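(* Let $\mu_1\ge\mu_2\ge0$, $N>0$, $g_1,g_2\in L^\infty(0,\infty;H)$, $\mathfrak g_j=\sup_{t\ge0}|g_j(t)|/\nu^2$, $\mathfrak g^2=\mathfrak g_1^2+\mathfrak g_2^2$, and let $(v_1,v_2)$ be the global strong solution of the symmetric nudging intertwinement $$\begin{aligned}\tfrac{dv_1}{dt}+\nu Av_1+B(v_1,v_1)&=g_1-\mu_1P_Nv_1+\mu_2P_Nv_2,\\ \tfrac{dv_2}{dt}+\nu Av_2+B(v_2,v_2)&=g_2+\mu_2P_Nv_1-\mu_1P_Nv_2,\end{aligned}$$ with arbitrary initial data $(v_0^1,v_0^2)\in V\times V$. Suppose $N\ge 4C_L\mathfrak g$. If $|P_Nv_1(t)-P_Nv_2(t)|\to0$ and $|g_1(t)-g_2(t)|\to0$ as $t\to\infty$, then $|v_1(t)-v_2(t)|\to0$ as $t\to\infty$.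
   Context: Let $\Omega=[0,2\pi]^2$ with periodic boundary conditions. $H$ is the space of $2\pi$-periodic, divergence-free, mean-free vector fields in $L^2(\Omega)^2$, with inner product $(u,v)=\int_\Omega u\cdot v\,dx$ and norm $|u|=(u,u)^{1/2}$; $V$ is the subspace of $H$ consisting of fields in $H^1$, with norm $\|u\|=|\nabla u|$. $\mathbb P$ is the Leray projection, $A=-\mathbb P\Delta$ is the Stokes operator with domain $D(A)$, and $B(u,v)=\mathbb P((u\cdot\nabla)v)$. For real $N>0$, $P_N$ is the orthogonal projection onto the Fourier modes with wavenumbers $k\in\mathbb Z^2\setminus\{0\}$, $|k|\le N$, and $Q_N=I-P_N$. $\nu>0$ is the viscosity. $C_L,C_A,C_S$ are absolute constants such that $\|u\|_{L^4}^2\le C_L\|u\||u|$, $\|u\|_{L^\infty}^2\le C_A|Au||u|$ and $\|P_Nu\|_{L^\infty}\le C_S(\ln N)^{1/2}\|P_Nu\|$. Global strong solution: $v_j\in C([0,T];V)\cap L^2(0,T;D(A))$ for every $T>0$. *)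

theory Defs
  imports "HOL-Analysis.Analysis"
begin

text \<open>2D periodic vector fields on [0,2pi]^2 represented by their Fourier coefficients:
  u(x) = sum over k in Z^2 of u k * exp(i k.x), with u k = (first component, second component).\<close>

type_synonym vfield = "int \<times> int \<Rightarrow> complex \<times> complex"

definition ksq :: "int \<times> int \<Rightarrow> real" where
  "ksq k = (real_of_int (fst k))\<^sup>2 + (real_of_int (snd k))\<^sup>2"

definition cnorm2 :: "complex \<times> complex \<Rightarrow> real" where
  "cnorm2 z = (cmod (fst z))\<^sup>2 + (cmod (snd z))\<^sup>2"

definition vdiff :: "vfield \<Rightarrow> vfield \<Rightarrow> vfield" where
  "vdiff u w = (\<lambda>k. (fst (u k) - fst (w k), snd (u k) - snd (w k)))"

text \<open>The space H: real-valued (conjugate symmetric coefficients), mean free,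
  divergence free, square integrable.\<close>
definition inH :: "vfield \<Rightarrow> bool" where
  "inH u \<longleftrightarrow> u (0,0) = (0,0)
     \<and> (\<forall>k. u (- fst k, - snd k) = (cnj (fst (u k)), cnj (snd (u k))))
     \<and> (\<forall>k. of_int (fst k) * fst (u k) + of_int (snd k) * snd (u k) = 0)
     \<and> (\<lambda>k. cnorm2 (u k)) summable_on UNIV"

text \<open>|u| (L2 norm, via Parseval).\<close>
definition normH :: "vfield \<Rightarrow> real" where
  "normH u = sqrt (4 * pi\<^sup>2 * (\<Sum>\<^sub>\<infinity>k. cnorm2 (u k)))"

definition inV :: "vfield \<Rightarrow> bool" where
  "inV u \<longleftrightarrow> inH u \<and> (\<lambda>k. ksq k * cnorm2 (u k)) summable_on UNIV"

definition normV :: "vfield \<Rightarrow> real" where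
  "normV u = sqrt (4 * pi\<^sup>2 * (\<Sum>\<^sub>\<infinity>k. ksq k * cnorm2 (u k)))"

definition inDA :: "vfield \<Rightarrow> bool" where
  "inDA u \<longleftrightarrow> inH u \<and> (\<lambda>k. (ksq k)\<^sup>2 * cnorm2 (u k)) summable_on UNIV"

definition stokesA :: "vfield \<Rightarrow> vfield" where
  "stokesA u = (\<lambda>k. (of_real (ksq k) * fst (u k), of_real (ksq k) * snd (u k)))"

definition projP :: "real \<Rightarrow> vfield \<Rightarrow> vfield" where
  "projP N u = (\<lambda>k. if k \<noteq> (0,0) \<and> sqrt (ksq k) \<le> N then u k else (0,0))"

text \<open>Fourier coefficients of (u . grad) v  (absolutely convergent convolution).\<close>
definition convect :: "vfield \<Rightarrow> vfield \<Rightarrow> vfield" where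
  "convect u v = (\<lambda>k.
     let c = (\<lambda>j. \<i> * (of_int (fst k - fst j) * fst (u j) + of_int (snd k - snd j) * snd (u j))) in
     ((\<Sum>\<^sub>\<infinity>j. c j * fst (v (fst k - fst j, snd k - snd j))),
      (\<Sum>\<^sub>\<infinity>j. c j * snd (v (fst k - fst j, snd k - snd j)))))"

definition leray :: "vfield \<Rightarrow> vfield" where
  "leray w = (\<lambda>k. if k = (0,0) then (0,0) else
     let d = (of_int (fst k) * fst (w k) + of_int (snd k) * snd (w k)) / of_real (ksq k) in
     (fst (w k) - d * of_int (fst k), snd (w k) - d * of_int (snd k)))"

definition bilinB :: "vfield \<Rightarrow> vfield \<Rightarrow> vfield" where
  "bilinB u v = leray (convect u v)"

text \<open>||u||_{L4}^2 = || |u|^2 ||_{L2}, computed via Parseval: |u|^2 has Fourier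
  coefficients c_k = sum_j u(j) . conj(u(j-k)).\<close>
definition L4sq :: "vfield \<Rightarrow> real" where
  "L4sq u = sqrt (4 * pi\<^sup>2 * (\<Sum>\<^sub>\<infinity>k. (cmod (\<Sum>\<^sub>\<infinity>j.
      fst (u j) * cnj (fst (u (fst j - fst k, snd j - snd k)))
    + snd (u j) * cnj (snd (u (fst j - fst k, snd j - snd k)))))\<^sup>2))"

definition rhs :: "real \<Rightarrow> real \<Rightarrow> real \<Rightarrow> real \<Rightarrow> vfield \<Rightarrow> vfield \<Rightarrow> vfield \<Rightarrow> vfield" where
  "rhs \<nu> mua mub N gt u w = (\<lambda>k.
     let c = (\<lambda>i :: complex \<times> complex \<Rightarrow> complex.
        i (gt k) - of_real \<nu> * i (stokesA u k) - i (bilinB u u k)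
        - of_real mua * i (projP N u k) + of_real mub * i (projP N w k)) in
     (c fst, c snd))"

definition cont_V :: "(real \<Rightarrow> vfield) \<Rightarrow> real \<Rightarrow> bool" where
  "cont_V v T \<longleftrightarrow> (\<forall>t\<in>{0..T}. inV (v t)) \<and>
     (\<forall>t\<in>{0..T}. ((\<lambda>s. normV (vdiff (v s) (v t))) \<longlongrightarrow> 0) (at t within {0..T}))"

definition L2_DA :: "(real \<Rightarrow> vfield) \<Rightarrow> real \<Rightarrow> bool" where
  "L2_DA v T \<longleftrightarrow> (AE t in lborel. t \<in> {0..T} \<longrightarrow> inDA (v t)) \<and>
     set_integrable lborel {0..T} (\<lambda>t. (normH (stokesA (v t)))\<^sup>2)"

text \<open>g in L^infty(0,infty;H) (with pointwise sup bound, as the paper uses sup).\<close>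
definition Linf_H :: "(real \<Rightarrow> vfield) \<Rightarrow> bool" where
  "Linf_H g \<longleftrightarrow> (\<forall>t\<ge>0. inH (g t)) \<and> (\<exists>M. \<forall>t\<ge>0. normH (g t) \<le> M) \<and>
     (\<forall>k. (\<lambda>t. g t k) \<in> borel_measurable lborel)"

definition nudging_solution ::
  "real \<Rightarrow> real \<Rightarrow> real \<Rightarrow> real \<Rightarrow> (real \<Rightarrow> vfield) \<Rightarrow> (real \<Rightarrow> vfield)
   \<Rightarrow> (real \<Rightarrow> vfield) \<Rightarrow> (real \<Rightarrow> vfield) \<Rightarrow> bool" where
  "nudging_solution \<nu> mu1 mu2 N g1 g2 v1 v2 \<longleftrightarrow>
     inV (v1 0) \<and> inV (v2 0) \<and>
     (\<forall>T>0. cont_V v1 T \<and> cont_V v2 T \<and> L2_DA v1 T \<and> L2_DA v2 T) \<and>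
     (\<forall>k. \<forall>t\<ge>0. \<forall>i\<in>{fst, snd}.
        set_integrable lborel {0..t} (\<lambda>s. i (rhs \<nu> mu1 mu2 N (g1 s) (v1 s) (v2 s) k)) \<and>
        i (v1 t k) = i (v1 0 k) + set_lebesgue_integral lborel {0..t}
                       (\<lambda>s. i (rhs \<nu> mu1 mu2 N (g1 s) (v1 s) (v2 s) k)) \<and>
        set_integrable lborel {0..t} (\<lambda>s. i (rhs \<nu> mu1 mu2 N (g2 s) (v2 s) (v1 s) k)) \<and>
        i (v2 t k) = i (v2 0 k) + set_lebesgue_integral lborel {0..t}
                       (\<lambda>s. i (rhs \<nu> mu1 mu2 N (g2 s) (v2 s) (v1 s) k)))"

definition gfrak :: "real \<Rightarrow> (real \<Rightarrow> vfield) \<Rightarrow> real" where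
  "gfrak \<nu> g = (SUP t\<in>{0..}. normH (g t)) / \<nu>\<^sup>2"

end

theory Submission
  imports Defs
begin

text \<open>
  Write \<open>w = v1 - v2\<close>, \<open>p = P_N w\<close>, \<open>q = Q_N w\<close> and \<open>M = ||v1||^2 + ||v2||^2\<close>. Because
  \<open>mu1 \<ge> mu2\<close> the coupling terms only dissipate \<open>|v1|^2 + |v2|^2\<close>, so this energy stays bounded and
  the time average of \<open>M\<close> is asymptotically at most \<open>\<nu>^2 \<gamma>^2\<close>, where \<open>\<gamma>\<close> is the size of the forces.
  The coupling disappears from the equation of \<open>q\<close>, and
  \<open>B(v1,v1) - B(v2,v2) = B(v1,p) + B(v1,q) + B(p,v2) + B(q,v2)\<close>. Paired with \<open>q\<close>, the second term
  vanishes, the first and third are small with \<open>p\<close>, and the last is at most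
  \<open>C_L ||q|| |q| ||v2||\<close>. Young's inequality and \<open>N |q| \<le> ||q||\<close> give
  \<open>(|q|^2)' \<le> - (\<nu> N^2 - C_L^2 M / \<nu>) |q|^2 + o(1) (1 + M)\<close>, whose averaged decay rate is positive
  when \<open>N \<ge> 4 C_L \<gamma>\<close>.

  For almost every time both fields lie in \<open>D(A)\<close>, hence have absolutely summable Fourier
  coefficients, so all manipulations of the nonlinear term are rearrangements of absolutely
  convergent sums.
\<close>

section \<open>Sums over Fourier modes and the trilinear form\<close>

text \<open>A solution is given only through the integrated equation of each Fourier coefficient,
  and the squared norms are not known to be differentiable. Energy estimates are therefore derived
  mode by mode and then summed; dominated convergence rests on a majorant that is affine in |A v1|^2
  + |A v2|^2 and hence integrable in time. The outcome is an inequality between increments and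
  integrals, and the Gronwall argument has to start from that, with a decay coefficient that may
  change sign and is controlled only through its integral. Norms are replaced by sums over
  coefficients, |u|^2 = 4 pi^2 \<open>msq u\<close>. In this normalization the constant of the L4
  inequality becomes 2 pi C_L, while the bound for the averaged \<open>M\<close> acquires a factor 1
  / (4 pi^2); the powers of pi cancel, and the averaged loss of decay is at most C_L^2 \<nu>
  \<gamma>^2, that is \<nu> N^2 / 16. The large margin pays for an artificial increase of the
  coefficient of \<open>M\<close>. That increase is what makes the error o(1) M manageable, since
  only time averages of \<open>M\<close> are bounded.\<close>

lemma infsum_CS:
  fixes f g :: "'k \<Rightarrow> real"
  assumes f: "(\<lambda>k. (f k)\<^sup>2) summable_on A" and g: "(\<lambda>k. (g k)\<^sup>2) summable_on A"
  shows "(\<lambda>k. \<bar>f k * g k\<bar>) summable_on A"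
    and "(\<Sum>\<^sub>\<infinity>k\<in>A. \<bar>f k * g k\<bar>) \<le> sqrt (\<Sum>\<^sub>\<infinity>k\<in>A. (f k)\<^sup>2) * sqrt (\<Sum>\<^sub>\<infinity>k\<in>A. (g k)\<^sup>2)"
proof -
  have bound: "(\<Sum>k\<in>F. \<bar>f k * g k\<bar>) \<le> sqrt (\<Sum>\<^sub>\<infinity>k\<in>A. (f k)\<^sup>2) * sqrt (\<Sum>\<^sub>\<infinity>k\<in>A. (g k)\<^sup>2)"
    if "finite F" "F \<subseteq> A" for F
  proof -
    have "(\<Sum>k\<in>F. \<bar>f k * g k\<bar>) \<le> L2_set f F * L2_set g F"
      using L2_set_mult_ineq[of f g F] by (simp add: abs_mult)
    also have "\<dots> \<le> sqrt (\<Sum>\<^sub>\<infinity>k\<in>A. (f k)\<^sup>2) * sqrt (\<Sum>\<^sub>\<infinity>k\<in>A. (g k)\<^sup>2)"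
      unfolding L2_set_def using that
      by (intro mult_mono real_sqrt_le_mono finite_sum_le_infsum f g)
        (auto intro!: sum_nonneg infsum_nonneg)
    finally show ?thesis .
  qed
  show s: "(\<lambda>k. \<bar>f k * g k\<bar>) summable_on A"
    by (rule nonneg_bdd_above_summable_on) (auto intro!: bdd_aboveI2 bound)
  show "(\<Sum>\<^sub>\<infinity>k\<in>A. \<bar>f k * g k\<bar>) \<le> sqrt (\<Sum>\<^sub>\<infinity>k\<in>A. (f k)\<^sup>2) * sqrt (\<Sum>\<^sub>\<infinity>k\<in>A. (g k)\<^sup>2)"
    using s by (intro infsum_le_finite_sums bound) auto
qed

lemma bij_add_left: "bij ((+) (j :: 'a::ab_group_add))"
  by (rule bij_betwI[where g = "\<lambda>k. k - j"]) auto

lemma summable_on_shift: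
  "(\<lambda>l. b (j + l)) summable_on UNIV \<longleftrightarrow> b summable_on (UNIV :: 'a::ab_group_add set)"
  using summable_on_reindex_bij_betw[OF bij_add_left, of b j] by simp

lemma infsum_shift:
  "(\<Sum>\<^sub>\<infinity>l. b (j + l)) = (\<Sum>\<^sub>\<infinity>l\<in>(UNIV :: 'a::ab_group_add set). b l)"
  using infsum_reindex_bij_betw[OF bij_add_left, of b j] by simp

text \<open>For fixed \<open>j\<close>, Cauchy-Schwarz in \<open>l\<close> and the shift invariance
  of the sum of squares of \<open>b\<close> give a bound independent of \<open>j\<close>; summing
  over \<open>j\<close> then costs only the l1 norm of \<open>f\<close>. This is the convergence
  criterion for all trilinear forms below.\<close>

lemma triple_sum_l1_l2_l2:
  fixes f a b :: "'k::ab_group_add \<Rightarrow> real"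
  assumes f0: "\<And>j. f j \<ge> 0" and a0: "\<And>j. a j \<ge> 0" and b0: "\<And>j. b j \<ge> 0"
    and f: "f summable_on UNIV" and a: "(\<lambda>k. (a k)\<^sup>2) summable_on UNIV"
    and b: "(\<lambda>k. (b k)\<^sup>2) summable_on UNIV"
  shows "(\<lambda>(j, l). f j * (a l * b (j + l))) summable_on UNIV"
    and "(\<Sum>\<^sub>\<infinity>(j, l). f j * (a l * b (j + l)))
      \<le> (\<Sum>\<^sub>\<infinity>j. f j) * (sqrt (\<Sum>\<^sub>\<infinity>k. (a k)\<^sup>2) * sqrt (\<Sum>\<^sub>\<infinity>k. (b k)\<^sup>2))"
proof -
  let ?C = "sqrt (\<Sum>\<^sub>\<infinity>k. (a k)\<^sup>2) * sqrt (\<Sum>\<^sub>\<infinity>k. (b k)\<^sup>2)"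
  have bs: "(\<lambda>k. (b (j + k))\<^sup>2) summable_on UNIV" for j
    using b summable_on_shift[of "\<lambda>k. (b k)\<^sup>2" j] by simp
  have s: "(\<lambda>l. a l * b (j + l)) summable_on UNIV" for j
    using infsum_CS(1)[OF a bs[of j]] a0 b0 by (simp add: abs_mult)
  have le: "(\<Sum>\<^sub>\<infinity>l. a l * b (j + l)) \<le> ?C" for j
    using infsum_CS(2)[OF a bs[of j]] a0 b0 infsum_shift[of "\<lambda>k. (b k)\<^sup>2" j] by (simp add: abs_mult)
  have s2: "(\<lambda>l. f j * (a l * b (j + l))) summable_on UNIV" for j
    by (rule summable_on_cmult_right) (rule s)
  have e: "(\<Sum>\<^sub>\<infinity>l. f j * (a l * b (j + l))) = f j * (\<Sum>\<^sub>\<infinity>l. a l * b (j + l))" for j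
    by (rule infsum_cmult_right) (use s in blast)
  have s3: "(\<lambda>j. f j * ?C) summable_on UNIV"
    by (rule summable_on_cmult_left) (rule f)
  have le2: "(\<Sum>\<^sub>\<infinity>l. f j * (a l * b (j + l))) \<le> f j * ?C" for j
    unfolding e by (intro mult_left_mono le f0)
  have s4: "(\<lambda>j. \<Sum>\<^sub>\<infinity>l. f j * (a l * b (j + l))) summable_on UNIV"
    by (rule summable_on_comparison_test[OF s3 le2]) (auto intro!: infsum_nonneg simp: f0 a0 b0)
  have S: "(\<lambda>(j, l). f j * (a l * b (j + l))) summable_on (SIGMA j:UNIV. UNIV)"
    using s4 by (intro summable_on_SigmaI[where g = "\<lambda>j. \<Sum>\<^sub>\<infinity>l. f j * (a l * b (j + l))"])
      (auto simp: f0 a0 b0 s2)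
  then show S': "(\<lambda>(j, l). f j * (a l * b (j + l))) summable_on UNIV" by simp
  have "(\<Sum>\<^sub>\<infinity>(j, l). f j * (a l * b (j + l))) = (\<Sum>\<^sub>\<infinity>j. \<Sum>\<^sub>\<infinity>l. f j * (a l * b (j + l)))"
    using infsum_Sigma'_banach[OF S] by simp
  also have "\<dots> \<le> (\<Sum>\<^sub>\<infinity>j. f j * ?C)"
    by (intro infsum_mono s4 s3 le2)
  also have "\<dots> = (\<Sum>\<^sub>\<infinity>j. f j) * ?C"
    by (rule infsum_cmult_left) (use f in blast)
  finally show "(\<Sum>\<^sub>\<infinity>(j, l). f j * (a l * b (j + l))) \<le> (\<Sum>\<^sub>\<infinity>j. f j) * ?C" .
qed


section \<open>Symbols of single modes and the double series of the trilinear form\<close>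

lemma cnorm2_eq: "cnorm2 z = (norm z)\<^sup>2"
  by (simp add: cnorm2_def norm_prod_def)

lemma ksq_nonneg [simp]: "ksq k \<ge> 0"
  by (simp add: ksq_def)

lemma ksq_uminus [simp]: "ksq (- k) = ksq k"
  by (simp add: ksq_def)

lemma ksq_ge_1: "k \<noteq> 0 \<Longrightarrow> ksq k \<ge> 1"
proof -
  assume "k \<noteq> 0"
  then have "(fst k)\<^sup>2 + (snd k)\<^sup>2 \<noteq> 0"
    by (simp add: prod_eq_iff sum_power2_eq_zero_iff)
  then have "(fst k)\<^sup>2 + (snd k)\<^sup>2 \<ge> 1"
    by (smt (verit) sum_power2_ge_zero)
  then have "real_of_int ((fst k)\<^sup>2 + (snd k)\<^sup>2) \<ge> 1" by linarith
  then show ?thesis by (simp add: ksq_def)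
qed

text \<open>The factor \<open>\<i> * dotk l (u j)\<close> is the symbol of u . grad when mode
  \<open>j\<close> of u acts on mode \<open>l\<close>; \<open>dotk k (u k) = 0\<close> for all
  \<open>k\<close> says that u is divergence free.\<close>

definition dotk :: "int \<times> int \<Rightarrow> complex \<times> complex \<Rightarrow> complex" where
  "dotk l z = of_int (fst l) * fst z + of_int (snd l) * snd z"

definition hdot :: "complex \<times> complex \<Rightarrow> complex \<times> complex \<Rightarrow> complex" where
  "hdot z w = fst z * cnj (fst w) + snd z * cnj (snd w)"

lemma cmod_dot2_le: "cmod (a * b + c * d) \<le> sqrt ((cmod a)\<^sup>2 + (cmod c)\<^sup>2) * sqrt ((cmod b)\<^sup>2 + (cmod d)\<^sup>2)"
proof -
  have "cmod (a * b + c * d) \<le> cmod a * cmod b + cmod c * cmod d"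
    by (metis norm_mult norm_triangle_ineq)
  also have "\<dots> = (cmod a, cmod c) \<bullet> (cmod b, cmod d)" by simp
  also have "\<dots> \<le> norm (cmod a, cmod c) * norm (cmod b, cmod d)"
    by (rule norm_cauchy_schwarz)
  finally show ?thesis by (simp add: norm_Pair)
qed

lemma cmod_dotk_le: "cmod (dotk l z) \<le> sqrt (ksq l) * norm z"
  unfolding dotk_def ksq_def norm_prod_def
  using cmod_dot2_le[of "of_int (fst l)" "fst z" "of_int (snd l)" "snd z"] by simp

lemma cmod_hdot_le: "cmod (hdot z w) \<le> norm z * norm w"
  unfolding hdot_def norm_prod_def
  using cmod_dot2_le[of "fst z" "cnj (fst w)" "snd z" "cnj (snd w)"] by simp

text \<open>Energy identities use the real inner product, convolutions the complex one; the real
  part links the two.\<close>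

lemma inner_eq_Re_hdot: "inner z w = Re (hdot z w)"
  by (simp add: hdot_def inner_prod_def inner_complex_def)

text \<open>Summed over all pairs \<open>(j, l)\<close>, and up to the factor \<open>4 pi^2\<close>, this is the trilinear
  form \<open>(B(u,v), w)\<close>.\<close>
definition tri :: "vfield \<Rightarrow> vfield \<Rightarrow> vfield \<Rightarrow> (int \<times> int) \<times> (int \<times> int) \<Rightarrow> real" where
  "tri u v w = (\<lambda>(j, l). Re (\<i> * dotk l (u j) * hdot (v l) (w (j + l))))"

text \<open>Absolute majorant of \<open>tri\<close>, with the derivative weight on \<open>v\<close>.
  Its summability is the condition under which the double series is rearranged.\<close>

definition tri_bound :: "vfield \<Rightarrow> vfield \<Rightarrow> vfield \<Rightarrow> (int \<times> int) \<times> (int \<times> int) \<Rightarrow> real" where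
  "tri_bound u v w = (\<lambda>(j, l). norm (u j) * ((sqrt (ksq l) * norm (v l)) * norm (w (j + l))))"

lemma abs_tri_le: "\<bar>tri u v w p\<bar> \<le> tri_bound u v w p"
proof -
  obtain j l where Pair: "p = (j, l)" by (rule prod.exhaust)
  have "\<bar>tri u v w p\<bar> \<le> cmod (\<i> * dotk l (u j) * hdot (v l) (w (j + l)))"
    unfolding Pair tri_def by (simp only: prod.case abs_Re_le_cmod)
  also have "\<dots> = cmod (dotk l (u j)) * cmod (hdot (v l) (w (j + l)))" by (simp add: norm_mult)
  also have "\<dots> \<le> (sqrt (ksq l) * norm (u j)) * (norm (v l) * norm (w (j + l)))"
    by (intro mult_mono cmod_dotk_le cmod_hdot_le) auto
  finally show ?thesis by (simp add: Pair tri_bound_def mult_ac)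
qed

lemma tri_summable: "tri_bound u v w summable_on UNIV \<Longrightarrow> tri u v w summable_on UNIV"
  by (rule abs_summable_summable, rule summable_on_comparison_test)
    (use abs_tri_le in auto)

lemma infsum_tri_le:
  assumes "tri_bound u v w summable_on UNIV"
  shows "\<bar>infsum (tri u v w) UNIV\<bar> \<le> infsum (tri_bound u v w) UNIV"
  using norm_infsum_le[OF has_sum_infsum[OF tri_summable[OF assms]] has_sum_infsum[OF assms]] abs_tri_le
  by auto

text \<open>The value type is left open because the same notion serves vector fields, the scalar
  sequences \<open>grad u\<close> and pairs of fields.\<close>

definition l2 :: "('k \<Rightarrow> 'a::real_normed_vector) \<Rightarrow> bool" where
  "l2 u \<longleftrightarrow> (\<lambda>k. (norm (u k))\<^sup>2) summable_on UNIV"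

text \<open>For a vector field this is |u|^2 / (4 pi^2), and \<open>msq (grad u)\<close> is ||u||^2
  / (4 pi^2).\<close>

definition msq :: "('k \<Rightarrow> 'a::real_normed_vector) \<Rightarrow> real" where
  "msq u = (\<Sum>\<^sub>\<infinity>k. (norm (u k))\<^sup>2)"

definition grad :: "vfield \<Rightarrow> int \<times> int \<Rightarrow> real" where
  "grad u k = sqrt (ksq k) * norm (u k)"

lemma msq_nonneg [simp]: "msq u \<ge> 0"
  unfolding msq_def by (intro infsum_nonneg) auto

lemma grad_nonneg [simp]: "grad u k \<ge> 0"
  by (simp add: grad_def)

lemma grad_sq: "(grad u k)\<^sup>2 = ksq k * (norm (u k))\<^sup>2"
  by (simp add: grad_def power_mult_distrib)

lemma l2_CS:
  fixes u :: "'k \<Rightarrow> 'a::real_normed_vector" and v :: "'k \<Rightarrow> 'b::real_normed_vector"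
  assumes "l2 u" "l2 v"
  shows "(\<lambda>k. norm (u k) * norm (v k)) summable_on UNIV"
    and "(\<Sum>\<^sub>\<infinity>k. norm (u k) * norm (v k)) \<le> sqrt (msq u) * sqrt (msq v)"
  using infsum_CS[of "\<lambda>k. norm (u k)" UNIV "\<lambda>k. norm (v k)"] assms
  by (auto simp: l2_def msq_def abs_mult)

lemma tri_bound_l1_first:
  assumes u: "(\<lambda>k. norm (u k)) summable_on UNIV" and v: "l2 (grad v)" and w: "l2 w"
  shows "tri_bound u v w summable_on UNIV"
    and "infsum (tri_bound u v w) UNIV \<le> (\<Sum>\<^sub>\<infinity>k. norm (u k)) * (sqrt (msq (grad v)) * sqrt (msq w))"
  using triple_sum_l1_l2_l2[of "\<lambda>k. norm (u k)" "grad v" "\<lambda>k. norm (w k)"] assms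
  by (auto simp: l2_def msq_def tri_bound_def grad_def)

text \<open>Exchanging the two summation indices puts the absolutely summable factor first again. It
  serves for v = P_N w, whose gradient has finitely many modes.\<close>

lemma tri_bound_l1_second:
  assumes u: "l2 u" and v: "grad v summable_on UNIV" and w: "l2 w"
  shows "tri_bound u v w summable_on UNIV"
    and "infsum (tri_bound u v w) UNIV \<le> infsum (grad v) UNIV * (sqrt (msq u) * sqrt (msq w))"
proof -
  note c = triple_sum_l1_l2_l2[of "grad v" "\<lambda>k. norm (u k)" "\<lambda>k. norm (w k)"]
  have sw: "bij_betw prod.swap (UNIV :: ((int \<times> int) \<times> (int \<times> int)) set) UNIV"
    by (rule bij_betwI[where g = prod.swap]) auto
  have eq: "tri_bound u v w (prod.swap p) = (case p of (j, l) \<Rightarrow> grad v j * (norm (u l) * norm (w (j + l))))" for p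
    by (auto simp: tri_bound_def grad_def mult_ac add.commute split: prod.split)
  show "tri_bound u v w summable_on UNIV"
    using c(1) assms summable_on_reindex_bij_betw[OF sw, of "tri_bound u v w"] unfolding eq
    by (auto simp: l2_def)
  show "infsum (tri_bound u v w) UNIV \<le> infsum (grad v) UNIV * (sqrt (msq u) * sqrt (msq w))"
    using c(2) assms infsum_reindex_bij_betw[OF sw, of "tri_bound u v w"] unfolding eq
    by (auto simp: l2_def msq_def)
qed

text \<open>Pairing sums over the output mode k = j + l outside and over j inside,
  \<open>tri\<close> over the pairs (j, l); the bijection (k, j) to (j, k - j) and Fubini identify
  them. Each single coefficient of the convolution converges by Cauchy-Schwarz.\<close>

lemma convect_pairing:
  assumes u: "l2 u" and v: "l2 (grad v)" and S: "tri_bound u v w summable_on UNIV"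
  shows "((\<lambda>k. inner (convect u v k) (w k)) has_sum infsum (tri u v w) UNIV) UNIV"
    and "(\<lambda>k. \<bar>inner (convect u v k) (w k)\<bar>) summable_on UNIV"
    and "(\<Sum>\<^sub>\<infinity>k. \<bar>inner (convect u v k) (w k)\<bar>) \<le> infsum (tri_bound u v w) UNIV"
proof -
  define \<phi> :: "(int \<times> int) \<times> (int \<times> int) \<Rightarrow> (int \<times> int) \<times> (int \<times> int)"
    where "\<phi> = (\<lambda>(k, j). (j, k - j))"
  have b: "bij_betw \<phi> UNIV UNIV"
    by (rule bij_betwI[where g = "\<lambda>(j, l). (j + l, j)"]) (auto simp: \<phi>_def)
  have comp: "((\<lambda>j. tri u v w (\<phi> (k, j))) has_sum inner (convect u v k) (w k)) UNIV" for k
  proof -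
    have bk: "bij_betw (\<lambda>j. k - j) (UNIV :: (int \<times> int) set) UNIV"
      by (rule bij_betwI[where g = "\<lambda>j. k - j"]) auto
    have gs: "l2 (\<lambda>j. grad v (k - j))"
      using v summable_on_reindex_bij_betw[OF bk, of "\<lambda>j. (norm (grad v j))\<^sup>2"] by (simp add: l2_def)
    have s0: "(\<lambda>j. norm (u j) * grad v (k - j)) summable_on UNIV"
      using l2_CS(1)[OF u gs] by simp
    define c where "c = (\<lambda>j. \<i> * dotk (k - j) (u j))"
    have s: "(\<lambda>j. c j * f (v (k - j))) summable_on UNIV"
      if f: "\<And>z. cmod (f z) \<le> norm z" for f :: "complex \<times> complex \<Rightarrow> complex"
    proof (rule abs_summable_summable, rule summable_on_comparison_test[OF s0])
      fix j
      have "norm (c j * f (v (k - j))) = cmod (dotk (k - j) (u j)) * cmod (f (v (k - j)))"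
        by (simp add: c_def norm_mult)
      also have "\<dots> \<le> (sqrt (ksq (k - j)) * norm (u j)) * norm (v (k - j))"
        by (intro mult_mono cmod_dotk_le f) auto
      finally show "norm (c j * f (v (k - j))) \<le> norm (u j) * grad v (k - j)"
        by (simp add: grad_def mult_ac)
    qed auto
    have conv: "convect u v k = ((\<Sum>\<^sub>\<infinity>j. c j * fst (v (k - j))), (\<Sum>\<^sub>\<infinity>j. c j * snd (v (k - j))))"
      unfolding convect_def c_def dotk_def Let_def by (simp add: minus_prod_def)
    have hs: "((\<lambda>j. c j * fst (v (k - j))) has_sum fst (convect u v k)) UNIV"
      "((\<lambda>j. c j * snd (v (k - j))) has_sum snd (convect u v k)) UNIV"
      unfolding conv fst_conv snd_conv
      by (intro has_sum_infsum s, metis norm_fst_le norm_snd_le prod.collapse)+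
    have "((\<lambda>j. Re (c j * fst (v (k - j)) * cnj (fst (w k)) + c j * snd (v (k - j)) * cnj (snd (w k))))
      has_sum Re (fst (convect u v k) * cnj (fst (w k)) + snd (convect u v k) * cnj (snd (w k)))) UNIV"
      by (intro has_sum_Re has_sum_add has_sum_cmult_left hs)
    moreover have "tri u v w (\<phi> (k, j)) = Re (c j * fst (v (k - j)) * cnj (fst (w k)) + c j * snd (v (k - j)) * cnj (snd (w k)))" for j
      by (simp only: tri_def \<phi>_def prod.case c_def hdot_def) (simp add: algebra_simps)
    ultimately show ?thesis by (simp add: inner_eq_Re_hdot hdot_def)
  qed
  have S1: "(\<lambda>p. tri_bound u v w (\<phi> p)) summable_on (SIGMA k:UNIV. UNIV)"
    using S summable_on_reindex_bij_betw[OF b, of "tri_bound u v w"] by simp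
  have S2: "(\<lambda>p. tri u v w (\<phi> p)) summable_on (SIGMA k:UNIV. UNIV)"
    using tri_summable[OF S] summable_on_reindex_bij_betw[OF b, of "tri u v w"] by simp
  have "((\<lambda>p. tri u v w (\<phi> p)) has_sum infsum (tri u v w) UNIV) (SIGMA k:UNIV. UNIV)"
    using S2 infsum_reindex_bij_betw[OF b, of "tri u v w"] by (simp add: has_sum_iff)
  from has_sum_SigmaD[OF this comp]
  show h: "((\<lambda>k. inner (convect u v k) (w k)) has_sum infsum (tri u v w) UNIV) UNIV" .
  have sk: "(\<lambda>j. tri_bound u v w (\<phi> (k, j))) summable_on UNIV" for k
    using summable_on_SigmaD1[of "\<lambda>k j. tri_bound u v w (\<phi> (k, j))" UNIV "\<lambda>_. UNIV" k] S1
    by (simp add: case_prod_unfold)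
  have le: "\<bar>inner (convect u v k) (w k)\<bar> \<le> (\<Sum>\<^sub>\<infinity>j. tri_bound u v w (\<phi> (k, j)))" for k
    using norm_infsum_le[OF comp[of k] has_sum_infsum[OF sk[of k]]] abs_tri_le by auto
  have s5: "(\<lambda>k. \<Sum>\<^sub>\<infinity>j. tri_bound u v w (\<phi> (k, j))) summable_on UNIV"
    using summable_on_Sigma_banach[of "\<lambda>k j. tri_bound u v w (\<phi> (k, j))" UNIV "\<lambda>_. UNIV"] S1
    by (simp add: case_prod_unfold)
  show s6: "(\<lambda>k. \<bar>inner (convect u v k) (w k)\<bar>) summable_on UNIV"
    by (rule summable_on_comparison_test[OF s5]) (auto intro: le)
  have "(\<Sum>\<^sub>\<infinity>k. \<bar>inner (convect u v k) (w k)\<bar>) \<le> (\<Sum>\<^sub>\<infinity>k. \<Sum>\<^sub>\<infinity>j. tri_bound u v w (\<phi> (k, j)))"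
    by (intro infsum_mono s5 s6 le)
  also have "\<dots> = infsum (tri_bound u v w) UNIV"
    using infsum_Sigma'_banach[of "\<lambda>k j. tri_bound u v w (\<phi> (k, j))" UNIV "\<lambda>_. UNIV"] S1
      infsum_reindex_bij_betw[OF b, of "tri_bound u v w"] by (simp add: case_prod_unfold)
  finally show "(\<Sum>\<^sub>\<infinity>k. \<bar>inner (convect u v k) (w k)\<bar>) \<le> infsum (tri_bound u v w) UNIV" .
qed

text \<open>Fourier form of (u . grad v, v) = 0. The involution l to -(j + l) leaves the
  \<open>hdot\<close> factor unchanged, because v is real valued, and reverses the sign of
  \<open>dotk l (u j)\<close>, because u(j) is orthogonal to j. The sum thus equals its
  negative.\<close>

lemma tri_antisym:
  assumes div: "\<And>k. dotk k (u k) = 0"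
    and sym: "\<And>k. v (- k) = (cnj (fst (v k)), cnj (snd (v k)))"
  shows "infsum (tri u v v) UNIV = 0"
proof -
  define \<phi> :: "(int \<times> int) \<times> (int \<times> int) \<Rightarrow> (int \<times> int) \<times> (int \<times> int)"
    where "\<phi> = (\<lambda>(j, l). (j, - (j + l)))"
  have b: "bij_betw \<phi> UNIV UNIV"
    by (rule bij_betwI[where g = \<phi>]) (auto simp: \<phi>_def)
  have "tri u v v (\<phi> p) = - tri u v v p" for p
  proof -
    obtain j l where Pair: "p = (j, l)" by (rule prod.exhaust)
    have d: "dotk (- (j + l)) (u j) = - dotk l (u j)"
      using div[of j] by (simp add: dotk_def algebra_simps add_eq_0_iff)
    have h: "hdot (v (- (j + l))) (v (j + - (j + l))) = hdot (v l) (v (j + l))"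
      using sym[of "j + l"] sym[of l] by (simp add: hdot_def mult.commute)
    show ?thesis
      unfolding Pair tri_def \<phi>_def prod.case d h by simp
  qed
  then have "infsum (tri u v v) UNIV = (\<Sum>\<^sub>\<infinity>p. - tri u v v p)"
    using infsum_reindex_bij_betw[OF b, of "tri u v v"] by simp
  then show ?thesis by (simp add: infsum_uminus)
qed

section \<open>The L4 bound for the trilinear form\<close>

lemma summable_on_int_inverse_square: "(\<lambda>a::int. 1 / (1 + (real_of_int a)\<^sup>2)) summable_on UNIV"
proof -
  have n: "(\<lambda>n::nat. 1 / (1 + (real n)\<^sup>2)) summable_on UNIV"
  proof (rule summable_nonneg_imp_summable_on)
    show "summable (\<lambda>n::nat. 1 / (1 + (real n)\<^sup>2))"
    proof (rule summable_comparison_test_ev)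
      show "summable (\<lambda>n. inverse ((real n) ^ 2))"
        by (rule inverse_power_summable) simp
      \<comment> \<open>The comparison fails at n = 0, where the right-hand side is 0 by
        convention.\<close>
      show "\<forall>\<^sub>F n in sequentially. norm (1 / (1 + (real n)\<^sup>2)) \<le> inverse ((real n)\<^sup>2)"
        using eventually_gt_at_top[of 0] 
        by eventually_elim (auto simp: inverse_eq_divide intro!: divide_left_mono add_pos_nonneg mult_pos_pos)
    qed
  qed auto
  let ?f = "\<lambda>a::int. 1 / (1 + (real_of_int a)\<^sup>2)"
  have 1: "?f summable_on range int"
    using n by (subst summable_on_reindex) (auto simp: o_def)
  have 2: "?f summable_on range (\<lambda>n. - int n)"
    using n by (subst summable_on_reindex) (auto simp: o_def inj_def)
  have "(UNIV :: int set) = range int \<union> range (\<lambda>n. - int n)"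
    by (auto intro: int_cases2)
  then show ?thesis using summable_on_union[OF 1 2] by simp
qed

lemma summable_on_prod_mult:
  fixes f :: "'a \<Rightarrow> real" and g :: "'b \<Rightarrow> real"
  assumes "\<And>x. f x \<ge> 0" "\<And>x. g x \<ge> 0" "f summable_on UNIV" "g summable_on UNIV"
  shows "(\<lambda>(x, y). f x * g y) summable_on UNIV"
proof -
  have "(\<lambda>(x, y). f x * g y) summable_on (SIGMA x:UNIV. UNIV)"
    by (rule summable_on_SigmaI[where g = "\<lambda>x. f x * infsum g UNIV"])
      (auto intro!: has_sum_cmult_right summable_on_cmult_left assms simp: assms)
  then show ?thesis by simp
qed

text \<open>A replacement for the weight |k|^(-4) that factors, so that its summability over the
  lattice reduces to a one-dimensional series; its reciprocal is at most 3 |k|^4 for nonzero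
  k.\<close>

definition lattice_weight :: "int \<times> int \<Rightarrow> real" where
  "lattice_weight = (\<lambda>(a, b). 1 / (1 + (real_of_int a)\<^sup>2) * (1 / (1 + (real_of_int b)\<^sup>2)))"

lemma lattice_weight_nonneg: "lattice_weight k \<ge> 0"
  by (cases k) (simp add: lattice_weight_def)

lemma lattice_weight_summable: "lattice_weight summable_on UNIV"
  unfolding lattice_weight_def by (intro summable_on_prod_mult summable_on_int_inverse_square) auto

lemma norm_stokesA: "norm (stokesA u k) = ksq k * norm (u k)"
proof -
  have "stokesA u k = ksq k *\<^sub>R u k"
    by (rule prod_eqI) (simp_all add: stokesA_def scaleR_conv_of_real)
  then show ?thesis by simp
qed

lemma inDA_iff: "inDA u \<longleftrightarrow> inH u \<and> l2 (stokesA u)"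
  by (simp add: inDA_def l2_def norm_stokesA cnorm2_eq power_mult_distrib)

text \<open>Weighted arithmetic-geometric mean against \<open>lattice_weight\<close>. The bound is
  affine in |Au|^2 instead of linear in |Au|, because the square is the quantity known to be
  integrable in time.\<close>

lemma inDA_l1:
  assumes u: "inDA u"
  shows "(\<lambda>k. norm (u k)) summable_on UNIV"
    and "(\<Sum>\<^sub>\<infinity>k. norm (u k)) \<le> 2 * msq (stokesA u) + infsum lattice_weight UNIV"
proof -
  have pt: "norm (u k) \<le> 2 * (norm (stokesA u k))\<^sup>2 + lattice_weight k" for k
  proof (cases "k = 0")
    case True
    then have "u k = 0" using u by (simp add: inDA_def inH_def zero_prod_def)
    then show ?thesis using lattice_weight_nonneg by simp
  next
    case False
    obtain a b where k: "k = (a, b)" by force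
    define s where "s = ksq k"
    define m where "m = (1 + (real_of_int a)\<^sup>2) * (1 + (real_of_int b)\<^sup>2)"
    have s1: "s \<ge> 1" unfolding s_def by (rule ksq_ge_1[OF False])
    have sab: "s = (real_of_int a)\<^sup>2 + (real_of_int b)\<^sup>2" by (simp add: s_def ksq_def k)
    have m1: "m \<ge> 1" unfolding m_def by (simp add: mult_ge1_I)
    have "m = 1 + s + (real_of_int a)\<^sup>2 * (real_of_int b)\<^sup>2" by (simp add: m_def sab algebra_simps)
    also have "(real_of_int a)\<^sup>2 * (real_of_int b)\<^sup>2 \<le> s * s"
      unfolding sab by (intro mult_mono) auto
    also have "1 + s + s * s \<le> 3 * s\<^sup>2"
      using s1 mult_left_mono[OF s1, of s] unfolding power2_eq_square by linarith
    finally have ms: "m \<le> 3 * s\<^sup>2" by simp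
    \<comment> \<open>This gives 2 x \<le> m x^2 + 1/m for x = |u(k)|, where 1/m is the lattice
      weight of k.\<close>
    have "0 \<le> (norm (u k) * m - 1)\<^sup>2" by simp
    moreover have "((norm (u k))\<^sup>2 * m + 1 / m) * m = (norm (u k) * m)\<^sup>2 + 1"
      using m1 by (simp add: distrib_right power2_eq_square)
    ultimately have "2 * norm (u k) * m \<le> ((norm (u k))\<^sup>2 * m + 1 / m) * m"
      by (simp add: power2_diff)
    then have "2 * norm (u k) \<le> (norm (u k))\<^sup>2 * m + 1 / m"
      using m1 mult_le_cancel_right[of "2 * norm (u k)" m "(norm (u k))\<^sup>2 * m + 1 / m"] by linarith
    also have "(norm (u k))\<^sup>2 * m \<le> (norm (u k))\<^sup>2 * (3 * s\<^sup>2)"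
      using ms by (intro mult_left_mono) auto
    finally have "norm (u k) \<le> 3 / 2 * (s\<^sup>2 * (norm (u k))\<^sup>2) + (1 / m) / 2"
      by (simp add: algebra_simps)
    also have "\<dots> \<le> 2 * (s\<^sup>2 * (norm (u k))\<^sup>2) + 1 / m"
      using m1 by (intro add_mono mult_right_mono) (auto simp: divide_simps)
    finally show ?thesis by (simp add: k lattice_weight_def m_def s_def norm_stokesA power_mult_distrib)
  qed
  have sA: "(\<lambda>k. (norm (stokesA u k))\<^sup>2) summable_on UNIV"
    using u by (simp add: inDA_iff l2_def)
  have s: "(\<lambda>k. 2 * (norm (stokesA u k))\<^sup>2 + lattice_weight k) summable_on UNIV"
    by (intro summable_on_add summable_on_cmult_right lattice_weight_summable sA)
  show s1: "(\<lambda>k. norm (u k)) summable_on UNIV"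
    by (rule summable_on_comparison_test[OF s]) (auto intro: pt)
  have "(\<Sum>\<^sub>\<infinity>k. norm (u k)) \<le> (\<Sum>\<^sub>\<infinity>k. 2 * (norm (stokesA u k))\<^sup>2 + lattice_weight k)"
    by (intro infsum_mono s s1 pt)
  also have "\<dots> = 2 * msq (stokesA u) + infsum lattice_weight UNIV"
    unfolding msq_def
    by (subst infsum_add) (auto intro!: summable_on_cmult_right lattice_weight_summable sA simp: infsum_cmult_right')
  finally show "(\<Sum>\<^sub>\<infinity>k. norm (u k)) \<le> 2 * msq (stokesA u) + infsum lattice_weight UNIV" .
qed

section \<open>Correlations of absolutely summable sequences and quartic sums\<close>

lemma l1_bounded:
  fixes y :: "'k \<Rightarrow> 'a::real_normed_vector"
  assumes "(\<lambda>k. norm (y k)) summable_on UNIV"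
  shows "norm (y k) \<le> (\<Sum>\<^sub>\<infinity>k. norm (y k))"
  using finite_sum_le_infsum[OF assms, of "{k}"] by simp

lemma l1_imp_l2:
  assumes "(\<lambda>k. norm (y k)) summable_on UNIV"
  shows "l2 y"
  unfolding l2_def
proof (rule summable_on_comparison_test[OF summable_on_cmult_left[OF assms]])
  show "(norm (y k))\<^sup>2 \<le> norm (y k) * (\<Sum>\<^sub>\<infinity>k. norm (y k))" for k
    unfolding power2_eq_square by (intro mult_left_mono l1_bounded assms) auto
qed auto

text \<open>For functions X and Y with coefficients \<open>x\<close> and \<open>y\<close>, this is
  the coefficient of X times the conjugate of Y at the mode -l.\<close>

definition correlation :: "('k::ab_group_add \<Rightarrow> complex) \<Rightarrow> ('k \<Rightarrow> complex) \<Rightarrow> 'k \<Rightarrow> complex" where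
  "correlation x y l = (\<Sum>\<^sub>\<infinity>j. x j * cnj (y (j + l)))"

lemma correlation_has_sum:
  fixes x y :: "'k::ab_group_add \<Rightarrow> complex"
  assumes x: "(\<lambda>k. norm (x k)) summable_on UNIV" and y: "(\<lambda>k. norm (y k)) summable_on UNIV"
  shows "((\<lambda>j. x j * cnj (y (j + l))) has_sum correlation x y l) UNIV"
  unfolding correlation_def
proof (rule has_sum_infsum, rule abs_summable_summable,
    rule summable_on_comparison_test[OF summable_on_cmult_left[OF x]])
  show "norm (x j * cnj (y (j + l))) \<le> norm (x j) * (\<Sum>\<^sub>\<infinity>k. norm (y k))" for j
    using l1_bounded[OF y] by (simp add: norm_mult mult_left_mono)
qed auto

text \<open>Both sides count quadruples of modes with \<open>j + i' = i + j'\<close>; the reindexing exchanges the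
  roles of the two middle arguments.\<close>
lemma correlation_exchange:
  fixes x y x' y' :: "'k::ab_group_add \<Rightarrow> complex"
  assumes x: "(\<lambda>k. norm (x k)) summable_on UNIV" and y: "(\<lambda>k. norm (y k)) summable_on UNIV"
    and x': "(\<lambda>k. norm (x' k)) summable_on UNIV" and y': "(\<lambda>k. norm (y' k)) summable_on UNIV"
  obtains I where "((\<lambda>l. correlation x y l * cnj (correlation x' y' l)) has_sum I) UNIV"
    and "((\<lambda>l. correlation x x' l * cnj (correlation y y' l)) has_sum I) UNIV"
proof -
  define T where "T = (\<lambda>x y x' y' :: 'k \<Rightarrow> complex. \<lambda>(l, j, i).
    (x j * cnj (y (j + l))) * cnj (x' i * cnj (y' (i + l))))"
  have sum: "T x y x' y' summable_on UNIV"
    if x: "(\<lambda>k. norm (x k)) summable_on UNIV" and y: "(\<lambda>k. norm (y k)) summable_on UNIV"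
      and x': "(\<lambda>k. norm (x' k)) summable_on UNIV" and y': "(\<lambda>k. norm (y' k)) summable_on UNIV"
    for x y x' y'
  proof -
    \<comment> \<open>One factor, \<open>y'\<close>, is bounded by its l1 norm; the other three
      depend on the independent indices j, i and m = j + l, so their product is summable.\<close>
    define P where "P = (\<lambda>(j, p). norm (x j) * (case p of (i, m) \<Rightarrow> norm (x' i) * norm (y m)))"
    have P: "P summable_on UNIV"
      unfolding P_def by (intro summable_on_prod_mult x x' y) (auto split: prod.split)
    define \<phi> :: "'k \<times> 'k \<times> 'k \<Rightarrow> 'k \<times> 'k \<times> 'k" where "\<phi> = (\<lambda>(l, j, i). (j, i, j + l))"
    have b: "bij_betw \<phi> UNIV UNIV"
      by (rule bij_betwI[where g = "\<lambda>(j, i, m). (m - j, j, i)"]) (auto simp: \<phi>_def)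
    have "(\<lambda>p. P (\<phi> p)) summable_on UNIV"
      using P summable_on_reindex_bij_betw[OF b] by blast
    from summable_on_cmult_left[OF this]
    have s: "(\<lambda>p. P (\<phi> p) * (\<Sum>\<^sub>\<infinity>k. norm (y' k))) summable_on UNIV" .
    have "norm (T x y x' y' p) \<le> P (\<phi> p) * (\<Sum>\<^sub>\<infinity>k. norm (y' k))" for p
    proof -
      obtain l j i where p: "p = (l, j, i)" by (metis prod.exhaust)
      have "norm (T x y x' y' p) = P (\<phi> p) * norm (y' (i + l))"
        by (simp add: p T_def P_def \<phi>_def norm_mult)
      also have "\<dots> \<le> P (\<phi> p) * (\<Sum>\<^sub>\<infinity>k. norm (y' k))"
        by (intro mult_left_mono l1_bounded y') (simp add: p P_def \<phi>_def)
      finally show ?thesis .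
    qed
    then show ?thesis
      using abs_summable_summable[OF summable_on_comparison_test[OF s]] by auto
  qed
  have hs: "((\<lambda>l. correlation x y l * cnj (correlation x' y' l)) has_sum infsum (T x y x' y') UNIV) UNIV"
    if x: "(\<lambda>k. norm (x k)) summable_on UNIV" and y: "(\<lambda>k. norm (y k)) summable_on UNIV"
      and x': "(\<lambda>k. norm (x' k)) summable_on UNIV" and y': "(\<lambda>k. norm (y' k)) summable_on UNIV"
    for x y x' y'
  proof -
    have S: "T x y x' y' summable_on (SIGMA l:UNIV. UNIV)"
      using sum[OF that] by simp
    have Sl: "(\<lambda>p. T x y x' y' (l, p)) summable_on (SIGMA j:UNIV. UNIV)" for l
      using summable_on_SigmaD1[of "\<lambda>l p. T x y x' y' (l, p)" UNIV "\<lambda>_. UNIV" l] S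
      by (simp add: case_prod_unfold)
    have inner: "((\<lambda>p. T x y x' y' (l, p)) has_sum correlation x y l * cnj (correlation x' y' l)) (SIGMA j:UNIV. UNIV)" for l
    proof (rule has_sum_SigmaI[OF _ _ Sl])
      show "((\<lambda>i. T x y x' y' (l, j, i)) has_sum (x j * cnj (y (j + l))) * cnj (correlation x' y' l)) UNIV" for j
        unfolding T_def prod.case
        by (intro has_sum_cmult_right) (simp only: has_sum_cnj_iff, rule correlation_has_sum[OF x' y'])
      show "((\<lambda>j. (x j * cnj (y (j + l))) * cnj (correlation x' y' l)) has_sum correlation x y l * cnj (correlation x' y' l)) UNIV"
        by (intro has_sum_cmult_left correlation_has_sum[OF x y])
    qed
    have "(T x y x' y' has_sum infsum (T x y x' y') UNIV) (SIGMA l:UNIV. UNIV)"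
      using S by simp
    from has_sum_SigmaD[OF this] show ?thesis using inner unfolding UNIV_Times_UNIV .
  qed
  \<comment> \<open>This involution swaps the argument j + l of \<open>y\<close> with the argument i
    of \<open>x'\<close> and keeps j and i + l.\<close>
  define \<phi> :: "'k \<times> 'k \<times> 'k \<Rightarrow> 'k \<times> 'k \<times> 'k" where "\<phi> = (\<lambda>(l, j, i). (i - j, j, j + l))"
  have b: "bij_betw \<phi> UNIV UNIV"
    by (rule bij_betwI[where g = \<phi>]) (auto simp: \<phi>_def)
  have "T x x' y y' (\<phi> p) = T x y x' y' p" for p
  proof -
    obtain l j i where p: "p = (l, j, i)" by (metis prod.exhaust)
    have "j + l + (i - j) = i + l" by simp
    then show ?thesis by (simp add: p T_def \<phi>_def add.commute)
  qed
  then have "infsum (T x y x' y') UNIV = infsum (T x x' y y') UNIV"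
    using infsum_reindex_bij_betw[OF b, of "T x x' y y'"] by simp
  then show thesis using that hs[OF x y x' y'] hs[OF x x' y y'] by simp
qed

definition L4sum :: "vfield \<Rightarrow> real" where
  "L4sum q = (\<Sum>\<^sub>\<infinity>k. (cmod (\<Sum>\<^sub>\<infinity>j. hdot (q j) (q (j - k))))\<^sup>2)"

lemma L4sq_eq: "L4sq q = 2 * pi * sqrt (L4sum q)"
  unfolding L4sq_def L4sum_def hdot_def
  by (simp add: real_sqrt_mult minus_prod_def)

text \<open>Fourier form of the integral of (q tensor q) : grad v being at most |grad v| times the
  L2 norm of q tensor q. Pointwise the tensor has Frobenius norm |q|^2, so its L2 norm is the
  squared L4 norm of q and no constant is lost.\<close>

lemma tri_L4:
  assumes q: "(\<lambda>k. norm (q k)) summable_on UNIV" and v: "l2 (grad v)"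
  shows "\<bar>infsum (tri q v q) UNIV\<bar> \<le> sqrt (msq (grad v)) * sqrt (L4sum q)"
proof -
  define x where "x = (\<lambda>k. fst (q k))"
  define y where "y = (\<lambda>k. snd (q k))"
  have x: "(\<lambda>k. norm (x k)) summable_on UNIV"
    by (rule summable_on_comparison_test[OF q]) (auto simp: x_def, metis norm_fst_le prod.collapse)
  have y: "(\<lambda>k. norm (y k)) summable_on UNIV"
    by (rule summable_on_comparison_test[OF q]) (auto simp: y_def, metis norm_snd_le prod.collapse)
  \<comment> \<open>Squared Frobenius norm of the coefficient of q tensor (conjugate of q) at mode
    -l.\<close>
  define H2 where "H2 l = (cmod (correlation x x l))\<^sup>2 + (cmod (correlation x y l))\<^sup>2
      + ((cmod (correlation y x l))\<^sup>2 + (cmod (correlation y y l))\<^sup>2)" for l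
  obtain I11 where 11: "((\<lambda>l. correlation x x l * cnj (correlation x x l)) has_sum I11) UNIV"
    using correlation_exchange[OF x x x x] by blast
  obtain I12 where 12: "((\<lambda>l. correlation x y l * cnj (correlation x y l)) has_sum I12) UNIV"
      "((\<lambda>l. correlation x x l * cnj (correlation y y l)) has_sum I12) UNIV"
    using correlation_exchange[OF x y x y] by blast
  obtain I21 where 21: "((\<lambda>l. correlation y x l * cnj (correlation y x l)) has_sum I21) UNIV"
      "((\<lambda>l. correlation y y l * cnj (correlation x x l)) has_sum I21) UNIV"
    using correlation_exchange[OF y x y x] by blast
  obtain I22 where 22: "((\<lambda>l. correlation y y l * cnj (correlation y y l)) has_sum I22) UNIV"
    using correlation_exchange[OF y y y y] by blast
  let ?I = "Re (I11 + I12 + (I21 + I22))"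
  have "((\<lambda>l. Re (correlation x x l * cnj (correlation x x l) + correlation x y l * cnj (correlation x y l)
      + (correlation y x l * cnj (correlation y x l) + correlation y y l * cnj (correlation y y l)))) has_sum ?I) UNIV"
    by (intro has_sum_Re has_sum_add 11 12 21 22)
  then have H2: "(H2 has_sum ?I) UNIV"
    unfolding H2_def by (simp only: cmod_power2) (simp add: power2_eq_square)
  \<comment> \<open>The exchange lemma replaces the off-diagonal squares by cross terms of the
    diagonal entries. The same total \<open>?I\<close> is therefore the sum of the squared moduli of
    the trace, which is |q|^2.\<close>
  have "((\<lambda>l. Re (correlation x x l * cnj (correlation x x l) + correlation x x l * cnj (correlation y y l)
      + (correlation y y l * cnj (correlation x x l) + correlation y y l * cnj (correlation y y l)))) has_sum ?I) UNIV"
    by (intro has_sum_Re has_sum_add 11 12 21 22)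
  moreover have "Re (a * cnj a + a * cnj b + (b * cnj a + b * cnj b)) = (cmod (a + b))\<^sup>2" for a b
    by (simp only: cmod_power2) (simp add: power2_eq_square algebra_simps)
  ultimately have L: "((\<lambda>l. (cmod (correlation x x l + correlation y y l))\<^sup>2) has_sum ?I) UNIV"
    by simp
  have c: "(\<Sum>\<^sub>\<infinity>j. hdot (q j) (q (j - k))) = correlation x x (- k) + correlation y y (- k)" for k
  proof -
    have "((\<lambda>j. x j * cnj (x (j + - k)) + y j * cnj (y (j + - k))) has_sum correlation x x (- k) + correlation y y (- k)) UNIV"
      by (intro has_sum_add correlation_has_sum x y)
    then show ?thesis by (simp add: hdot_def x_def y_def infsumI)
  qed
  \<comment> \<open>\<open>L4sum\<close> shifts by j - k, whereas \<open>correlation\<close> shifts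
    by j + l; the reflection of k reconciles them.\<close>
  have bm: "bij_betw uminus (UNIV :: (int \<times> int) set) UNIV"
    by (rule bij_betwI[where g = uminus]) auto
  have L4: "L4sum q = ?I"
    unfolding L4sum_def c
    using infsum_reindex_bij_betw[OF bm, of "\<lambda>l. (cmod (correlation x x l + correlation y y l))\<^sup>2"] infsumI[OF L] by simp
  have S: "tri q v q summable_on UNIV"
    by (intro tri_summable tri_bound_l1_first q v l1_imp_l2)
  have sw: "bij_betw prod.swap (UNIV :: ((int \<times> int) \<times> (int \<times> int)) set) UNIV"
    by (rule bij_betwI[where g = prod.swap]) auto
  \<comment> \<open>The mode l of v is held fixed while summing over j, so that the inner sums
    become correlations of the components of q.\<close>
  have S': "((\<lambda>p. tri q v q (prod.swap p)) has_sum infsum (tri q v q) UNIV) (SIGMA l:UNIV. UNIV)"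
    using S has_sum_reindex_bij_betw[OF sw, of "tri q v q"] by simp
  define R where "R l = Re (\<i> * (of_int (fst l) * (fst (v l) * correlation x x l + snd (v l) * correlation x y l)
    + of_int (snd l) * (fst (v l) * correlation y x l + snd (v l) * correlation y y l)))" for l
  have inner: "((\<lambda>j. tri q v q (prod.swap (l, j))) has_sum R l) UNIV" for l
  proof -
    let ?c = "\<lambda>x y j. x j * cnj (y (j + l))"
    have "((\<lambda>j. Re (\<i> * (of_int (fst l) * (fst (v l) * ?c x x j + snd (v l) * ?c x y j)
      + of_int (snd l) * (fst (v l) * ?c y x j + snd (v l) * ?c y y j)))) has_sum R l) UNIV"
      unfolding R_def by (intro has_sum_Re has_sum_cmult_right has_sum_add correlation_has_sum x y)
    moreover have "tri q v q (prod.swap (l, j)) = Re (\<i> * (of_int (fst l) * (fst (v l) * ?c x x j + snd (v l) * ?c x y j)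
      + of_int (snd l) * (fst (v l) * ?c y x j + snd (v l) * ?c y y j)))" for j
      by (simp only: tri_def prod.swap_def fst_conv snd_conv prod.case hdot_def dotk_def x_def y_def)
        (simp only: algebra_simps)
    ultimately show ?thesis by simp
  qed
  have Rsum: "(R has_sum infsum (tri q v q) UNIV) UNIV"
    using has_sum_SigmaD[OF S' inner] .
  have Rle: "\<bar>R l\<bar> \<le> norm (grad v l) * norm (sqrt (H2 l))" for l
  proof -
    let ?a = "fst (v l) * correlation x x l + snd (v l) * correlation x y l"
    let ?b = "fst (v l) * correlation y x l + snd (v l) * correlation y y l"
    have a: "(cmod ?a)\<^sup>2 \<le> (norm (v l))\<^sup>2 * ((cmod (correlation x x l))\<^sup>2 + (cmod (correlation x y l))\<^sup>2)"
      using power_mono[OF cmod_dot2_le[of "fst (v l)" "correlation x x l" "snd (v l)" "correlation x y l"], of 2]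
      by (simp add: norm_prod_def power_mult_distrib)
    have b: "(cmod ?b)\<^sup>2 \<le> (norm (v l))\<^sup>2 * ((cmod (correlation y x l))\<^sup>2 + (cmod (correlation y y l))\<^sup>2)"
      using power_mono[OF cmod_dot2_le[of "fst (v l)" "correlation y x l" "snd (v l)" "correlation y y l"], of 2]
      by (simp add: norm_prod_def power_mult_distrib)
    have "\<bar>R l\<bar> \<le> cmod (of_int (fst l) * ?a + of_int (snd l) * ?b)"
      unfolding R_def by (rule order_trans[OF abs_Re_le_cmod]) (simp add: norm_mult)
    also have "\<dots> \<le> sqrt (ksq l) * sqrt ((cmod ?a)\<^sup>2 + (cmod ?b)\<^sup>2)"
      using cmod_dot2_le[of "of_int (fst l)" ?a "of_int (snd l)" ?b] by (simp add: ksq_def)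
    also have "\<dots> \<le> sqrt (ksq l) * sqrt ((norm (v l))\<^sup>2 * H2 l)"
      using a b by (intro mult_left_mono real_sqrt_le_mono) (auto simp: H2_def algebra_simps)
    also have "\<dots> = grad v l * sqrt (H2 l)" by (simp add: grad_def real_sqrt_mult)
    finally show ?thesis by (simp add: H2_def)
  qed
  have H20: "H2 l \<ge> 0" for l by (simp add: H2_def)
  have h: "l2 (\<lambda>l. sqrt (H2 l))" "msq (\<lambda>l. sqrt (H2 l)) = ?I"
    using H2 H20 by (auto simp: l2_def msq_def has_sum_iff)
  have "\<bar>infsum (tri q v q) UNIV\<bar> \<le> (\<Sum>\<^sub>\<infinity>l. norm (grad v l) * norm (sqrt (H2 l)))"
    using norm_infsum_le[OF Rsum has_sum_infsum[OF l2_CS(1)[OF v h(1)]]] Rle by simp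
  also have "\<dots> \<le> sqrt (msq (grad v)) * sqrt (L4sum q)"
    using l2_CS(2)[OF v h(1)] by (simp add: h L4)
  finally show ?thesis .
qed

section \<open>Energy inequality for Fourier coefficients\<close>

lemma integrable_inner_pair:
  fixes \<rho> :: "real \<Rightarrow> 'b::euclidean_space"
  assumes \<rho>: "integrable lborel \<rho>"
  shows "integrable (lborel \<Otimes>\<^sub>M lborel) (\<lambda>(a, b). inner (\<rho> a) (\<rho> b))"
proof -
  have [measurable]: "\<rho> \<in> borel_measurable lborel" using \<rho> by auto
  have "integrable (lborel \<Otimes>\<^sub>M lborel) (\<lambda>(a, b). norm (\<rho> a) * norm (\<rho> b))"
  proof (rule lborel_pair.Fubini_integrable)
    show "(\<lambda>(a, b). norm (\<rho> a) * norm (\<rho> b)) \<in> borel_measurable (lborel \<Otimes>\<^sub>M lborel)"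
      by measurable
    show "integrable lborel (\<lambda>a. LINT b|lborel. norm (case (a, b) of (a, b) \<Rightarrow> norm (\<rho> a) * norm (\<rho> b)))"
      using \<rho> by simp
    show "AE a in lborel. integrable lborel (\<lambda>b. case (a, b) of (a, b) \<Rightarrow> norm (\<rho> a) * norm (\<rho> b))"
      using \<rho> by simp
  qed
  then show ?thesis
    by (rule Bochner_Integration.integrable_bound)
      (auto intro!: AE_I2 simp: Cauchy_Schwarz_ineq2)
qed

text \<open>The square of the integral is a double integral over the plane. The diagonal cuts it
  into two half planes, which contribute equally by symmetry. This replaces the chain rule for
  |C|^2, where C is only an indefinite integral.\<close>

lemma integral_split_diagonal:
  fixes \<rho> :: "real \<Rightarrow> 'b::euclidean_space"
  assumes \<rho>: "integrable lborel \<rho>"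
  defines "C \<equiv> \<lambda>b. LINT a|lborel. indicator {..b} a *\<^sub>R \<rho> a"
  shows "integrable lborel (\<lambda>b. inner (C b) (\<rho> b))"
    and "(norm (LINT a|lborel. \<rho> a))\<^sup>2 = 2 * (LINT b|lborel. inner (C b) (\<rho> b))"
proof -
  have [measurable]: "\<rho> \<in> borel_measurable lborel" using \<rho> by auto
  have ind: "integrable lborel (\<lambda>a. indicator A a *\<^sub>R \<rho> a)" if "A \<in> sets lborel" for A
    using integrable_mult_indicator[OF that \<rho>] .
  let ?F = "\<lambda>(a, b). inner (\<rho> a) (\<rho> b)"
  have F: "integrable (lborel \<Otimes>\<^sub>M lborel) ?F" by (rule integrable_inner_pair[OF \<rho>])
  have sets: "sets (lborel \<Otimes>\<^sub>M lborel) = sets (borel :: (real \<times> real) measure)"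
    by (simp only: lborel_prod sets_lborel)
  have K: "{p :: real \<times> real. fst p \<le> snd p} \<in> sets (lborel \<Otimes>\<^sub>M lborel)"
    "{p :: real \<times> real. snd p < fst p} \<in> sets (lborel \<Otimes>\<^sub>M lborel)"
    unfolding sets
    by (intro borel_closed borel_open closed_Collect_le open_Collect_less continuous_intros)+
  let ?F1 = "\<lambda>a b. indicator {..b} a *\<^sub>R inner (\<rho> a) (\<rho> b)"
  let ?F2 = "\<lambda>a b. indicator {..<a} b *\<^sub>R inner (\<rho> a) (\<rho> b)"
  have F1: "integrable (lborel \<Otimes>\<^sub>M lborel) (case_prod ?F1)"
    using integrable_mult_indicator[OF K(1) F]
    by (rule Bochner_Integration.integrable_cong[THEN iffD1, rotated 2])
      (auto simp: indicator_def)
  have F2: "integrable (lborel \<Otimes>\<^sub>M lborel) (case_prod ?F2)"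
    using integrable_mult_indicator[OF K(2) F]
    by (rule Bochner_Integration.integrable_cong[THEN iffD1, rotated 2])
      (auto simp: indicator_def)
  have e1: "(LINT a|lborel. ?F1 a b) = inner (C b) (\<rho> b)" for b
    unfolding C_def
    by (subst integral_inner_left[symmetric]) (auto intro!: ind)
  \<comment> \<open>The first half plane contains the diagonal and the second does not; the endpoint
    is a null set.\<close>
  have C': "C a = (LINT b|lborel. indicator {..<a} b *\<^sub>R \<rho> b)" for a
    unfolding C_def using AE_lborel_singleton[of a]
    by (intro integral_cong_AE) (auto elim!: eventually_mono simp: indicator_def)
  have e2: "(LINT b|lborel. ?F2 a b) = inner (C a) (\<rho> a)" for a
    unfolding C'
    by (subst inner_commute, subst integral_inner_right[symmetric]) (auto intro!: ind)
  show "integrable lborel (\<lambda>b. inner (C b) (\<rho> b))"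
    using lborel_pair.integrable_snd[OF F1] by (simp only: e1)
  have i1: "integral\<^sup>L (lborel \<Otimes>\<^sub>M lborel) (case_prod ?F1) = (LINT b|lborel. inner (C b) (\<rho> b))"
    using lborel_pair.integral_snd[OF F1] by (simp only: e1)
  have i2: "integral\<^sup>L (lborel \<Otimes>\<^sub>M lborel) (case_prod ?F2) = (LINT b|lborel. inner (C b) (\<rho> b))"
    using lborel_pair.integral_fst[OF F2] by (simp only: e2)
  have "(norm (LINT a|lborel. \<rho> a))\<^sup>2 = inner (LINT a|lborel. \<rho> a) (LINT b|lborel. \<rho> b)"
    by (simp add: power2_norm_eq_inner)
  also have "\<dots> = (LINT a|lborel. LINT b|lborel. inner (\<rho> a) (\<rho> b))"
    using \<rho> by (simp add: integral_inner_right integral_inner_left)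
  also have "\<dots> = integral\<^sup>L (lborel \<Otimes>\<^sub>M lborel) ?F"
    using lborel_pair.integral_fst[OF F] by simp
  also have "\<dots> = (LINT p|(lborel \<Otimes>\<^sub>M lborel). case_prod ?F1 p + case_prod ?F2 p)"
    by (intro Bochner_Integration.integral_cong) (auto simp: indicator_def)
  also have "\<dots> = 2 * (LINT b|lborel. inner (C b) (\<rho> b))"
    by (subst Bochner_Integration.integral_add[OF F1 F2]) (simp only: i1 i2 mult_2)
  finally show "(norm (LINT a|lborel. \<rho> a))\<^sup>2 = 2 * (LINT b|lborel. inner (C b) (\<rho> b))" .
qed

text \<open>\<open>r\<close> is extended by zero outside the interval and the splitting along the
  diagonal is applied to c - c(0); the term linear in c(0) restores |c|^2.\<close>

lemma norm_sq_indefinite_integral: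
  fixes c r :: "real \<Rightarrow> 'b::euclidean_space"
  assumes int: "set_integrable lborel {0..t} r"
    and c: "\<And>s. s \<in> {0..t} \<Longrightarrow> c s = c 0 + (LINT a:{0..s}|lborel. r a)"
    and t: "t \<ge> 0"
  shows "set_integrable lborel {0..t} (\<lambda>s. inner (c s) (r s))"
    and "(norm (c t))\<^sup>2 = (norm (c 0))\<^sup>2 + 2 * (LINT s:{0..t}|lborel. inner (c s) (r s))"
proof -
  define \<rho> where "\<rho> = (\<lambda>s. indicator {0..t} s *\<^sub>R r s)"
  have \<rho>: "integrable lborel \<rho>" using int by (simp add: set_integrable_def \<rho>_def)
  define C where "C b = (LINT a|lborel. indicator {..b} a *\<^sub>R \<rho> a)" for b
  have C: "C b = c b - c 0" if "b \<in> {0..t}" for b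
  proof -
    have "C b = (LINT a:{0..b}|lborel. r a)"
      unfolding C_def set_lebesgue_integral_def \<rho>_def using that
      by (intro Bochner_Integration.integral_cong) (auto simp: indicator_def)
    then show ?thesis using c[OF that] by simp
  qed
  have eq: "indicator {0..t} s *\<^sub>R inner (c s) (r s) = inner (C s) (\<rho> s) + inner (c 0) (\<rho> s)" for s
    using C[of s] by (auto simp: \<rho>_def indicator_def inner_diff_left)
  note d = integral_split_diagonal[OF \<rho>, folded C_def]
  have i2: "integrable lborel (\<lambda>s. inner (c 0) (\<rho> s))" using \<rho> by simp
  show "set_integrable lborel {0..t} (\<lambda>s. inner (c s) (r s))"
    unfolding set_integrable_def eq using d(1) i2 by simp
  have P: "(LINT s|lborel. \<rho> s) = c t - c 0"
    using c[of t] t by (simp add: \<rho>_def set_lebesgue_integral_def)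
  have "2 * (LINT s:{0..t}|lborel. inner (c s) (r s))
      = (norm (c t - c 0))\<^sup>2 + 2 * inner (c 0) (c t - c 0)"
    unfolding set_lebesgue_integral_def eq
    using d i2 \<rho> P by simp
  also have "\<dots> = (norm (c t))\<^sup>2 - (norm (c 0))\<^sup>2"
    by (simp add: power2_norm_eq_inner inner_diff inner_commute algebra_simps)
  finally show "(norm (c t))\<^sup>2 = (norm (c 0))\<^sup>2 + 2 * (LINT s:{0..t}|lborel. inner (c s) (r s))"
    by simp
qed

text \<open>Infinite sums are limits over the net of finite sets, but dominated convergence needs a
  sequence; an enumeration of the countable index set provides one.\<close>

lemma filterlim_to_nat_lessThan:
  "filterlim (\<lambda>n. {k :: 'k::countable. to_nat k < n}) (finite_subsets_at_top UNIV) sequentially"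
  unfolding filterlim_iff eventually_finite_subsets_at_top
proof safe
  fix P :: "'k set \<Rightarrow> bool" and X :: "'k set"
  assume X: "finite X" and P: "\<forall>Y. finite Y \<and> X \<subseteq> Y \<and> Y \<subseteq> UNIV \<longrightarrow> P Y"
  have fin: "finite {k :: 'k. to_nat k < n}" for n
    using finite_vimageI[OF finite_lessThan[of n] inj_to_nat] by (simp add: vimage_def lessThan_def)
  obtain m where m: "\<And>k. k \<in> X \<Longrightarrow> to_nat k < m"
    using finite_nat_set_iff_bounded[of "to_nat ` X"] X by auto
  show "\<forall>\<^sub>F n in sequentially. P {k. to_nat k < n}"
    using eventually_ge_at_top[of m]
  proof eventually_elim
    case (elim n)
    then have "X \<subseteq> {k. to_nat k < n}" using m by fastforce
    then show ?case using P fin by simp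
  qed
qed

text \<open>The identity for |c(k)|^2 holds for each mode and is summed over an increasing sequence
  of finite sets. \<open>R\<close> serves only to dominate, so it may be a crude integrable function
  on the whole of {0..T}; \<open>f\<close> carries the actual estimate and is required only on
  {s..t}.\<close>

lemma energy_inequality:
  fixes c r :: "real \<Rightarrow> 'k::countable \<Rightarrow> 'b::euclidean_space"
  assumes int: "\<And>k. set_integrable lborel {0..T} (\<lambda>\<tau>. r \<tau> k)"
    and c: "\<And>k \<tau>. \<tau> \<in> {0..T} \<Longrightarrow> c \<tau> k = c 0 k + (LINT a:{0..\<tau>}|lborel. r a k)"
    and l2: "\<And>\<tau>. \<tau> \<in> {0..T} \<Longrightarrow> l2 (c \<tau>)"
    and R: "set_integrable lborel {0..T} R"
    and ae: "AE \<tau> in lborel. \<tau> \<in> {0..T} \<longrightarrow>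
      (\<lambda>k. \<bar>inner (c \<tau> k) (r \<tau> k)\<bar>) summable_on UNIV \<and>
      (\<Sum>\<^sub>\<infinity>k. \<bar>inner (c \<tau> k) (r \<tau> k)\<bar>) \<le> R \<tau> \<and>
      (\<tau> \<in> {s..t} \<longrightarrow> 2 * (\<Sum>\<^sub>\<infinity>k. inner (c \<tau> k) (r \<tau> k)) \<le> f \<tau>)"
    and f: "continuous_on {s..t} f"
    and st: "0 \<le> s" "s \<le> t" "t \<le> T"
  shows "msq (c t) - msq (c s) \<le> integral {s..t} f"
proof -
  define h where "h k \<tau> = 2 * inner (c \<tau> k) (r \<tau> k)" for k \<tau>
  have sub: "set_integrable lborel {a..b} g" if "set_integrable lborel {0..T} g" "0 \<le> a" "b \<le> T"
    for a b and g :: "real \<Rightarrow> 'c::{banach,second_countable_topology}"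
    using set_integrable_subset[OF that(1), of "{a..b}"] that by auto
  have hi: "set_integrable lborel {0..\<tau>} (h k)"
    and hn: "(norm (c \<tau> k))\<^sup>2 = (norm (c 0 k))\<^sup>2 + (LINT a:{0..\<tau>}|lborel. h k a)"
    if "\<tau> \<in> {0..T}" for k \<tau>
  proof -
    have i: "set_integrable lborel {0..\<tau>} (\<lambda>a. r a k)" using sub[OF int[of k], of 0 \<tau>] that by simp
    have e: "\<And>a. a \<in> {0..\<tau>} \<Longrightarrow> c a k = c 0 k + (LINT a:{0..a}|lborel. r a k)"
      using that by (intro c) auto
    have "0 \<le> \<tau>" using that by simp
    note * = norm_sq_indefinite_integral[of \<tau> "\<lambda>a. r a k" "\<lambda>a. c a k", OF i e this]
    show "set_integrable lborel {0..\<tau>} (h k)"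
      unfolding h_def using *(1) by (rule set_integrable_mult_right)
    show "(norm (c \<tau> k))\<^sup>2 = (norm (c 0 k))\<^sup>2 + (LINT a:{0..\<tau>}|lborel. h k a)"
      unfolding h_def using *(2) by simp
  qed
  have his: "set_integrable lborel {s..t} (h k)" for k
    using hi[of T k] st sub by auto
  have hd: "(LINT a:{s..t}|lborel. h k a) = (norm (c t k))\<^sup>2 - (norm (c s k))\<^sup>2" for k
  proof -
    have "integral {0..s} (h k) + integral {s..t} (h k) = integral {0..t} (h k)"
      using st hi[of t k] set_borel_integral_eq_integral(1)[of "{0..t}" "h k"]
      by (intro Henstock_Kurzweil_Integration.integral_combine) auto
    then show ?thesis
      using hn[of t k] hn[of s k] st hi[of t k] hi[of s k] his[of k]
      by (simp add: set_borel_integral_eq_integral)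
  qed
  define S where "S n = {k :: 'k. to_nat k < n}" for n
  define H where "H n \<tau> = indicator {s..t} \<tau> *\<^sub>R (\<Sum>k\<in>S n. h k \<tau>)" for n \<tau>
  have Hint: "integrable lborel (H n)" for n
    unfolding H_def scaleR_sum_right using his by (auto simp: set_integrable_def)
  have HI: "integral\<^sup>L lborel (H n) = (\<Sum>k\<in>S n. (norm (c t k))\<^sup>2 - (norm (c s k))\<^sup>2)" for n
    unfolding H_def scaleR_sum_right hd[symmetric] set_lebesgue_integral_def
    using his by (intro Bochner_Integration.integral_sum) (auto simp: set_integrable_def)
  have lim1: "(\<lambda>n. integral\<^sup>L lborel (H n)) \<longlonglongrightarrow> msq (c t) - msq (c s)"
  proof -
    have "((\<lambda>n. \<Sum>k\<in>S n. (norm (c \<tau> k))\<^sup>2) \<longlongrightarrow> msq (c \<tau>)) sequentially" if "\<tau> \<in> {0..T}" for \<tau>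
      using has_sum_infsum[OF l2[OF that, unfolded l2_def]] filterlim_to_nat_lessThan
      unfolding has_sum_def msq_def S_def by (rule filterlim_compose)
    then show ?thesis
      unfolding HI sum_subtractf using st by (intro tendsto_diff) auto
  qed
  \<comment> \<open>Defined as a pointwise limit, \<open>g\<close> is measurable at once; it agrees
    with the infinite sum almost everywhere.\<close>
  define g where "g \<tau> = lim (\<lambda>n. H n \<tau>)" for \<tau>
  have meas [measurable]: "H n \<in> borel_measurable lborel" for n
    using Hint by auto
  have gm: "g \<in> borel_measurable lborel"
    unfolding g_def by measurable
  have conv: "AE \<tau> in lborel. (\<lambda>n. H n \<tau>) \<longlonglongrightarrow> indicator {s..t} \<tau> *\<^sub>R (2 * (\<Sum>\<^sub>\<infinity>k. inner (c \<tau> k) (r \<tau> k)))"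
    using ae
  proof eventually_elim
    case (elim \<tau>)
    show ?case
    proof (cases "\<tau> \<in> {s..t}")
      case True
      then have "(\<lambda>k. \<bar>inner (c \<tau> k) (r \<tau> k)\<bar>) summable_on UNIV" using elim st by auto
      then have "(\<lambda>k. inner (c \<tau> k) (r \<tau> k)) summable_on UNIV"
        by (simp add: abs_summable_summable)
      then have "((\<lambda>k. h k \<tau>) has_sum 2 * (\<Sum>\<^sub>\<infinity>k. inner (c \<tau> k) (r \<tau> k))) UNIV"
        unfolding h_def by (intro has_sum_cmult_right) simp
      then have "(\<lambda>n. \<Sum>k\<in>S n. h k \<tau>) \<longlonglongrightarrow> 2 * (\<Sum>\<^sub>\<infinity>k. inner (c \<tau> k) (r \<tau> k))"
        using filterlim_to_nat_lessThan unfolding has_sum_def S_def by (rule filterlim_compose)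
      then show ?thesis using True by (simp add: H_def)
    qed (simp add: H_def)
  qed
  have lim2: "(\<lambda>n. integral\<^sup>L lborel (H n)) \<longlonglongrightarrow> integral\<^sup>L lborel g"
    and gi: "integrable lborel g"
  proof -
    let ?w = "\<lambda>\<tau>. 2 * (indicator {0..T} \<tau> *\<^sub>R R \<tau>)"
    have w: "integrable lborel ?w" using R by (simp add: set_integrable_def)
    have cv: "AE \<tau> in lborel. (\<lambda>n. H n \<tau>) \<longlonglongrightarrow> g \<tau>"
      using conv unfolding g_def
      by eventually_elim (simp add: limI)
    have bd: "AE \<tau> in lborel. norm (H n \<tau>) \<le> ?w \<tau>" for n
      using ae
    proof eventually_elim
      case (elim \<tau>)
      show ?case
      proof (cases "\<tau> \<in> {s..t}")
        case True
        then have e: "(\<lambda>k. \<bar>inner (c \<tau> k) (r \<tau> k)\<bar>) summable_on UNIV"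
          "(\<Sum>\<^sub>\<infinity>k. \<bar>inner (c \<tau> k) (r \<tau> k)\<bar>) \<le> R \<tau>" and T: "\<tau> \<in> {0..T}"
          using elim st by auto
        have fin: "finite (S n)"
          using finite_vimageI[OF finite_lessThan[of n] inj_to_nat] by (simp add: S_def vimage_def lessThan_def)
        have "norm (H n \<tau>) \<le> (\<Sum>k\<in>S n. 2 * \<bar>inner (c \<tau> k) (r \<tau> k)\<bar>)"
          using True sum_abs[of "\<lambda>k. h k \<tau>" "S n"] by (simp add: H_def h_def abs_mult)
        also have "\<dots> = 2 * (\<Sum>k\<in>S n. \<bar>inner (c \<tau> k) (r \<tau> k)\<bar>)" by (simp add: sum_distrib_left)
        also have "\<dots> \<le> 2 * (\<Sum>\<^sub>\<infinity>k. \<bar>inner (c \<tau> k) (r \<tau> k)\<bar>)"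
          using finite_sum_le_infsum[OF e(1) fin] by simp
        finally show ?thesis using e(2) T by simp
      next
        case False
        \<comment> \<open>Outside {s..t} the integrand is 0, and domination still requires a
          nonnegative majorant.\<close>
        have "\<tau> \<in> {0..T} \<Longrightarrow> R \<tau> \<ge> 0"
          using elim infsum_nonneg[of UNIV "\<lambda>k. \<bar>inner (c \<tau> k) (r \<tau> k)\<bar>"] by force
        then show ?thesis using False by (auto simp: H_def indicator_def)
      qed
    qed
    show "(\<lambda>n. integral\<^sup>L lborel (H n)) \<longlonglongrightarrow> integral\<^sup>L lborel g"
      by (rule integral_dominated_convergence[OF gm meas w cv bd])
    show "integrable lborel g"
      by (rule integrable_dominated_convergence[OF gm meas w cv bd])
  qed
  from f have fi: "set_integrable lborel {s..t} f"
    by (rule borel_integrable_atLeastAtMost')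
  have "msq (c t) - msq (c s) = integral\<^sup>L lborel g"
    using LIMSEQ_unique[OF lim1 lim2] .
  also have "\<dots> \<le> (LINT \<tau>:{s..t}|lborel. f \<tau>)"
    unfolding set_lebesgue_integral_def
  proof (rule integral_mono_AE[OF gi])
    show "integrable lborel (\<lambda>\<tau>. indicator {s..t} \<tau> *\<^sub>R f \<tau>)"
      using fi by (simp add: set_integrable_def)
    show "AE \<tau> in lborel. g \<tau> \<le> indicator {s..t} \<tau> *\<^sub>R f \<tau>"
      using conv ae
    proof eventually_elim
      case (elim \<tau>)
      have "g \<tau> = indicator {s..t} \<tau> *\<^sub>R (2 * (\<Sum>\<^sub>\<infinity>k. inner (c \<tau> k) (r \<tau> k)))"
        unfolding g_def by (rule limI) (rule elim(1))
      then show ?case using elim(2) st by (auto simp: indicator_def)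
    qed
  qed
  also have "\<dots> = integral {s..t} f"
    using set_borel_integral_eq_integral(2)[OF fi] .
  finally show ?thesis .
qed

section \<open>A Gronwall inequality with time-averaged decay\<close>

text \<open>The hypothesis \<open>D\<close> bounds the upper right Dini derivative by 0 through a
  majorant that touches \<phi> at r and has derivative 0 there. An integral inequality supplies such
  a majorant even when \<phi> itself is not differentiable.\<close>

lemma dini_nonincreasing:
  fixes \<phi> :: "real \<Rightarrow> real"
  assumes cont: "continuous_on {s..t} \<phi>" and st: "s \<le> t"
    and D: "\<And>r. s \<le> r \<Longrightarrow> r < t \<Longrightarrow> \<exists>\<psi>. (\<psi> has_real_derivative 0) (at r within {r..t}) \<and> \<psi> r = 0
      \<and> (\<forall>x\<in>{r..t}. \<phi> x - \<phi> r \<le> \<psi> x)"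
  shows "\<phi> t \<le> \<phi> s"
proof -
  have "\<phi> t \<le> \<phi> s + \<epsilon> * (t - s)" if \<epsilon>: "\<epsilon> > 0" for \<epsilon>
  proof -
    \<comment> \<open>Points that satisfy the bound with slope \<epsilon>. The set is compact, and
      from its last point r < t the majorant would allow a further step to the right.\<close>
    define A where "A = {r \<in> {s..t}. \<phi> r \<le> \<phi> s + \<epsilon> * (r - s)}"
    have "closed A" unfolding A_def
      by (intro continuous_on_closed_Collect_le continuous_intros cont closed_atLeastAtMost)
    then have "compact A"
      unfolding A_def compact_eq_bounded_closed
      by (auto intro: bounded_subset[OF bounded_closed_interval[of s t]])
    moreover have "s \<in> A" using st by (simp add: A_def)
    ultimately obtain r where r: "r \<in> A" "\<And>x. x \<in> A \<Longrightarrow> x \<le> r"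
      using compact_attains_sup[of A] by blast
    have "r = t"
    proof (rule ccontr)
      assume "r \<noteq> t"
      then have rt: "s \<le> r" "r < t" using r(1) by (auto simp: A_def)
      from D[OF this] obtain \<psi> where \<psi>: "(\<psi> has_real_derivative 0) (at r within {r..t})" "\<psi> r = 0"
        "\<And>x. x \<in> {r..t} \<Longrightarrow> \<phi> x - \<phi> r \<le> \<psi> x" by blast
      from \<psi>(1) \<epsilon> obtain d where d: "d > 0"
        "\<And>x. x \<in> {r..t} \<Longrightarrow> norm (x - r) < d \<Longrightarrow> norm (\<psi> x - \<psi> r - 0 * (x - r)) \<le> \<epsilon> * norm (x - r)"
        unfolding has_field_derivative_def has_derivative_within_alt by blast
      define x where "x = min (r + d / 2) t"
      have x: "x \<in> {r..t}" "norm (x - r) < d" "r < x" using d(1) rt by (auto simp: x_def)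
      have "\<psi> x \<le> \<epsilon> * (x - r)" using d(2)[OF x(1,2)] x \<psi>(2) by simp
      then have "\<phi> x \<le> \<phi> s + \<epsilon> * (x - s)"
        using \<psi>(3)[OF x(1)] r(1) by (simp add: A_def algebra_simps)
      then have "x \<in> A" using x rt by (auto simp: A_def)
      then show False using r(2) x(3) by force
    qed
    then show ?thesis using r(1) by (simp add: A_def)
  qed
  moreover have "((\<lambda>\<epsilon>. \<phi> s + \<epsilon> * (t - s)) \<longlongrightarrow> \<phi> s + 0 * (t - s)) (at_right 0)"
    by (intro tendsto_intros)
  ultimately have "\<phi> t \<le> \<phi> s + 0 * (t - s)"
    by (intro tendsto_lowerbound[of _ _ "at_right (0::real)"])
      (auto simp: eventually_at_right_less intro: eventually_at_rightI[of 0 1])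
  then show ?thesis by simp
qed

text \<open>Integrating factor exp(A) with A the primitive of \<open>a\<close>. As \<open>a\<close>
  may change sign, decay is imposed only through its integrals up to the final time, where
  \<open>D\<close> is the amount by which they may fall short of the rate \<delta>.\<close>

lemma gronwall_decay:
  fixes y a :: "real \<Rightarrow> real"
  assumes y: "continuous_on {s..t} y" and a: "continuous_on {s..t} a" and st: "s \<le> t"
    and b: "b \<ge> 0" and ys: "y s \<ge> 0" and \<delta>: "\<delta> > 0"
    and inc: "\<And>r r'. s \<le> r \<Longrightarrow> r \<le> r' \<Longrightarrow> r' \<le> t \<Longrightarrow> y r' - y r \<le> integral {r..r'} (\<lambda>x. b - a x * y x)"
    and lower: "\<And>r. s \<le> r \<Longrightarrow> r \<le> t \<Longrightarrow> \<delta> * (t - r) - D \<le> integral {r..t} a"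
  shows "y t \<le> exp D * (exp (- \<delta> * (t - s)) * y s + b / \<delta>)"
proof -
  define A where "A r = integral {s..r} a" for r
  define F where "F r = integral {s..r} (\<lambda>x. b - a x * y x)" for r
  define J where "J r = integral {s..r} (\<lambda>x. exp (A x))" for r
  define \<phi> where "\<phi> r = y r * exp (A r) - b * J r" for r
  have A': "(A has_real_derivative a r) (at r within {s..t})" if "r \<in> {s..t}" for r
    unfolding A_def by (rule integral_has_real_derivative[OF a that])
  have Ac: "continuous_on {s..t} A"
    by (rule DERIV_continuous_on) (rule A')
  have fc: "continuous_on {s..t} (\<lambda>x. b - a x * y x)"
    by (intro continuous_intros a y)
  have F': "(F has_real_derivative b - a r * y r) (at r within {s..t})" if "r \<in> {s..t}" for r
    unfolding F_def by (rule integral_has_real_derivative[OF fc that])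
  have ec: "continuous_on {s..t} (\<lambda>x. exp (A x))"
    by (intro continuous_intros Ac)
  have J': "(J has_real_derivative exp (A r)) (at r within {s..t})" if "r \<in> {s..t}" for r
    unfolding J_def by (rule integral_has_real_derivative[OF ec that])
  have Jc: "continuous_on {s..t} J"
    by (rule DERIV_continuous_on) (rule J')
  have "\<phi> t \<le> \<phi> s"
  proof (rule dini_nonincreasing[OF _ st])
    show "continuous_on {s..t} \<phi>"
      unfolding \<phi>_def by (intro continuous_intros y Ac Jc)
    fix r assume r: "s \<le> r" "r < t"
    then have rin: "r \<in> {s..t}" and sub: "{r..t} \<subseteq> {s..t}" by auto
    note A'' = DERIV_subset[OF A'[OF rin] sub] and F'' = DERIV_subset[OF F'[OF rin] sub]
      and J'' = DERIV_subset[OF J'[OF rin] sub]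
    \<comment> \<open>The increment of y is replaced by that of its integral bound F. At r the
      derivative is exp(A r) (b - a r * y r) + y r * a r * exp(A r) - b exp(A r) = 0.\<close>
    define \<psi> where "\<psi> x = exp (A x) * (F x - F r) + y r * (exp (A x) - exp (A r)) - b * (J x - J r)" for x
    have "(\<psi> has_real_derivative 0) (at r within {r..t})"
      unfolding \<psi>_def
      by (auto intro!: derivative_eq_intros A'' F'' J'' simp: algebra_simps)
    moreover have "\<phi> x - \<phi> r \<le> \<psi> x" if x: "x \<in> {r..t}" for x
    proof -
      have "F r + integral {r..x} (\<lambda>x. b - a x * y x) = F x"
        unfolding F_def using r x
        by (intro Henstock_Kurzweil_Integration.integral_combine integrable_continuous_real
            continuous_on_subset[OF fc]) auto
      then have "y x - y r \<le> F x - F r" using inc[of r x] r x by auto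
      then have "exp (A x) * (y x - y r) \<le> exp (A x) * (F x - F r)" by simp
      then show ?thesis by (simp add: \<phi>_def \<psi>_def algebra_simps)
    qed
    moreover have "\<psi> r = 0" by (simp add: \<psi>_def)
    ultimately show "\<exists>\<psi>. (\<psi> has_real_derivative 0) (at r within {r..t}) \<and> \<psi> r = 0
      \<and> (\<forall>x\<in>{r..t}. \<phi> x - \<phi> r \<le> \<psi> x)" by blast
  qed
  then have "y t * exp (A t) \<le> y s + b * J t"
    by (simp add: \<phi>_def A_def J_def)
  then have "exp (- A t) * (y t * exp (A t)) \<le> exp (- A t) * (y s + b * J t)"
    by (intro mult_left_mono) auto
  then have main: "y t \<le> exp (- A t) * y s + b * (exp (- A t) * J t)"
    by (simp add: exp_minus field_simps)
  have At: "\<delta> * (t - s) - D \<le> A t" using lower[of s] st by (simp add: A_def)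
  have 1: "exp (- A t) * y s \<le> exp D * (exp (- \<delta> * (t - s)) * y s)"
  proof -
    have "exp (- A t) \<le> exp (D - \<delta> * (t - s))" using At by simp
    then have "exp (- A t) * y s \<le> exp (D - \<delta> * (t - s)) * y s" using ys by (rule mult_right_mono)
    also have "exp (D - \<delta> * (t - s)) = exp D * exp (- \<delta> * (t - s))"
      by (simp only: exp_add[symmetric]) simp
    finally show ?thesis by (simp only: mult.assoc)
  qed
  \<comment> \<open>The integrand is exp of minus the integral of \<open>a\<close> over {r..t};
    \<open>lower\<close> bounds it by an exponential of integral at most exp D / \<delta>.\<close>
  have "exp (- A t) * J t = integral {s..t} (\<lambda>r. exp (- A t) * exp (A r))"
    unfolding J_def by simp
  also have "\<dots> \<le> integral {s..t} (\<lambda>r. exp (D - \<delta> * (t - r)))"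
  proof (rule integral_le)
    show "(\<lambda>r. exp (- A t) * exp (A r)) integrable_on {s..t}"
      by (intro integrable_continuous_real continuous_intros Ac)
    show "(\<lambda>r. exp (D - \<delta> * (t - r))) integrable_on {s..t}"
      by (intro integrable_continuous_real continuous_intros)
    fix r assume r: "r \<in> {s..t}"
    have "A r + integral {r..t} a = A t"
      unfolding A_def using r
      by (intro Henstock_Kurzweil_Integration.integral_combine integrable_continuous_real a) auto
    then have "A r - A t \<le> D - \<delta> * (t - r)" using lower[of r] r by auto
    then show "exp (- A t) * exp (A r) \<le> exp (D - \<delta> * (t - r))"
      by (simp add: exp_add[symmetric])
  qed
  also have "\<dots> = exp (D - \<delta> * (t - t)) / \<delta> - exp (D - \<delta> * (t - s)) / \<delta>"
    by (intro integral_unique fundamental_theorem_of_calculus st)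
      (use \<delta> in \<open>auto intro!: derivative_eq_intros simp: has_real_derivative_iff_has_vector_derivative[symmetric]\<close>)
  also have "\<dots> \<le> exp D / \<delta>" using \<delta> by simp
  finally have "b * (exp (- A t) * J t) \<le> b * (exp D / \<delta>)" using b by (rule mult_left_mono)
  with main 1 show ?thesis by (simp add: algebra_simps)
qed

section \<open>Fourier description of the function spaces\<close>

lemma normH_eq: "normH u = 2 * pi * sqrt (msq u)"
  by (simp add: normH_def msq_def cnorm2_eq real_sqrt_mult)

lemma normV_eq: "normV u = 2 * pi * sqrt (msq (grad u))"
  by (simp add: normV_def msq_def cnorm2_eq grad_sq real_sqrt_mult)

lemma vdiff_eq: "vdiff u w = (\<lambda>k. u k - w k)"
  by (simp add: vdiff_def minus_prod_def)

lemma inH_D: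
  assumes "inH u"
  shows "u 0 = 0" "u (- k) = (cnj (fst (u k)), cnj (snd (u k)))" "dotk k (u k) = 0" "l2 u"
  using assms by (cases k; simp add: inH_def zero_prod_def uminus_prod_def dotk_def l2_def cnorm2_eq)+

lemma inV_iff: "inV u \<longleftrightarrow> inH u \<and> l2 (grad u)"
  by (simp add: inV_def l2_def grad_sq cnorm2_eq)

lemma dotk_diff: "dotk k (a - b) = dotk k a - dotk k b"
  by (simp add: dotk_def algebra_simps)

lemma dotk_0 [simp]: "dotk k 0 = 0"
  by (simp add: dotk_def)

text \<open>The part removed by the Leray projection is a complex multiple of k, hence orthogonal to
  \<open>z\<close>. The second premise covers the zero mode, where the projection returns 0.\<close>

lemma inner_bilinB:
  assumes "dotk k z = 0" "k = 0 \<Longrightarrow> z = 0"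
  shows "inner (bilinB u v k) z = inner (convect u v k) z"
proof (cases "k = 0")
  case False
  define d where "d = dotk k (convect u v k) / of_real (ksq k)"
  have e: "bilinB u v k = convect u v k - (d * of_int (fst k), d * of_int (snd k))"
    using False by (simp add: bilinB_def leray_def d_def dotk_def Let_def zero_prod_def minus_prod_def)
  have "hdot (d * of_int (fst k), d * of_int (snd k)) z = d * cnj (dotk k z)"
    by (simp add: hdot_def dotk_def algebra_simps)
  then have "inner (d * of_int (fst k), d * of_int (snd k)) z = 0"
    unfolding inner_eq_Re_hdot using assms(1) by simp
  then show ?thesis unfolding e by (simp add: inner_diff_left del: inner_Pair)
qed (simp add: assms)

lemma rhs_eq:
  "rhs \<nu> mua mub N g u w k
    = g k - (\<nu> * ksq k) *\<^sub>R u k - bilinB u u k - mua *\<^sub>R projP N u k + mub *\<^sub>R projP N w k"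
  by (rule prod_eqI) (simp_all add: rhs_def stokesA_def Let_def scaleR_conv_of_real mult.assoc)

lemma l2_diff:
  fixes u v :: "'k \<Rightarrow> 'a::real_normed_vector"
  assumes "l2 u" "l2 v"
  shows "l2 (\<lambda>k. u k - v k)" and "msq (\<lambda>k. u k - v k) \<le> 2 * msq u + 2 * msq v"
proof -
  have s: "(\<lambda>k. 2 * (norm (u k))\<^sup>2 + 2 * (norm (v k))\<^sup>2) summable_on UNIV"
    using assms unfolding l2_def by (intro summable_on_add summable_on_cmult_right)
  have le: "(norm (u k - v k))\<^sup>2 \<le> 2 * (norm (u k))\<^sup>2 + 2 * (norm (v k))\<^sup>2" for k
  proof -
    have "(norm (u k - v k))\<^sup>2 \<le> (norm (u k) + norm (v k))\<^sup>2"
      by (intro power_mono norm_triangle_ineq4) auto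
    also have "\<dots> \<le> 2 * (norm (u k))\<^sup>2 + 2 * (norm (v k))\<^sup>2"
      using sum_squares_ge_zero[of "norm (u k) - norm (v k)" 0] by (simp add: power2_eq_square algebra_simps)
    finally show ?thesis .
  qed
  show *: "l2 (\<lambda>k. u k - v k)" unfolding l2_def
    by (rule summable_on_comparison_test[OF s]) (auto intro: le)
  have "msq (\<lambda>k. u k - v k) \<le> (\<Sum>\<^sub>\<infinity>k. 2 * (norm (u k))\<^sup>2 + 2 * (norm (v k))\<^sup>2)"
    using * unfolding msq_def l2_def by (intro infsum_mono s le)
  also have "\<dots> = 2 * msq u + 2 * msq v"
    using assms unfolding msq_def l2_def
    by (subst infsum_add) (auto intro!: summable_on_cmult_right simp: infsum_cmult_right')
  finally show "msq (\<lambda>k. u k - v k) \<le> 2 * msq u + 2 * msq v" .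
qed

lemma msq_mono:
  fixes u :: "'k \<Rightarrow> 'a::real_normed_vector" and v :: "'k \<Rightarrow> 'b::real_normed_vector"
  assumes "l2 v" and le: "\<And>k. norm (u k) \<le> norm (v k)"
  shows "l2 u" and "msq u \<le> msq v"
proof -
  have le2: "(norm (u k))\<^sup>2 \<le> (norm (v k))\<^sup>2" for k
    by (rule power_mono[OF le]) simp
  show *: "l2 u" unfolding l2_def
    by (rule summable_on_comparison_test[OF assms(1)[unfolded l2_def]]) (simp_all add: le)
  show "msq u \<le> msq v"
    using * assms(1) unfolding msq_def l2_def by (intro infsum_mono le2)
qed

text \<open>The difference of squares is factored mode by mode and followed by Cauchy-Schwarz; the
  bound tends to 0 with the distance of u to a fixed v.\<close>

lemma msq_diff_le:
  fixes u v :: "'k \<Rightarrow> 'a::real_normed_vector"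
  assumes u: "l2 u" and v: "l2 v"
  shows "\<bar>msq u - msq v\<bar> \<le> msq (\<lambda>k. u k - v k) + 2 * (sqrt (msq (\<lambda>k. u k - v k)) * sqrt (msq v))"
proof -
  let ?d = "\<lambda>k. u k - v k"
  have d: "l2 ?d" by (rule l2_diff[OF u v])
  note cs = l2_CS[OF d v]
  have hs: "((\<lambda>k. (norm (u k))\<^sup>2 - (norm (v k))\<^sup>2) has_sum (msq u - msq v)) UNIV"
    unfolding diff_conv_add_uminus[of "(norm _)\<^sup>2"] diff_conv_add_uminus[of "msq _"]
    using u v by (intro has_sum_add) (simp_all add: l2_def msq_def has_sum_uminus)
  have hb: "((\<lambda>k. (norm (?d k))\<^sup>2 + 2 * (norm (?d k) * norm (v k))) has_sum
      (msq ?d + 2 * (\<Sum>\<^sub>\<infinity>k. norm (?d k) * norm (v k)))) UNIV"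
    using d cs(1) unfolding l2_def msq_def by (intro has_sum_add has_sum_cmult_right has_sum_infsum)
  have pt: "norm ((norm (u k))\<^sup>2 - (norm (v k))\<^sup>2) \<le> (norm (?d k))\<^sup>2 + 2 * (norm (?d k) * norm (v k))" for k
  proof -
    have "\<bar>norm (u k) - norm (v k)\<bar> \<le> norm (?d k)" by (rule norm_triangle_ineq3)
    moreover have "norm (u k) + norm (v k) \<le> norm (?d k) + 2 * norm (v k)"
      using norm_triangle_sub[of "u k" "v k"] by simp
    ultimately have "\<bar>norm (u k) - norm (v k)\<bar> * (norm (u k) + norm (v k))
        \<le> norm (?d k) * (norm (?d k) + 2 * norm (v k))"
      by (intro mult_mono) auto
    moreover have "\<bar>(norm (u k))\<^sup>2 - (norm (v k))\<^sup>2\<bar> = \<bar>norm (u k) - norm (v k)\<bar> * (norm (u k) + norm (v k))"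
      by (simp add: power2_eq_square square_diff_square_factored abs_mult mult.commute)
    ultimately show ?thesis by (simp add: power2_eq_square algebra_simps)
  qed
  have "\<bar>msq u - msq v\<bar> \<le> msq ?d + 2 * (\<Sum>\<^sub>\<infinity>k. norm (?d k) * norm (v k))"
    using norm_infsum_le[OF hs hb pt] by simp
  then show ?thesis using cs(2) by linarith
qed

section \<open>Continuity in time of squared norms\<close>

lemma continuous_on_msq:
  fixes X :: "real \<Rightarrow> 'k \<Rightarrow> 'a::real_normed_vector"
  assumes l2: "\<And>t. t \<in> A \<Longrightarrow> l2 (X t)"
    and lim: "\<And>t. t \<in> A \<Longrightarrow> ((\<lambda>s. msq (\<lambda>k. X s k - X t k)) \<longlongrightarrow> 0) (at t within A)"
  shows "continuous_on A (\<lambda>t. msq (X t))"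
  unfolding continuous_on_def
proof
  fix t assume t: "t \<in> A"
  let ?d = "\<lambda>s. msq (\<lambda>k. X s k - X t k)"
  have "((\<lambda>s. msq (X s) - msq (X t)) \<longlongrightarrow> 0) (at t within A)"
  proof (rule Lim_null_comparison)
    show "\<forall>\<^sub>F s in at t within A. norm (msq (X s) - msq (X t)) \<le> ?d s + 2 * (sqrt (?d s) * sqrt (msq (X t)))"
      unfolding eventually_at_filter using msq_diff_le[OF l2 l2[OF t]]
      by (auto intro!: always_eventually)
    have "((\<lambda>s. ?d s + 2 * (sqrt (?d s) * sqrt (msq (X t)))) \<longlongrightarrow> 0 + 2 * (sqrt 0 * sqrt (msq (X t)))) (at t within A)"
      by (intro tendsto_intros lim t)
    then show "((\<lambda>s. ?d s + 2 * (sqrt (?d s) * sqrt (msq (X t)))) \<longlongrightarrow> 0) (at t within A)" by simp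
  qed
  then show "((\<lambda>t. msq (X t)) \<longlongrightarrow> msq (X t)) (at t within A)"
    by (rule LIM_zero_cancel)
qed

lemma norm_le_grad: "u 0 = 0 \<Longrightarrow> norm (u k) \<le> grad u k"
proof (cases "k = 0")
  case False
  then have "1 \<le> sqrt (ksq k)" using ksq_ge_1[of k] by simp
  then show ?thesis unfolding grad_def using mult_right_mono[of 1 "sqrt (ksq k)" "norm (u k)"] by simp
qed (simp add: grad_def)

lemma poincare:
  assumes "inV u"
  shows "msq u \<le> msq (grad u)"
  using assms inH_D(1)[of u] norm_le_grad[of u]
  by (intro msq_mono(2)) (auto simp: inV_iff)

text \<open>\<open>grad\<close> takes norms and is therefore not additive; the vector-valued
  sequence on the right is linear in \<open>u\<close>, so facts about differences apply to
  it.\<close>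

lemma msq_grad_eq: "l2 (grad u) \<longleftrightarrow> l2 (\<lambda>k. sqrt (ksq k) *\<^sub>R u k)" "msq (grad u) = msq (\<lambda>k. sqrt (ksq k) *\<^sub>R u k)"
  by (simp_all add: l2_def msq_def grad_def)

lemma cont_V_lim:
  assumes "cont_V v T" "t \<in> {0..T}"
  shows "((\<lambda>s. msq (grad (\<lambda>k. v s k - v t k))) \<longlongrightarrow> 0) (at t within {0..T})"
proof -
  have "((\<lambda>s. (normV (vdiff (v s) (v t)))\<^sup>2 / (4 * pi\<^sup>2)) \<longlongrightarrow> 0\<^sup>2 / (4 * pi\<^sup>2)) (at t within {0..T})"
    using assms unfolding cont_V_def by (intro tendsto_intros) auto
  then show ?thesis by (simp add: normV_eq vdiff_eq power_mult_distrib)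
qed

lemma cont_V_continuous:
  assumes "cont_V v T"
  shows "continuous_on {0..T} (\<lambda>t. msq (grad (v t)))"
  unfolding msq_grad_eq
proof (rule continuous_on_msq)
  show "l2 (\<lambda>k. sqrt (ksq k) *\<^sub>R v t k)" if "t \<in> {0..T}" for t
    using assms that unfolding cont_V_def by (auto simp: inV_iff msq_grad_eq)
  show "((\<lambda>s. msq (\<lambda>k. sqrt (ksq k) *\<^sub>R v s k - sqrt (ksq k) *\<^sub>R v t k)) \<longlongrightarrow> 0) (at t within {0..T})"
    if "t \<in> {0..T}" for t
    using cont_V_lim[OF assms that] by (simp add: msq_grad_eq scaleR_diff_right)
qed

text \<open>The equations hold for the two components separately, while the energy argument wants
  one integrand with values in a Euclidean space. It is used again to join the two fields.\<close>

lemma set_integral_Pair: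
  fixes f :: "'x \<Rightarrow> 'a::{banach,second_countable_topology} \<times> 'b::{banach,second_countable_topology}"
  assumes "set_integrable M A (\<lambda>s. fst (f s))" "set_integrable M A (\<lambda>s. snd (f s))"
  shows "set_integrable M A f"
    and "set_lebesgue_integral M A f = (set_lebesgue_integral M A (\<lambda>s. fst (f s)), set_lebesgue_integral M A (\<lambda>s. snd (f s)))"
proof -
  have b: "bounded_linear (\<lambda>x::'a. (x, 0::'b))" "bounded_linear (\<lambda>y::'b. (0::'a, y))"
    by (intro bounded_linear_Pair bounded_linear_ident bounded_linear_zero)+
  have e: "indicator A s *\<^sub>R f s = (indicator A s *\<^sub>R fst (f s), 0) + (0, indicator A s *\<^sub>R snd (f s))" for s
    by (simp add: prod_eq_iff)
  show i: "set_integrable M A f"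
    unfolding set_integrable_def e using assms
    by (intro Bochner_Integration.integrable_add integrable_bounded_linear[OF b(1)]
        integrable_bounded_linear[OF b(2)]) (auto simp: set_integrable_def)
  show "set_lebesgue_integral M A f = (set_lebesgue_integral M A (\<lambda>s. fst (f s)), set_lebesgue_integral M A (\<lambda>s. snd (f s)))"
    using integral_bounded_linear[OF bounded_linear_fst i[unfolded set_integrable_def]]
      integral_bounded_linear[OF bounded_linear_snd i[unfolded set_integrable_def]]
    unfolding set_lebesgue_integral_def by (simp add: prod_eq_iff)
qed

section \<open>Energy production rates\<close>

lemma sqrt_le_one_plus: "x \<ge> 0 \<Longrightarrow> sqrt x \<le> 1 + x"
  by (rule real_le_lsqrt) (auto simp: power2_eq_square algebra_simps)

text \<open>Supplies the majorant for dominated convergence. Everything except Au is bounded by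
  \<open>K\<close>, and Au enters at most quadratically. The test field \<phi> is left free because
  both u itself and the high modes of the difference are inserted.\<close>

lemma rhs_pairing:
  assumes u: "inDA u" "inV u" and w: "inH w" and g: "inH g"
    and \<phi>: "l2 \<phi>" "\<And>k. dotk k (\<phi> k) = 0" "\<phi> 0 = 0"
    and pos: "\<nu> \<ge> 0" "mua \<ge> 0" "mub \<ge> 0" "K \<ge> 0"
    and K: "sqrt (msq g) \<le> K" "sqrt (msq \<phi>) \<le> K" "sqrt (msq (grad u)) \<le> K"
      "sqrt (msq u) \<le> K" "sqrt (msq w) \<le> K"
  shows "(\<lambda>k. \<bar>inner (\<phi> k) (rhs \<nu> mua mub N g u w k)\<bar>) summable_on UNIV"
    and "(\<Sum>\<^sub>\<infinity>k. \<bar>inner (\<phi> k) (rhs \<nu> mua mub N g u w k)\<bar>)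
      \<le> K * K + \<nu> * ((1 + msq (stokesA u)) * K) + (2 * msq (stokesA u) + infsum lattice_weight UNIV) * (K * K)
        + mua * (K * K) + mub * (K * K)"
proof -
  have l2u: "l2 u" "l2 w" "l2 g" using u w g inH_D(4) by (auto simp: inV_iff)
  have l2A: "l2 (stokesA u)" and gr: "l2 (grad u)" using u by (auto simp: inDA_iff inV_iff)
  have tr: "tri_bound u u \<phi> summable_on UNIV"
    and trle: "infsum (tri_bound u u \<phi>) UNIV \<le> (\<Sum>\<^sub>\<infinity>k. norm (u k)) * (sqrt (msq (grad u)) * sqrt (msq \<phi>))"
    by (intro tri_bound_l1_first inDA_l1 u gr \<phi>)+
  note pr = convect_pairing[OF l2u(1) gr tr]
  define T where "T k = norm (g k) * norm (\<phi> k) + \<nu> * (norm (stokesA u k) * norm (\<phi> k))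
    + \<bar>inner (convect u u k) (\<phi> k)\<bar> + mua * (norm (u k) * norm (\<phi> k)) + mub * (norm (w k) * norm (\<phi> k))" for k
  have T: "(T has_sum (\<Sum>\<^sub>\<infinity>k. norm (g k) * norm (\<phi> k)) + \<nu> * (\<Sum>\<^sub>\<infinity>k. norm (stokesA u k) * norm (\<phi> k))
    + (\<Sum>\<^sub>\<infinity>k. \<bar>inner (convect u u k) (\<phi> k)\<bar>) + mua * (\<Sum>\<^sub>\<infinity>k. norm (u k) * norm (\<phi> k))
    + mub * (\<Sum>\<^sub>\<infinity>k. norm (w k) * norm (\<phi> k))) UNIV"
    unfolding T_def
    by (intro has_sum_add has_sum_cmult_right has_sum_infsum l2_CS(1) l2u l2A \<phi> pr(2))
  have pt: "\<bar>inner (\<phi> k) (rhs \<nu> mua mub N g u w k)\<bar> \<le> T k" for k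
  proof -
    have B: "inner (\<phi> k) (bilinB u u k) = inner (convect u u k) (\<phi> k)"
      using inner_bilinB[of k "\<phi> k" u u] \<phi> by (auto simp: inner_commute)
    have cs: "\<bar>inner (\<phi> k) z\<bar> \<le> norm z * norm (\<phi> k)" for z
      using Cauchy_Schwarz_ineq2[of "\<phi> k" z] by (simp add: mult.commute)
    have 1: "\<bar>inner (\<phi> k) ((\<nu> * ksq k) *\<^sub>R u k)\<bar> \<le> \<nu> * (norm (stokesA u k) * norm (\<phi> k))"
      using cs[of "(\<nu> * ksq k) *\<^sub>R u k"] pos by (simp add: norm_stokesA abs_mult mult_ac)
    have P: "norm (projP N z k) \<le> norm (z k)" for z by (simp add: projP_def zero_prod_def[symmetric])
    have 2: "\<bar>inner (\<phi> k) (m *\<^sub>R projP N z k)\<bar> \<le> m * (norm (z k) * norm (\<phi> k))" if "m \<ge> 0" for m z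
    proof -
      have "\<bar>inner (\<phi> k) (projP N z k)\<bar> \<le> norm (z k) * norm (\<phi> k)"
        using cs[of "projP N z k"] mult_right_mono[OF P[of z], of "norm (\<phi> k)"] by simp
      then show ?thesis using that by (simp add: abs_mult mult_left_mono)
    qed
    show ?thesis
      unfolding rhs_eq T_def inner_add_right inner_diff_right B
      using cs[of "g k"] 1 2[OF pos(2), of u] 2[OF pos(3), of w] by linarith
  qed
  show s: "(\<lambda>k. \<bar>inner (\<phi> k) (rhs \<nu> mua mub N g u w k)\<bar>) summable_on UNIV"
    by (rule summable_on_comparison_test[OF has_sum_imp_summable[OF T]]) (auto intro: pt)
  have cs: "(\<Sum>\<^sub>\<infinity>k. norm (z k) * norm (\<phi> k)) \<le> a * K" if "l2 z" "sqrt (msq z) \<le> a"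
    for z :: vfield and a
  proof -
    have "sqrt (msq z) * sqrt (msq \<phi>) \<le> a * K"
      using that K(2) by (intro mult_mono) (auto intro: order_trans[OF real_sqrt_ge_zero[OF msq_nonneg]])
    then show ?thesis using l2_CS(2)[OF that(1) \<phi>(1)] by simp
  qed
  have "(\<Sum>\<^sub>\<infinity>k. \<bar>inner (convect u u k) (\<phi> k)\<bar>) \<le> (\<Sum>\<^sub>\<infinity>k. norm (u k)) * (sqrt (msq (grad u)) * sqrt (msq \<phi>))"
    using pr(3) trle by simp
  also have "\<dots> \<le> (2 * msq (stokesA u) + infsum lattice_weight UNIV) * (K * K)"
    by (intro mult_mono inDA_l1 u K) (auto intro!: mult_nonneg_nonneg add_nonneg_nonneg infsum_nonneg pos lattice_weight_nonneg)
  finally have c: "(\<Sum>\<^sub>\<infinity>k. \<bar>inner (convect u u k) (\<phi> k)\<bar>)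
    \<le> (2 * msq (stokesA u) + infsum lattice_weight UNIV) * (K * K)" .
  have "(\<Sum>\<^sub>\<infinity>k. \<bar>inner (\<phi> k) (rhs \<nu> mua mub N g u w k)\<bar>) \<le> infsum T UNIV"
    by (intro infsum_mono s has_sum_imp_summable[OF T] pt)
  also have "\<dots> \<le> K * K + \<nu> * ((1 + msq (stokesA u)) * K)
        + (2 * msq (stokesA u) + infsum lattice_weight UNIV) * (K * K)
        + mua * (K * K) + mub * (K * K)"
    unfolding infsumI[OF T]
    by (intro add_mono mult_left_mono cs c l2u l2A K pos sqrt_le_one_plus msq_nonneg)
  finally show "(\<Sum>\<^sub>\<infinity>k. \<bar>inner (\<phi> k) (rhs \<nu> mua mub N g u w k)\<bar>)
      \<le> K * K + \<nu> * ((1 + msq (stokesA u)) * K) + (2 * msq (stokesA u) + infsum lattice_weight UNIV) * (K * K)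
        + mua * (K * K) + mub * (K * K)" .
qed

lemma convect_self_pairing:
  assumes u: "inDA u" "inV u"
  shows "((\<lambda>k. inner (u k) (convect u u k)) has_sum 0) UNIV"
proof -
  have h: "inH u" and gr: "l2 (grad u)" using u by (auto simp: inV_iff)
  have "tri_bound u u u summable_on UNIV"
    by (intro tri_bound_l1_first inDA_l1 u gr inH_D h)
  from convect_pairing(1)[OF inH_D(4)[OF h] gr this] show ?thesis
    using tri_antisym[of u u, OF inH_D(3)[OF h] inH_D(2)[OF h]] by (simp add: inner_commute)
qed

lemma young_half:
  assumes "\<nu> > (0::real)"
  shows "x * y \<le> x\<^sup>2 / (2 * \<nu>) + \<nu> / 2 * y\<^sup>2"
proof -
  have "0 \<le> (x - \<nu> * y)\<^sup>2 / (2 * \<nu>)" using assms by simp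
  also have "\<dots> = x\<^sup>2 / (2 * \<nu>) + \<nu> / 2 * y\<^sup>2 - x * y"
    using assms by (simp add: power2_eq_square field_simps)
  finally show ?thesis by simp
qed

text \<open>Young's inequality spends half of the dissipation on the forces; 2|ab| \<le> a^2 + b^2
  and mu2 \<le> mu1 show that the coupling contributes a nonpositive amount.\<close>

lemma energy_rate:
  assumes u1: "inDA u1" "inV u1" and u2: "inDA u2" "inV u2" and g: "inH g1" "inH g2"
    and \<nu>: "\<nu> > 0" and mu: "mu2 \<le> mu1" "0 \<le> mu2"
    and s: "(\<lambda>k. inner (u1 k, u2 k) (rhs \<nu> mu1 mu2 N g1 u1 u2 k, rhs \<nu> mu1 mu2 N g2 u2 u1 k)) summable_on UNIV"
  shows "2 * (\<Sum>\<^sub>\<infinity>k. inner (u1 k, u2 k) (rhs \<nu> mu1 mu2 N g1 u1 u2 k, rhs \<nu> mu1 mu2 N g2 u2 u1 k))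
    \<le> (msq g1 + msq g2) / \<nu> - \<nu> * (msq (grad u1) + msq (grad u2))"
proof -
  let ?X = "\<lambda>k. inner (u1 k, u2 k) (rhs \<nu> mu1 mu2 N g1 u1 u2 k, rhs \<nu> mu1 mu2 N g2 u2 u1 k)"
  have h: "inH u1" "inH u2" using u1 u2 by (auto simp: inV_iff)
  \<comment> \<open>The convective terms vanish only after summation over k. Adding them here leaves
    the sum unchanged and cancels them in each mode, so that a pointwise comparison
    suffices.\<close>
  have 1: "((\<lambda>k. ?X k + inner (u1 k) (convect u1 u1 k) + inner (u2 k) (convect u2 u2 k)) has_sum (infsum ?X UNIV + 0 + 0)) UNIV"
    by (intro has_sum_add has_sum_infsum s convect_self_pairing u1 u2)
  have l: "l2 g1" "l2 g2" "l2 (grad u1)" "l2 (grad u2)"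
    using g u1 u2 by (auto simp: inV_iff inH_D)
  define U where "U k = (1 / (2 * \<nu>)) * ((norm (g1 k))\<^sup>2 + (norm (g2 k))\<^sup>2)
      + (- (\<nu> / 2)) * ((norm (grad u1 k))\<^sup>2 + (norm (grad u2 k))\<^sup>2)" for k
  have 2: "(U has_sum ((1 / (2 * \<nu>)) * (msq g1 + msq g2) + (- (\<nu> / 2)) * (msq (grad u1) + msq (grad u2)))) UNIV"
    unfolding U_def msq_def using l unfolding l2_def
    by (intro has_sum_add has_sum_cmult_right has_sum_infsum)
  have pt: "?X k + inner (u1 k) (convect u1 u1 k) + inner (u2 k) (convect u2 u2 k) \<le> U k" for k
  proof -
    have B: "inner (u k) (bilinB u u k) = inner (u k) (convect u u k)" if "inH u" for u
      using inner_bilinB[of k "u k" u u] inH_D[OF that] by (auto simp: inner_commute)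
    \<comment> \<open>As a factor 0 or 1 it turns P_N into a scalar multiple and treats low and high
      modes together.\<close>
    define \<xi> :: real where "\<xi> = (if k \<noteq> 0 \<and> sqrt (ksq k) \<le> N then 1 else 0)"
    have P: "projP N u k = \<xi> *\<^sub>R u k" for u
      by (simp add: projP_def \<xi>_def zero_prod_def)
    have y: "inner (u k) (f k) \<le> (norm (f k))\<^sup>2 / (2 * \<nu>) + \<nu> / 2 * (grad u k)\<^sup>2" if "inH u" for u f
    proof -
      have "inner (u k) (f k) \<le> norm (f k) * norm (u k)"
        using norm_cauchy_schwarz[of "u k" "f k"] by (simp add: mult.commute)
      also have "\<dots> \<le> norm (f k) * grad u k"
        by (intro mult_left_mono norm_le_grad inH_D(1) that) auto
      also have "\<dots> \<le> (norm (f k))\<^sup>2 / (2 * \<nu>) + \<nu> / 2 * (grad u k)\<^sup>2"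
        by (rule young_half[OF \<nu>])
      finally show ?thesis .
    qed
    have m: "2 * mu2 * \<xi> * inner (u1 k) (u2 k) \<le> mu1 * \<xi> * (inner (u1 k) (u1 k) + inner (u2 k) (u2 k))"
    proof -
      have "0 \<le> inner (u1 k - u2 k) (u1 k - u2 k)" by simp
      then have a: "2 * inner (u1 k) (u2 k) \<le> inner (u1 k) (u1 k) + inner (u2 k) (u2 k)"
        by (simp add: inner_diff inner_commute)
      have "(mu2 * \<xi>) * (2 * inner (u1 k) (u2 k)) \<le> (mu2 * \<xi>) * (inner (u1 k) (u1 k) + inner (u2 k) (u2 k))"
        using mu by (intro mult_left_mono a) (auto simp: \<xi>_def)
      also have "\<dots> \<le> (mu1 * \<xi>) * (inner (u1 k) (u1 k) + inner (u2 k) (u2 k))"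
        using mu by (intro mult_right_mono) (auto simp: \<xi>_def)
      finally show ?thesis by (simp add: algebra_simps)
    qed
    have "?X k + inner (u1 k) (convect u1 u1 k) + inner (u2 k) (convect u2 u2 k)
      = inner (u1 k) (g1 k) + inner (u2 k) (g2 k) - \<nu> * (ksq k * inner (u1 k) (u1 k) + ksq k * inner (u2 k) (u2 k))
        + (2 * mu2 * \<xi> * inner (u1 k) (u2 k) - mu1 * \<xi> * (inner (u1 k) (u1 k) + inner (u2 k) (u2 k)))"
      unfolding rhs_eq inner_Pair inner_add_right inner_diff_right B[OF h(1)] B[OF h(2)] P
      by (simp add: algebra_simps inner_commute)
    also have "ksq k * inner (u1 k) (u1 k) + ksq k * inner (u2 k) (u2 k) = (grad u1 k)\<^sup>2 + (grad u2 k)\<^sup>2"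
      by (simp add: grad_sq power2_norm_eq_inner)
    finally show ?thesis
      using y[OF h(1), of g1] y[OF h(2), of g2] m unfolding U_def
      by (simp add: algebra_simps add_divide_distrib)
  qed
  have "infsum ?X UNIV + 0 + 0 \<le> (1 / (2 * \<nu>)) * (msq g1 + msq g2) + (- (\<nu> / 2)) * (msq (grad u1) + msq (grad u2))"
    by (rule has_sum_mono[OF 1 2 pt])
  from mult_left_mono[OF this, of 2]
  have "2 * infsum ?X UNIV \<le> 2 * ((1 / (2 * \<nu>)) * (msq g1 + msq g2) + (- (\<nu> / 2)) * (msq (grad u1) + msq (grad u2)))"
    by (simp only: add_0_right)
  also have "\<dots> = (msq g1 + msq g2) / \<nu> - \<nu> * (msq (grad u1) + msq (grad u2))"
    by (simp add: algebra_simps add_divide_distrib)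
  finally show ?thesis .
qed

section \<open>Splitting into low and high modes\<close>

definition highP :: "real \<Rightarrow> vfield \<Rightarrow> vfield" where
  "highP N u = (\<lambda>k. if k = 0 \<or> sqrt (ksq k) \<le> N then 0 else u k)"

lemma projP_eq: "projP N u k = (if k \<noteq> 0 \<and> sqrt (ksq k) \<le> N then u k else 0)"
  by (simp add: projP_def zero_prod_def)

text \<open>Both operators kill the zero mode, so \<open>highP\<close> is the complement of P_N on
  mean-free fields.\<close>

lemma projP_plus_highP: "u 0 = 0 \<Longrightarrow> projP N u k + highP N u k = u k"
  by (auto simp: projP_eq highP_def)

lemma finite_low_modes: "finite {k. k \<noteq> 0 \<and> sqrt (ksq k) \<le> N}"
proof (rule finite_subset)
  let ?m = "\<lceil>\<bar>N\<bar>\<rceil>"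
  show "{k. k \<noteq> 0 \<and> sqrt (ksq k) \<le> N} \<subseteq> {- ?m..?m} \<times> {- ?m..?m}"
  proof
    fix k assume k: "k \<in> {k. k \<noteq> 0 \<and> sqrt (ksq k) \<le> N}"
    obtain a b where ab: "k = (a, b)" by force
    have "sqrt (ksq (a, b)) \<le> N" using k ab by simp
    then have le: "sqrt ((real_of_int a)\<^sup>2 + (real_of_int b)\<^sup>2) \<le> \<bar>N\<bar>" by (simp add: ksq_def)
    have "\<bar>real_of_int a\<bar> \<le> \<bar>N\<bar>" "\<bar>real_of_int b\<bar> \<le> \<bar>N\<bar>"
      by (rule order_trans[OF _ le], rule real_le_rsqrt, simp)+
    then have "real_of_int \<bar>a\<bar> \<le> of_int ?m" "real_of_int \<bar>b\<bar> \<le> of_int ?m"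
      by (auto intro: order_trans[OF _ le_of_int_ceiling])
    then show "k \<in> {- ?m..?m} \<times> {- ?m..?m}" unfolding ab by auto
  qed
qed simp

text \<open>Norm equivalence on a finite-dimensional range: L2 convergence of the low modes becomes
  l1 convergence. The constant depends on N alone, which is fixed.\<close>

lemma projP_l1:
  assumes "l2 u"
  shows "(\<lambda>k. norm (projP N u k)) summable_on UNIV"
    and "(\<Sum>\<^sub>\<infinity>k. norm (projP N u k)) \<le> real (card {k. k \<noteq> 0 \<and> sqrt (ksq k) \<le> N}) * sqrt (msq (projP N u))"
proof -
  let ?S = "{k. k \<noteq> 0 \<and> sqrt (ksq k) \<le> N}"
  have hs: "((\<lambda>k. norm (projP N u k)) has_sum (\<Sum>k\<in>?S. norm (projP N u k))) UNIV"
    by (rule has_sum_finite_neutralI[where B = ?S]) (auto simp: finite_low_modes projP_eq)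
  then show "(\<lambda>k. norm (projP N u k)) summable_on UNIV" by (rule has_sum_imp_summable)
  have l: "l2 (projP N u)" by (rule msq_mono(1)[OF assms]) (simp add: projP_eq)
  have "norm (projP N u k) \<le> sqrt (msq (projP N u))" for k
    unfolding msq_def
    by (intro real_le_rsqrt) (use finite_sum_le_infsum[OF l[unfolded l2_def], of "{k}"] in simp)
  then have "(\<Sum>k\<in>?S. norm (projP N u k)) \<le> of_nat (card ?S) * sqrt (msq (projP N u))"
    by (intro sum_bounded_above)
  then show "(\<Sum>\<^sub>\<infinity>k. norm (projP N u k)) \<le> real (card ?S) * sqrt (msq (projP N u))"
    using infsumI[OF hs] by simp
qed

lemma inH_I:
  assumes "u 0 = 0" "\<And>k. u (- k) = (cnj (fst (u k)), cnj (snd (u k)))" "\<And>k. dotk k (u k) = 0" "l2 u"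
  shows "inH u"
  using assms by (simp add: inH_def zero_prod_def uminus_prod_def dotk_def l2_def cnorm2_eq)

lemma inV_diff:
  assumes "inV u" "inV v"
  shows "inV (\<lambda>k. u k - v k)"
proof -
  have h: "inH u" "inH v" and g: "l2 (grad u)" "l2 (grad v)" using assms by (auto simp: inV_iff)
  have "inH (\<lambda>k. u k - v k)"
  proof (rule inH_I)
    show "u (- k) - v (- k) = (cnj (fst (u k - v k)), cnj (snd (u k - v k)))" for k
      by (simp add: inH_D(2)[OF h(1)] inH_D(2)[OF h(2)])
  qed (simp_all add: inH_D(1,3)[OF h(1)] inH_D(1,3)[OF h(2)] dotk_diff
      l2_diff(1)[OF inH_D(4)[OF h(1)] inH_D(4)[OF h(2)]])
  moreover have "l2 (grad (\<lambda>k. u k - v k))"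
    using l2_diff(1)[OF g[unfolded msq_grad_eq]] by (simp add: msq_grad_eq scaleR_diff_right)
  ultimately show ?thesis by (simp add: inV_iff)
qed

lemma inV_highP:
  assumes "inV u"
  shows "inV (highP N u)"
proof -
  have h: "inH u" and g: "l2 (grad u)" using assms by (auto simp: inV_iff)
  have "inH (highP N u)"
  proof (rule inH_I)
    show "highP N u (- k) = (cnj (fst (highP N u k)), cnj (snd (highP N u k)))" for k
      by (cases "k = 0 \<or> sqrt (ksq k) \<le> N") (auto simp: highP_def inH_D(2)[OF h] prod_eq_iff)
    show "dotk k (highP N u k) = 0" for k using inH_D(3)[OF h] by (simp add: highP_def)
    show "l2 (highP N u)" by (rule msq_mono(1)[OF inH_D(4)[OF h]]) (simp add: highP_def)
  qed (simp add: highP_def)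
  moreover have "l2 (grad (highP N u))"
    by (rule msq_mono(1)[OF g]) (simp add: highP_def grad_def)
  ultimately show ?thesis by (simp add: inV_iff)
qed

text \<open>Every surviving mode has |k| > N; this is the source of the decay rate \<nu>
  N^2.\<close>

lemma msq_highP_le:
  assumes "inV u" "N > 0"
  shows "N\<^sup>2 * msq (highP N u) \<le> msq (grad (highP N u))"
proof -
  have l: "l2 (highP N u)" "l2 (grad (highP N u))"
    using inV_highP[OF assms(1)] inH_D(4) by (auto simp: inV_iff)
  have "N\<^sup>2 * (norm (highP N u k))\<^sup>2 \<le> (norm (grad (highP N u) k))\<^sup>2" for k
  proof (cases "k = 0 \<or> sqrt (ksq k) \<le> N")
    case False
    then have "N\<^sup>2 \<le> (sqrt (ksq k))\<^sup>2" using assms(2) by (intro power_mono) auto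
    then have "N\<^sup>2 * (norm (highP N u k))\<^sup>2 \<le> ksq k * (norm (highP N u k))\<^sup>2"
      by (intro mult_right_mono) auto
    then show ?thesis by (simp add: grad_sq)
  qed (simp add: highP_def)
  then show ?thesis
    using has_sum_mono[OF has_sum_cmult_right[OF has_sum_infsum[OF l(1)[unfolded l2_def]], of "N\<^sup>2"]
        has_sum_infsum[OF l(2)[unfolded l2_def]]]
    by (simp add: msq_def)
qed

text \<open>The projections vanish on the modes of \<open>q\<close>, so the coupling drops out. All
  terms containing p or g1 - g2 carry a factor |q|, replaced by the a priori bound \<open>Y\<close>;
  only the term quadratic in q keeps the factor \<open>msq q\<close>.\<close>

lemma diff_rate:
  assumes u1: "inDA u1" "inV u1" and u2: "inDA u2" "inV u2" and g: "inH g1" "inH g2"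
    and \<nu>: "\<nu> > 0" and N: "N > 0"
    and CL: "\<forall>u. inV u \<longrightarrow> L4sq u \<le> C_L * normV u * normH u"
  defines "w \<equiv> \<lambda>k. u1 k - u2 k"
  defines "q \<equiv> highP N w"
  defines "M \<equiv> msq (grad u1) + msq (grad u2)"
  assumes p\<epsilon>: "(\<Sum>\<^sub>\<infinity>k. norm (projP N w k)) \<le> \<epsilon>"
    and g\<epsilon>: "sqrt (msq (\<lambda>k. g1 k - g2 k)) \<le> \<epsilon>"
    and Y: "sqrt (msq q) \<le> Y"
    and s: "(\<lambda>k. inner (q k) (rhs \<nu> mu1 mu2 N g1 u1 u2 k - rhs \<nu> mu1 mu2 N g2 u2 u1 k)) summable_on UNIV"
  shows "2 * (\<Sum>\<^sub>\<infinity>k. inner (q k) (rhs \<nu> mu1 mu2 N g1 u1 u2 k - rhs \<nu> mu1 mu2 N g2 u2 u1 k))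
    \<le> - (\<nu> * N\<^sup>2 - (2 * pi * max C_L 0)\<^sup>2 / \<nu> * M) * msq q + \<epsilon> * (2 * (2 + N) * Y) * (1 + M)"
proof -
  define p where "p = projP N w"
  let ?X = "\<lambda>k. inner (q k) (rhs \<nu> mu1 mu2 N g1 u1 u2 k - rhs \<nu> mu1 mu2 N g2 u2 u1 k)"
  have h: "inH u1" "inH u2" and gr: "l2 (grad u1)" "l2 (grad u2)" using u1 u2 by (auto simp: inV_iff)
  have w: "inV w" unfolding w_def by (intro inV_diff u1 u2)
  then have hw: "inH w" by (simp add: inV_iff)
  have q: "inV q" unfolding q_def by (rule inV_highP[OF w])
  then have hq: "inH q" and grq: "l2 (grad q)" by (auto simp: inV_iff)
  have l2: "l2 u1" "l2 u2" "l2 w" "l2 q" using h hw hq by (auto intro: inH_D)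
  have q1: "(\<lambda>k. norm (q k)) summable_on UNIV"
  proof (rule summable_on_comparison_test[OF summable_on_add[OF inDA_l1(1)[OF u1(1)] inDA_l1(1)[OF u2(1)]]])
    show "norm (q k) \<le> norm (u1 k) + norm (u2 k)" for k
      using norm_triangle_ineq4[of "u1 k" "u2 k"] by (simp add: q_def highP_def w_def)
  qed simp
  note p1 = projP_l1(1)[OF l2(3), of N, folded p_def]
  have gpN: "grad p k \<le> N * norm (p k)" for k
    using mult_right_mono[of "sqrt (ksq k)" N "norm (p k)"] by (auto simp: grad_def p_def projP_eq)
  have gp: "grad p summable_on UNIV"
    by (rule summable_on_comparison_test[OF summable_on_cmult_right[OF p1]]) (auto intro: gpN)
  have gple: "infsum (grad p) UNIV \<le> N * (\<Sum>\<^sub>\<infinity>k. norm (p k))"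
    using infsum_mono[OF gp summable_on_cmult_right[OF p1] gpN] by (simp add: infsum_cmult_right')
  have wpq: "u1 k = u2 k + p k + q k" for k
    using projP_plus_highP[of w N k] inH_D(1)[OF hw] by (simp add: p_def q_def w_def algebra_simps)
  let ?t1 = "tri_bound u1 p q" and ?t2 = "tri_bound p u2 q"
  have tr: "tri_bound u1 u1 q summable_on UNIV" "tri_bound u2 u2 q summable_on UNIV" "tri_bound u1 q q summable_on UNIV"
    "?t2 summable_on UNIV" "tri_bound q u2 q summable_on UNIV"
    by (intro tri_bound_l1_first(1) inDA_l1(1) u1 u2 gr grq l2 p1 q1)+
  \<comment> \<open>Here the gradient of p is the absolutely summable factor: p has modes up to N
    only, so its gradient costs a factor N.\<close>
  have tr': "?t1 summable_on UNIV"
    by (intro tri_bound_l1_second(1) l2 gp)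
  have b1: "\<bar>infsum (tri u1 p q) UNIV\<bar> \<le> (N * \<epsilon>) * (sqrt (msq u1) * sqrt (msq q))"
  proof -
    have "\<bar>infsum (tri u1 p q) UNIV\<bar> \<le> infsum (grad p) UNIV * (sqrt (msq u1) * sqrt (msq q))"
      using infsum_tri_le[OF tr'] tri_bound_l1_second(2)[OF l2(1) gp l2(4)] by simp
    also have "\<dots> \<le> (N * \<epsilon>) * (sqrt (msq u1) * sqrt (msq q))"
      using order_trans[OF gple mult_left_mono[OF p\<epsilon>[folded p_def], of N]] N
      by (intro mult_right_mono) auto
    finally show ?thesis .
  qed
  have b2: "\<bar>infsum (tri p u2 q) UNIV\<bar> \<le> \<epsilon> * (sqrt (msq (grad u2)) * sqrt (msq q))"
  proof -
    have "\<bar>infsum (tri p u2 q) UNIV\<bar> \<le> (\<Sum>\<^sub>\<infinity>k. norm (p k)) * (sqrt (msq (grad u2)) * sqrt (msq q))"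
      using infsum_tri_le[OF tr(4)] tri_bound_l1_first(2)[OF p1 gr(2) l2(4)] by simp
    also have "\<dots> \<le> \<epsilon> * (sqrt (msq (grad u2)) * sqrt (msq q))"
      using p\<epsilon> by (intro mult_right_mono) (auto simp: p_def)
    finally show ?thesis .
  qed
  \<comment> \<open>The factor 2 pi comes from passing from norms to coefficient sums: one 2 pi on
    the left of the L4 inequality, two on the right. The maximum with 0 is taken because no sign of
    \<open>C_L\<close> is assumed.\<close>
  define C2 where "C2 = 2 * pi * max C_L 0"
  have L4: "sqrt (L4sum q) \<le> C2 * (sqrt (msq (grad q)) * sqrt (msq q))"
  proof -
    have "2 * pi * sqrt (L4sum q) \<le> C_L * (2 * pi * sqrt (msq (grad q))) * (2 * pi * sqrt (msq q))"
      using CL q by (simp add: L4sq_eq normV_eq normH_eq)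
    also have "\<dots> = 2 * pi * (C_L * (2 * pi * (sqrt (msq (grad q)) * sqrt (msq q))))"
      by (simp add: mult_ac)
    finally have "sqrt (L4sum q) \<le> C_L * (2 * pi * (sqrt (msq (grad q)) * sqrt (msq q)))"
      by (rule mult_left_le_imp_le) simp
    also have "\<dots> \<le> max C_L 0 * (2 * pi * (sqrt (msq (grad q)) * sqrt (msq q)))"
      by (intro mult_right_mono) auto
    finally show ?thesis by (simp add: C2_def mult_ac)
  qed
  have b3: "\<bar>infsum (tri q u2 q) UNIV\<bar> \<le> (C2 * (sqrt (msq (grad u2)) * sqrt (msq q))) * sqrt (msq (grad q))"
  proof -
    have "\<bar>infsum (tri q u2 q) UNIV\<bar> \<le> sqrt (msq (grad u2)) * sqrt (L4sum q)"
      by (rule tri_L4[OF q1 gr(2)])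
    also have "\<dots> \<le> sqrt (msq (grad u2)) * (C2 * (sqrt (msq (grad q)) * sqrt (msq q)))"
      by (intro mult_left_mono L4) auto
    finally show ?thesis by (simp add: mult_ac)
  qed
  have anti: "infsum (tri u1 q q) UNIV = 0"
    by (rule tri_antisym) (auto intro: inH_D h hq)
  have tri_split: "tri u1 u1 q x - tri u2 u2 q x = tri u1 p q x + tri u1 q q x + tri p u2 q x + tri q u2 q x" for x
  proof -
    obtain j l where x: "x = (j, l)" by (rule prod.exhaust)
    have d: "dotk l (u1 j) = dotk l (u2 j) + dotk l (p j) + dotk l (q j)"
      by (simp add: wpq dotk_def algebra_simps)
    have e: "hdot (u1 l) z = hdot (u2 l) z + hdot (p l) z + hdot (q l) z" for z
      by (simp add: wpq hdot_def algebra_simps)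
    show ?thesis
      unfolding x tri_def prod.case plus_complex.sel[symmetric] minus_complex.sel[symmetric]
      by (simp only: d e) (simp add: algebra_simps)
  qed
  have tsplit: "infsum (tri u1 u1 q) UNIV - infsum (tri u2 u2 q) UNIV
      = infsum (tri u1 p q) UNIV + infsum (tri u1 q q) UNIV + infsum (tri p u2 q) UNIV + infsum (tri q u2 q) UNIV"
  proof -
    have "((\<lambda>x. tri u1 u1 q x + - tri u2 u2 q x) has_sum (infsum (tri u1 u1 q) UNIV + - infsum (tri u2 u2 q) UNIV)) UNIV"
      by (intro has_sum_add has_sum_uminusI has_sum_infsum tri_summable tr)
    moreover have "((\<lambda>x. tri u1 p q x + tri u1 q q x + tri p u2 q x + tri q u2 q x) has_sum
      (infsum (tri u1 p q) UNIV + infsum (tri u1 q q) UNIV + infsum (tri p u2 q) UNIV + infsum (tri q u2 q) UNIV)) UNIV"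
      by (intro has_sum_add has_sum_infsum tri_summable tr tr')
    ultimately show ?thesis using tri_split has_sum_unique by fastforce
  qed
  let ?gd = "\<lambda>k. g1 k - g2 k"
  have gd: "l2 ?gd" by (intro l2_diff(1) inH_D(4) g)
  \<comment> \<open>The convective terms are added back before comparing mode by mode; their sums
    are estimated through \<open>tsplit\<close>.\<close>
  have X1: "((\<lambda>k. ?X k + inner (convect u1 u1 k) (q k) + - inner (convect u2 u2 k) (q k)) has_sum
      (infsum ?X UNIV + infsum (tri u1 u1 q) UNIV + - infsum (tri u2 u2 q) UNIV)) UNIV"
    by (intro has_sum_add has_sum_infsum s has_sum_uminusI convect_pairing(1) l2 gr tr)
  have X2: "((\<lambda>k. norm (?gd k) * norm (q k) + (- \<nu>) * (norm (grad q k))\<^sup>2) has_sum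
      ((\<Sum>\<^sub>\<infinity>k. norm (?gd k) * norm (q k)) + (- \<nu>) * msq (grad q))) UNIV"
    unfolding msq_def
    by (intro has_sum_add has_sum_cmult_right has_sum_infsum l2_CS(1) gd l2 grq[unfolded l2_def])
  have pt: "?X k + inner (convect u1 u1 k) (q k) + - inner (convect u2 u2 k) (q k)
      \<le> norm (?gd k) * norm (q k) + (- \<nu>) * (norm (grad q k))\<^sup>2" for k
  proof (cases "k = 0 \<or> sqrt (ksq k) \<le> N")
    case True
    then have "q k = 0" by (auto simp: q_def highP_def)
    then show ?thesis by (simp add: grad_def)
  next
    case False
    then have P: "projP N u k = 0" for u by (simp add: projP_eq)
    have wq: "q k = u1 k - u2 k" using False by (simp add: q_def highP_def w_def)
    have B: "inner (q k) (bilinB u u k) = inner (convect u u k) (q k)" for u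
      using inner_bilinB[of k "q k" u u] inH_D[OF hq] by (auto simp: inner_commute)
    have "rhs \<nu> mu1 mu2 N g1 u1 u2 k - rhs \<nu> mu1 mu2 N g2 u2 u1 k
      = ?gd k - (\<nu> * ksq k) *\<^sub>R q k - bilinB u1 u1 k + bilinB u2 u2 k"
      unfolding rhs_eq P wq by (simp add: algebra_simps)
    then have "?X k + inner (convect u1 u1 k) (q k) + - inner (convect u2 u2 k) (q k)
      = inner (q k) (?gd k) - \<nu> * (norm (grad q k))\<^sup>2"
      by (simp add: inner_add_right inner_diff_right B grad_sq power2_norm_eq_inner)
    also have "inner (q k) (?gd k) \<le> norm (?gd k) * norm (q k)"
      using norm_cauchy_schwarz[of "q k" "?gd k"] by (simp add: mult.commute)
    finally show ?thesis by simp
  qed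
  define a b m n where "a = sqrt (msq (grad q))" and "b = sqrt (msq q)" and "m = sqrt (msq (grad u2))"
    and "n = sqrt (msq u1)"
  note abmn = a_def[symmetric] b_def[symmetric] m_def[symmetric] n_def[symmetric]
  have nn: "a \<ge> 0" "b \<ge> 0" "m \<ge> 0" "n \<ge> 0" by (auto simp: a_def b_def m_def n_def)
  have sq: "a\<^sup>2 = msq (grad q)" "b\<^sup>2 = msq q" "m\<^sup>2 = msq (grad u2)" by (auto simp: a_def b_def m_def)
  have \<epsilon>0: "\<epsilon> \<ge> 0" using g\<epsilon> real_sqrt_ge_zero[OF msq_nonneg] order_trans by blast
  have gb: "(\<Sum>\<^sub>\<infinity>k. norm (?gd k) * norm (q k)) \<le> \<epsilon> * b"
    using l2_CS(2)[OF gd l2(4)] mult_right_mono[OF g\<epsilon> nn(2)] by (simp add: b_def)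
  have main: "infsum ?X UNIV \<le> \<epsilon> * b - \<nu> * a\<^sup>2 + (N * \<epsilon>) * (n * b) + \<epsilon> * (m * b) + (C2 * (m * b)) * a"
    using has_sum_mono[OF X1 X2 pt] gb b1 b2 b3 tsplit anti unfolding abmn sq by linarith
  \<comment> \<open>After doubling, half of the dissipation 2 \<nu> a^2 is spent here, and
    \<open>ab\<close> turns the rest into \<nu> N^2 |q|^2.\<close>
  have yg: "(C2 * (m * b)) * a \<le> (C2 * (m * b))\<^sup>2 / (2 * \<nu>) + \<nu> / 2 * a\<^sup>2"
    by (rule young_half[OF \<nu>])
  have nM: "n \<le> 1 + M"
    using sqrt_le_one_plus[OF msq_nonneg[of u1]] poincare[OF u1(2)] msq_nonneg[of "grad u2"]
    unfolding n_def M_def by linarith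
  have mM: "m \<le> 1 + M"
    using sqrt_le_one_plus[OF msq_nonneg[of "grad u2"]] msq_nonneg[of "grad u1"]
    unfolding m_def M_def by linarith
  have M0: "M \<ge> 0" by (simp add: M_def)
  have small: "\<epsilon> * b + (N * \<epsilon>) * (n * b) + \<epsilon> * (m * b) \<le> \<epsilon> * ((2 + N) * Y) * (1 + M)"
  proof -
    have "1 + N * n + m \<le> (1 + M) + N * (1 + M) + (1 + M)"
      using N M0 by (intro add_mono mult_left_mono nM mM) auto
    then have "b * (1 + N * n + m) \<le> Y * ((1 + M) + N * (1 + M) + (1 + M))"
      using Y nn N by (intro mult_mono) (auto simp: b_def[symmetric])
    then have "\<epsilon> * (b * (1 + N * n + m)) \<le> \<epsilon> * (Y * ((1 + M) + N * (1 + M) + (1 + M)))"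
      using \<epsilon>0 by (rule mult_left_mono)
    then show ?thesis by (simp add: algebra_simps)
  qed
  have ab: "\<nu> * (N\<^sup>2 * b\<^sup>2) \<le> \<nu> * a\<^sup>2"
    using msq_highP_le[OF w N] \<nu> by (intro mult_left_mono) (auto simp: sq q_def)
  have "(C2 * (m * b))\<^sup>2 / \<nu> = (C2\<^sup>2 / \<nu> * m\<^sup>2) * b\<^sup>2" by (simp add: power_mult_distrib)
  also have "\<dots> \<le> (C2\<^sup>2 / \<nu> * M) * b\<^sup>2"
    using \<nu> by (intro mult_right_mono mult_left_mono) (auto simp: sq M_def)
  finally have c: "(C2 * (m * b))\<^sup>2 / \<nu> \<le> (C2\<^sup>2 / \<nu> * M) * b\<^sup>2" .
  have "2 * infsum ?X UNIV \<le> 2 * (\<epsilon> * ((2 + N) * Y) * (1 + M)) + (C2 * (m * b))\<^sup>2 / \<nu> - \<nu> * a\<^sup>2"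
    using main yg small by simp
  also have "\<dots> \<le> 2 * (\<epsilon> * ((2 + N) * Y) * (1 + M)) + (C2\<^sup>2 / \<nu> * M) * b\<^sup>2 - \<nu> * (N\<^sup>2 * b\<^sup>2)"
    using c ab by simp
  also have "\<dots> = - (\<nu> * N\<^sup>2 - C2\<^sup>2 / \<nu> * M) * b\<^sup>2 + \<epsilon> * (2 * (2 + N) * Y) * (1 + M)"
    by (simp add: algebra_simps)
  finally show ?thesis unfolding sq C2_def .
qed

section \<open>Solutions of the nudging intertwinement\<close>

lemma msq_Pair:
  assumes "l2 u" "l2 v"
  shows "l2 (\<lambda>k. (u k, v k))" and "msq (\<lambda>k. (u k, v k)) = msq u + msq v"
proof -
  have "((\<lambda>k. (norm (u k))\<^sup>2 + (norm (v k))\<^sup>2) has_sum (msq u + msq v)) UNIV"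
    using assms unfolding l2_def msq_def by (intro has_sum_add has_sum_infsum)
  then have "((\<lambda>k. (norm (u k, v k))\<^sup>2) has_sum (msq u + msq v)) UNIV" by (simp add: norm_Pair)
  then show "l2 (\<lambda>k. (u k, v k))" "msq (\<lambda>k. (u k, v k)) = msq u + msq v"
    by (auto simp: l2_def msq_def has_sum_iff)
qed

text \<open>The uniform bound in \<open>Linf_H\<close> makes the supremum in \<open>gfrak\<close> a
  genuine upper bound.\<close>

lemma msq_le_gfrak:
  assumes "Linf_H g" "\<nu> > 0" "t \<ge> 0"
  shows "msq (g t) \<le> (\<nu>\<^sup>2 * gfrak \<nu> g)\<^sup>2 / (4 * pi\<^sup>2)"
proof -
  obtain B where "\<forall>t\<ge>0. normH (g t) \<le> B" using assms(1) unfolding Linf_H_def by blast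
  then have "bdd_above ((\<lambda>t. normH (g t)) ` {0..})"
    by (intro bdd_aboveI2[where M = B]) auto
  then have "normH (g t) \<le> (SUP t\<in>{0..}. normH (g t))"
    using assms(3) by (intro cSUP_upper) auto
  also have "\<dots> = \<nu>\<^sup>2 * gfrak \<nu> g" using assms(2) by (simp add: gfrak_def)
  finally have "(normH (g t))\<^sup>2 \<le> (\<nu>\<^sup>2 * gfrak \<nu> g)\<^sup>2"
    by (rule power_mono) (simp add: normH_eq)
  then show ?thesis by (simp add: normH_eq power_mult_distrib field_simps)
qed

locale nudging_pair =
  fixes \<nu> mu1 mu2 N C_L :: real and g1 g2 v1 v2 :: "real \<Rightarrow> vfield"
  assumes nu: "\<nu> > 0" and mu: "mu1 \<ge> mu2" "mu2 \<ge> 0" and N: "N > 0"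
    and CL: "\<forall>u. inV u \<longrightarrow> L4sq u \<le> C_L * normV u * normH u"
    and g1: "Linf_H g1" and g2: "Linf_H g2"
    and sol: "nudging_solution \<nu> mu1 mu2 N g1 g2 v1 v2"
begin

definition R1 :: "real \<Rightarrow> vfield" where "R1 t k = rhs \<nu> mu1 mu2 N (g1 t) (v1 t) (v2 t) k"
definition R2 :: "real \<Rightarrow> vfield" where "R2 t k = rhs \<nu> mu1 mu2 N (g2 t) (v2 t) (v1 t) k"
text \<open>This is (||v1||^2 + ||v2||^2) / (4 pi^2); the energy \<open>E\<close> is scaled in the
  same way.\<close>

definition M :: "real \<Rightarrow> real" where "M t = msq (grad (v1 t)) + msq (grad (v2 t))"
definition E :: "real \<Rightarrow> real" where "E t = msq (v1 t) + msq (v2 t)"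
definition q :: "real \<Rightarrow> vfield" where "q t = highP N (\<lambda>k. v1 t k - v2 t k)"
text \<open>Bound for the rate of energy input (|g1|^2 + |g2|^2) / \<nu>, again divided by 4 pi^2:
  |g_j| is at most \<nu>^2 times its \<open>gfrak\<close>.\<close>

definition G :: "real" where "G = \<nu> ^ 3 * ((gfrak \<nu> g1)\<^sup>2 + (gfrak \<nu> g2)\<^sup>2) / (4 * pi\<^sup>2)"

lemma sol_cont:
  assumes "T > 0"
  shows "cont_V v1 T" "cont_V v2 T" "L2_DA v1 T" "L2_DA v2 T"
  using sol assms by (auto simp: nudging_solution_def)

lemma inV_v:
  assumes "t \<ge> 0"
  shows "inV (v1 t)" "inV (v2 t)"
  using sol_cont(1,2)[of "t + 1"] assms by (auto simp: cont_V_def)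

lemma l2_v:
  assumes "t \<ge> 0"
  shows "l2 (v1 t)" "l2 (v2 t)"
  using inV_v[OF assms] by (auto simp: inV_iff intro: inH_D)

lemma inH_g:
  assumes "t \<ge> 0"
  shows "inH (g1 t)" "inH (g2 t)"
  using g1 g2 assms by (auto simp: Linf_H_def)

lemma inV_q: "t \<ge> 0 \<Longrightarrow> inV (q t)"
  unfolding q_def by (intro inV_highP inV_diff inV_v)

lemma M_nonneg: "M t \<ge> 0" and E_nonneg: "E t \<ge> 0"
  by (auto simp: M_def E_def)

lemma G_nonneg: "G \<ge> 0"
  unfolding G_def using nu by simp

lemma E_le_M: "t \<ge> 0 \<Longrightarrow> E t \<le> M t"
  unfolding E_def M_def by (intro add_mono poincare inV_v)

lemma msq_q_le: "t \<ge> 0 \<Longrightarrow> msq (q t) \<le> 2 * E t"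
proof -
  assume t: "t \<ge> 0"
  have "msq (q t) \<le> msq (\<lambda>k. v1 t k - v2 t k)"
    unfolding q_def by (rule msq_mono(2)[OF l2_diff(1)[OF l2_v[OF t]]]) (simp add: highP_def)
  then show ?thesis using l2_diff(2)[OF l2_v[OF t]] by (simp add: E_def)
qed

lemma msq_g_le:
  assumes "t \<ge> 0"
  shows "(msq (g1 t) + msq (g2 t)) / \<nu> \<le> G"
proof -
  have "msq (g1 t) + msq (g2 t) \<le> (\<nu>\<^sup>2 * gfrak \<nu> g1)\<^sup>2 / (4 * pi\<^sup>2) + (\<nu>\<^sup>2 * gfrak \<nu> g2)\<^sup>2 / (4 * pi\<^sup>2)"
    by (intro add_mono msq_le_gfrak g1 g2 nu assms)
  also have "\<dots> = \<nu> * G"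
    by (simp add: G_def add_divide_distrib[symmetric]) (simp add: eval_nat_numeral algebra_simps)
  finally show ?thesis using nu by (simp add: field_simps)
qed

lemma AE_inDA:
  assumes "T > 0"
  shows "AE t in lborel. t \<in> {0..T} \<longrightarrow> inDA (v1 t) \<and> inDA (v2 t)"
  using sol_cont(3,4)[OF assms] by (auto simp: L2_DA_def elim!: AE_mp)

lemma component_integral:
  assumes "t \<ge> 0"
  shows "set_integrable lborel {0..t} (\<lambda>s. R1 s k)" "v1 t k = v1 0 k + (LINT s:{0..t}|lborel. R1 s k)"
    "set_integrable lborel {0..t} (\<lambda>s. R2 s k)" "v2 t k = v2 0 k + (LINT s:{0..t}|lborel. R2 s k)"
proof -
  have *: "\<forall>i\<in>{fst, snd}. set_integrable lborel {0..t} (\<lambda>s. i (R1 s k)) \<and>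
      i (v1 t k) = i (v1 0 k) + (LINT s:{0..t}|lborel. i (R1 s k)) \<and>
      set_integrable lborel {0..t} (\<lambda>s. i (R2 s k)) \<and>
      i (v2 t k) = i (v2 0 k) + (LINT s:{0..t}|lborel. i (R2 s k))"
    using sol assms unfolding nudging_solution_def R1_def R2_def by blast
  have i: "set_integrable lborel {0..t} (\<lambda>s. fst (R1 s k))" "set_integrable lborel {0..t} (\<lambda>s. snd (R1 s k))"
    "set_integrable lborel {0..t} (\<lambda>s. fst (R2 s k))" "set_integrable lborel {0..t} (\<lambda>s. snd (R2 s k))"
    using * by auto
  show "set_integrable lborel {0..t} (\<lambda>s. R1 s k)" "set_integrable lborel {0..t} (\<lambda>s. R2 s k)"
    by (intro set_integral_Pair(1) i)+
  show "v1 t k = v1 0 k + (LINT s:{0..t}|lborel. R1 s k)"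
    unfolding set_integral_Pair(2)[OF i(1,2)] using * by (intro prod_eqI) auto
  show "v2 t k = v2 0 k + (LINT s:{0..t}|lborel. R2 s k)"
    unfolding set_integral_Pair(2)[OF i(3,4)] using * by (intro prod_eqI) auto
qed

lemma continuous_on_M: "0 \<le> s \<Longrightarrow> continuous_on {s..t} M"
proof -
  assume s: "0 \<le> s"
  \<comment> \<open>A positive horizon that contains {s..t} for every t, also when the interval is
    empty.\<close>
  let ?T = "max t 0 + 1"
  have "continuous_on {0..?T} M"
    unfolding M_def by (intro continuous_on_add cont_V_continuous sol_cont) auto
  then show ?thesis by (rule continuous_on_subset) (use s in auto)
qed

lemma continuous_on_msq_v:
  assumes s: "0 \<le> s" and c: "\<And>T. T > 0 \<Longrightarrow> cont_V v T"
  shows "continuous_on {s..t} (\<lambda>\<tau>. msq (v \<tau>))"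
proof -
  let ?T = "max t 0 + 1"
  have T: "cont_V v ?T" by (rule c) simp
  have V: "inV (v \<tau>)" if "\<tau> \<in> {0..?T}" for \<tau> using T that by (auto simp: cont_V_def)
  have "continuous_on {0..?T} (\<lambda>\<tau>. msq (v \<tau>))"
  proof (rule continuous_on_msq)
    show "l2 (v \<tau>)" if "\<tau> \<in> {0..?T}" for \<tau> using V[OF that] by (auto simp: inV_iff intro: inH_D)
    show "((\<lambda>s. msq (\<lambda>k. v s k - v \<tau> k)) \<longlongrightarrow> 0) (at \<tau> within {0..?T})" if \<tau>: "\<tau> \<in> {0..?T}" for \<tau>
    proof (rule Lim_null_comparison[OF _ cont_V_lim[OF T \<tau>]])
      show "\<forall>\<^sub>F s in at \<tau> within {0..?T}. norm (msq (\<lambda>k. v s k - v \<tau> k)) \<le> msq (grad (\<lambda>k. v s k - v \<tau> k))"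
        unfolding eventually_at_filter
        using poincare[OF inV_diff[OF V V[OF \<tau>]]] by (auto intro!: always_eventually)
    qed
  qed
  then show ?thesis by (rule continuous_on_subset) (use s in auto)
qed

lemma continuous_on_E: "0 \<le> s \<Longrightarrow> continuous_on {s..t} E"
  unfolding E_def by (intro continuous_on_add continuous_on_msq_v sol_cont)

lemma continuous_on_q:
  assumes s: "0 \<le> s"
  shows "continuous_on {s..t} (\<lambda>\<tau>. msq (q \<tau>))"
proof -
  let ?T = "max t 0 + 1"
  have T: "cont_V v1 ?T" "cont_V v2 ?T" by (rule sol_cont; simp)+
  have "continuous_on {0..?T} (\<lambda>\<tau>. msq (q \<tau>))"
  proof (rule continuous_on_msq)
    show "l2 (q \<tau>)" if "\<tau> \<in> {0..?T}" for \<tau> using inV_q[of \<tau>] that by (auto simp: inV_iff intro: inH_D)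
    show "((\<lambda>s. msq (\<lambda>k. q s k - q \<tau> k)) \<longlongrightarrow> 0) (at \<tau> within {0..?T})" if \<tau>: "\<tau> \<in> {0..?T}" for \<tau>
    proof (rule Lim_null_comparison)
      let ?d1 = "\<lambda>s k. v1 s k - v1 \<tau> k" and ?d2 = "\<lambda>s k. v2 s k - v2 \<tau> k"
      have "((\<lambda>s. 2 * msq (grad (?d1 s)) + 2 * msq (grad (?d2 s))) \<longlongrightarrow> 2 * 0 + 2 * 0) (at \<tau> within {0..?T})"
        by (intro tendsto_intros cont_V_lim T \<tau>)
      then show "((\<lambda>s. 2 * msq (grad (?d1 s)) + 2 * msq (grad (?d2 s))) \<longlongrightarrow> 0) (at \<tau> within {0..?T})" by simp
      have "msq (\<lambda>k. q s k - q \<tau> k) \<le> 2 * msq (grad (?d1 s)) + 2 * msq (grad (?d2 s))" if s: "s \<ge> 0" for s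
      proof -
        have \<tau>0: "\<tau> \<ge> 0" using \<tau> by simp
        have V: "inV (?d1 s)" "inV (?d2 s)" by (intro inV_diff inV_v s \<tau>0)+
        then have l: "l2 (?d1 s)" "l2 (?d2 s)" by (auto simp: inV_iff intro: inH_D)
        have "msq (\<lambda>k. q s k - q \<tau> k) \<le> msq (\<lambda>k. ?d1 s k - ?d2 s k)"
          by (rule msq_mono(2)[OF l2_diff(1)[OF l]]) (simp add: q_def highP_def algebra_simps)
        also have "\<dots> \<le> 2 * msq (?d1 s) + 2 * msq (?d2 s)" by (rule l2_diff(2)[OF l])
        also have "\<dots> \<le> 2 * msq (grad (?d1 s)) + 2 * msq (grad (?d2 s))"
          by (intro add_mono mult_left_mono poincare V) auto
        finally show ?thesis .
      qed
      then show "\<forall>\<^sub>F s in at \<tau> within {0..?T}. norm (msq (\<lambda>k. q s k - q \<tau> k)) \<le> 2 * msq (grad (?d1 s)) + 2 * msq (grad (?d2 s))"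
        unfolding eventually_at_filter by (auto intro!: always_eventually)
    qed
  qed
  then show ?thesis by (rule continuous_on_subset) (use s in auto)
qed

text \<open>The majorant of \<open>rhs_pairing\<close>, affine in \<open>msq (stokesA u)\<close> and
  hence integrable in time along a solution.\<close>

definition pairing_bound :: "real \<Rightarrow> vfield \<Rightarrow> real" where "pairing_bound K u = K * K + \<nu> * ((1 + msq (stokesA u)) * K)
  + (2 * msq (stokesA u) + infsum lattice_weight UNIV) * (K * K) + mu1 * (K * K) + mu2 * (K * K)"

lemma set_integrable_pairing_bound:
  assumes "L2_DA v T"
  shows "set_integrable lborel {0..T} (\<lambda>t. pairing_bound K (v t))"
proof -
  let ?\<alpha> = "K * K + \<nu> * K + infsum lattice_weight UNIV * (K * K) + mu1 * (K * K) + mu2 * (K * K)"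
  let ?\<beta> = "\<nu> * K + 2 * (K * K)"
  have "set_integrable lborel {0..T} (\<lambda>t. ?\<alpha> + ?\<beta> * (1 / (4 * pi\<^sup>2) * (normH (stokesA (v t)))\<^sup>2))"
    using assms unfolding L2_DA_def
    by (intro set_integral_add(1) set_integrable_mult_right
        borel_integrable_atLeastAtMost'[OF continuous_on_const]) blast
  moreover have "1 / (4 * pi\<^sup>2) * (normH (stokesA (v t)))\<^sup>2 = msq (stokesA (v t))" for t
    by (simp add: normH_eq power_mult_distrib)
  moreover have "?\<alpha> + ?\<beta> * msq (stokesA (v t)) = pairing_bound K (v t)" for t
    by (simp add: pairing_bound_def algebra_simps)
  ultimately show ?thesis by (simp only:)
qed

text \<open>\<open>M\<close> is continuous on a compact interval and controls the other norms of the
  fields. \<open>K\<close> depends on T; it enters only the domination and no final estimate, so its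
  growth does no harm.\<close>

lemma uniform_bounds_on:
  assumes "T > 0"
  obtains K where "K \<ge> 0" "\<And>t. t \<in> {0..T} \<Longrightarrow> sqrt (msq (g1 t)) \<le> K \<and> sqrt (msq (g2 t)) \<le> K \<and>
    sqrt (msq (v1 t)) \<le> K \<and> sqrt (msq (v2 t)) \<le> K \<and> sqrt (msq (q t)) \<le> K \<and>
    sqrt (msq (grad (v1 t))) \<le> K \<and> sqrt (msq (grad (v2 t))) \<le> K"
proof -
  have "bounded (M ` {0..T})"
    by (intro compact_imp_bounded compact_continuous_image continuous_on_M) auto
  then obtain B where "\<forall>x\<in>M ` {0..T}. norm x \<le> B"
    unfolding bounded_iff by blast
  then have B: "\<And>t. t \<in> {0..T} \<Longrightarrow> M t \<le> B" by force
  have B0: "B \<ge> 0" using B[of 0] M_nonneg[of 0] assms by simp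
  define K where "K = 1 + 2 * B + \<nu> * G"
  have le: "sqrt x \<le> K" if "x \<ge> 0" "x \<le> 2 * B + \<nu> * G" for x
    using sqrt_le_one_plus[OF that(1)] that(2) by (simp add: K_def)
  have \<nu>G: "\<nu> * G \<ge> 0" using nu G_nonneg by simp
  show thesis
  proof
    show "K \<ge> 0" using \<nu>G B0 by (simp add: K_def)
    fix t assume t: "t \<in> {0..T}"
    then have t0: "t \<ge> 0" by simp
    have m: "msq (g1 t) + msq (g2 t) \<le> \<nu> * G" using msq_g_le[OF t0] nu by (simp add: field_simps)
    note nn = msq_nonneg[of "g1 t"] msq_nonneg[of "g2 t"] msq_nonneg[of "v1 t"] msq_nonneg[of "v2 t"]
      msq_nonneg[of "grad (v1 t)"] msq_nonneg[of "grad (v2 t)"]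
    note f = B[OF t, unfolded M_def] E_le_M[OF t0, unfolded E_def M_def] msq_q_le[OF t0, unfolded E_def] m \<nu>G B0
    have "msq (q t) \<le> 2 * M t" using msq_q_le[OF t0] E_le_M[OF t0] by linarith
    also have "\<dots> \<le> 2 * B + \<nu> * G" using B[OF t] \<nu>G by linarith
    finally have "msq (q t) \<le> 2 * B + \<nu> * G" .
    moreover have "msq (grad (v1 t)) \<le> 2 * B + \<nu> * G" "msq (grad (v2 t)) \<le> 2 * B + \<nu> * G"
      "msq (v1 t) \<le> 2 * B + \<nu> * G" "msq (v2 t) \<le> 2 * B + \<nu> * G"
      "msq (g1 t) \<le> 2 * B + \<nu> * G" "msq (g2 t) \<le> 2 * B + \<nu> * G"
      using nn f by linarith+
    ultimately show "sqrt (msq (g1 t)) \<le> K \<and> sqrt (msq (g2 t)) \<le> K \<and>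
      sqrt (msq (v1 t)) \<le> K \<and> sqrt (msq (v2 t)) \<le> K \<and> sqrt (msq (q t)) \<le> K \<and>
      sqrt (msq (grad (v1 t))) \<le> K \<and> sqrt (msq (grad (v2 t))) \<le> K"
      by (simp add: le)
  qed
qed

text \<open>The two fields are joined into one with values in pairs, since the coupling terms are
  dissipative only jointly.\<close>

lemma E_increment:
  assumes st: "0 \<le> s" "s \<le> t"
  shows "E t - E s \<le> integral {s..t} (\<lambda>\<tau>. G - \<nu> * M \<tau>)"
proof -
  define T where "T = t + 1"
  have T: "T > 0" "t \<le> T" using st by (auto simp: T_def)
  obtain K where K0: "K \<ge> 0" and K: "\<And>t. t \<in> {0..T} \<Longrightarrow> sqrt (msq (g1 t)) \<le> K \<and> sqrt (msq (g2 t)) \<le> K \<and>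
    sqrt (msq (v1 t)) \<le> K \<and> sqrt (msq (v2 t)) \<le> K \<and> sqrt (msq (q t)) \<le> K \<and>
    sqrt (msq (grad (v1 t))) \<le> K \<and> sqrt (msq (grad (v2 t))) \<le> K"
    by (rule uniform_bounds_on[OF T(1)]) blast
  let ?c = "\<lambda>\<tau> k. (v1 \<tau> k, v2 \<tau> k)" and ?r = "\<lambda>\<tau> k. (R1 \<tau> k, R2 \<tau> k)"
  have "msq (?c t) - msq (?c s) \<le> integral {s..t} (\<lambda>\<tau>. G - \<nu> * M \<tau>)"
  proof (rule energy_inequality[where R = "\<lambda>\<tau>. pairing_bound K (v1 \<tau>) + pairing_bound K (v2 \<tau>)"])
    have i: "set_integrable lborel {0..\<tau>} (\<lambda>s. fst (?r s k))" "set_integrable lborel {0..\<tau>} (\<lambda>s. snd (?r s k))"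
      if "\<tau> \<ge> 0" for \<tau> k using component_integral[OF that, of k] by auto
    show "set_integrable lborel {0..T} (\<lambda>\<tau>. ?r \<tau> k)" for k
      using T by (intro set_integral_Pair(1) i) auto
    show "?c \<tau> k = ?c 0 k + (LINT a:{0..\<tau>}|lborel. ?r a k)" if "\<tau> \<in> {0..T}" for k \<tau>
    proof -
      have \<tau>0: "\<tau> \<ge> 0" using that by simp
      show ?thesis unfolding set_integral_Pair(2)[OF i[OF \<tau>0]]
        using component_integral(2,4)[OF \<tau>0, of k] by simp
    qed
    show "l2 (?c \<tau>)" if "\<tau> \<in> {0..T}" for \<tau> using that by (intro msq_Pair l2_v) auto
    show "set_integrable lborel {0..T} (\<lambda>\<tau>. pairing_bound K (v1 \<tau>) + pairing_bound K (v2 \<tau>))"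
      by (intro set_integral_add(1) set_integrable_pairing_bound sol_cont T)
    show "continuous_on {s..t} (\<lambda>\<tau>. G - \<nu> * M \<tau>)"
      by (intro continuous_intros continuous_on_M st)
    show "AE \<tau> in lborel. \<tau> \<in> {0..T} \<longrightarrow>
      (\<lambda>k. \<bar>inner (?c \<tau> k) (?r \<tau> k)\<bar>) summable_on UNIV \<and>
      (\<Sum>\<^sub>\<infinity>k. \<bar>inner (?c \<tau> k) (?r \<tau> k)\<bar>) \<le> pairing_bound K (v1 \<tau>) + pairing_bound K (v2 \<tau>) \<and>
      (\<tau> \<in> {s..t} \<longrightarrow> 2 * (\<Sum>\<^sub>\<infinity>k. inner (?c \<tau> k) (?r \<tau> k)) \<le> G - \<nu> * M \<tau>)"
      using AE_inDA[OF T(1)]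
    proof eventually_elim
      case (elim \<tau>)
      show ?case
      proof
        assume \<tau>: "\<tau> \<in> {0..T}"
        then have \<tau>0: "\<tau> \<ge> 0" and DA: "inDA (v1 \<tau>)" "inDA (v2 \<tau>)" using elim by auto
        have V: "inV (v1 \<tau>)" "inV (v2 \<tau>)" and H: "inH (v1 \<tau>)" "inH (v2 \<tau>)"
          using inV_v[OF \<tau>0] by (auto simp: inV_iff)
        have nn: "\<nu> \<ge> 0" "mu1 \<ge> 0" using nu mu by auto
        note p1 = rhs_pairing[OF DA(1) V(1) H(2) inH_g(1)[OF \<tau>0] l2_v(1)[OF \<tau>0] inH_D(3)[OF H(1)] inH_D(1)[OF H(1)]
            nn mu(2) K0, of N]
        note p2 = rhs_pairing[OF DA(2) V(2) H(1) inH_g(2)[OF \<tau>0] l2_v(2)[OF \<tau>0] inH_D(3)[OF H(2)] inH_D(1)[OF H(2)]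
            nn mu(2) K0, of N]
        have s1: "(\<lambda>k. \<bar>inner (v1 \<tau> k) (R1 \<tau> k)\<bar>) summable_on UNIV" "(\<Sum>\<^sub>\<infinity>k. \<bar>inner (v1 \<tau> k) (R1 \<tau> k)\<bar>) \<le> pairing_bound K (v1 \<tau>)"
          and s2: "(\<lambda>k. \<bar>inner (v2 \<tau> k) (R2 \<tau> k)\<bar>) summable_on UNIV" "(\<Sum>\<^sub>\<infinity>k. \<bar>inner (v2 \<tau> k) (R2 \<tau> k)\<bar>) \<le> pairing_bound K (v2 \<tau>)"
          unfolding R1_def R2_def pairing_bound_def using K[OF \<tau>] by (intro p1 p2; simp)+
        have ss: "(\<lambda>k. \<bar>inner (v1 \<tau> k) (R1 \<tau> k)\<bar> + \<bar>inner (v2 \<tau> k) (R2 \<tau> k)\<bar>) summable_on UNIV"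
          by (intro summable_on_add s1 s2)
        have a: "(\<lambda>k. \<bar>inner (?c \<tau> k) (?r \<tau> k)\<bar>) summable_on UNIV"
          by (rule summable_on_comparison_test[OF ss]) auto
        have "(\<Sum>\<^sub>\<infinity>k. \<bar>inner (?c \<tau> k) (?r \<tau> k)\<bar>) \<le> (\<Sum>\<^sub>\<infinity>k. \<bar>inner (v1 \<tau> k) (R1 \<tau> k)\<bar> + \<bar>inner (v2 \<tau> k) (R2 \<tau> k)\<bar>)"
          by (intro infsum_mono a ss) auto
        also have "\<dots> \<le> pairing_bound K (v1 \<tau>) + pairing_bound K (v2 \<tau>)"
          using infsum_add[OF s1(1) s2(1)] s1(2) s2(2) by linarith
        finally have b: "(\<Sum>\<^sub>\<infinity>k. \<bar>inner (?c \<tau> k) (?r \<tau> k)\<bar>) \<le> pairing_bound K (v1 \<tau>) + pairing_bound K (v2 \<tau>)" .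
        have a': "(\<lambda>k. inner (?c \<tau> k) (?r \<tau> k)) summable_on UNIV"
          by (rule abs_summable_summable) (use a in simp)
        have "2 * (\<Sum>\<^sub>\<infinity>k. inner (?c \<tau> k) (?r \<tau> k)) \<le> (msq (g1 \<tau>) + msq (g2 \<tau>)) / \<nu> - \<nu> * M \<tau>"
          unfolding R1_def R2_def M_def
          by (rule energy_rate[OF DA(1) V(1) DA(2) V(2) inH_g[OF \<tau>0] nu mu a'[unfolded R1_def R2_def]])
        then have "2 * (\<Sum>\<^sub>\<infinity>k. inner (?c \<tau> k) (?r \<tau> k)) \<le> G - \<nu> * M \<tau>"
          using msq_g_le[OF \<tau>0] by linarith
        then show "(\<lambda>k. \<bar>inner (?c \<tau> k) (?r \<tau> k)\<bar>) summable_on UNIV \<and>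
          (\<Sum>\<^sub>\<infinity>k. \<bar>inner (?c \<tau> k) (?r \<tau> k)\<bar>) \<le> pairing_bound K (v1 \<tau>) + pairing_bound K (v2 \<tau>) \<and>
          (\<tau> \<in> {s..t} \<longrightarrow> 2 * (\<Sum>\<^sub>\<infinity>k. inner (?c \<tau> k) (?r \<tau> k)) \<le> G - \<nu> * M \<tau>)"
          using a b by blast
      qed
    qed
  qed (use st T in auto)
  then show ?thesis using st by (simp add: E_def msq_Pair l2_v)
qed

section \<open>Uniform energy bound and time averages of \<open>M\<close>\<close>

definition Emax :: "real" where "Emax = E 0 + G / \<nu>"

lemma integrable_M: "0 \<le> s \<Longrightarrow> M integrable_on {s..t}"
  by (intro integrable_continuous_real continuous_on_M)

text \<open>The smallest nonzero wavenumber is 1, so the dissipation \<nu> \<open>M\<close>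
  dominates \<nu> \<open>E\<close> and Gronwall applies with constant rate \<nu> and no
  deficit.\<close>

lemma E_bounded:
  assumes t: "t \<ge> 0"
  shows "E t \<le> Emax"
proof -
  have "E t \<le> exp 0 * (exp (- \<nu> * (t - 0)) * E 0 + G / \<nu>)"
  proof (rule gronwall_decay[where a = "\<lambda>_. \<nu>" and D = 0])
    fix r r' assume r: "0 \<le> r" "r \<le> r'" "r' \<le> t"
    have "E r' - E r \<le> integral {r..r'} (\<lambda>\<tau>. G - \<nu> * M \<tau>)"
      by (rule E_increment[OF r(1,2)])
    also have "\<dots> \<le> integral {r..r'} (\<lambda>\<tau>. G - \<nu> * E \<tau>)"
      using r E_le_M nu
      by (intro integral_le integrable_continuous_real continuous_intros continuous_on_M continuous_on_E)
        auto
    finally show "E r' - E r \<le> integral {r..r'} (\<lambda>\<tau>. G - \<nu> * E \<tau>)" .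
  qed (use t nu G_nonneg E_nonneg in \<open>auto intro!: continuous_on_E continuous_intros\<close>)
  also have "\<dots> \<le> 1 * E 0 + G / \<nu>"
    using nu t E_nonneg[of 0] by (simp add: mult_left_le_one_le)
  finally show ?thesis by (simp add: Emax_def)
qed

text \<open>The energy balance with the final energy discarded. The excess over the linear growth
  does not depend on the interval, as \<open>Emax\<close> bounds the energy at every starting
  time.\<close>

lemma integral_M_le:
  assumes st: "0 \<le> s" "s \<le> t"
  shows "\<nu> * integral {s..t} M \<le> G * (t - s) + Emax"
proof -
  have "E t - E s \<le> integral {s..t} (\<lambda>\<tau>. G - \<nu> * M \<tau>)" by (rule E_increment[OF st])
  also have "\<dots> = G * (t - s) - \<nu> * integral {s..t} M"
    using st by (subst Henstock_Kurzweil_Integration.integral_diff)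
      (auto intro!: integrable_M integrable_on_mult_right simp: mult.commute)
  finally show ?thesis using E_nonneg[of t] E_bounded[OF st(1)] by linarith
qed

section \<open>Decay of the high modes of the difference\<close>

lemma q_increment:
  assumes s0: "0 \<le> s0" and st: "s0 \<le> s" "s \<le> t"
    and \<epsilon>: "\<And>\<tau>. \<tau> \<ge> s0 \<Longrightarrow> (\<Sum>\<^sub>\<infinity>k. norm (projP N (\<lambda>k. v1 \<tau> k - v2 \<tau> k) k)) \<le> \<epsilon>"
      "\<And>\<tau>. \<tau> \<ge> s0 \<Longrightarrow> sqrt (msq (\<lambda>k. g1 \<tau> k - g2 \<tau> k)) \<le> \<epsilon>"
  shows "msq (q t) - msq (q s) \<le> integral {s..t} (\<lambda>\<tau>.
    - (\<nu> * N\<^sup>2 - (2 * pi * max C_L 0)\<^sup>2 / \<nu> * M \<tau>) * msq (q \<tau>)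
    + \<epsilon> * (2 * (2 + N) * sqrt (2 * Emax)) * (1 + M \<tau>))"
proof -
  let ?f = "\<lambda>\<tau>. - (\<nu> * N\<^sup>2 - (2 * pi * max C_L 0)\<^sup>2 / \<nu> * M \<tau>) * msq (q \<tau>)
    + \<epsilon> * (2 * (2 + N) * sqrt (2 * Emax)) * (1 + M \<tau>)"
  have s: "0 \<le> s" using s0 st by simp
  define T where "T = t + 1"
  have T: "T > 0" "t \<le> T" using st s by (auto simp: T_def)
  obtain K where K0: "K \<ge> 0" and K: "\<And>t. t \<in> {0..T} \<Longrightarrow> sqrt (msq (g1 t)) \<le> K \<and> sqrt (msq (g2 t)) \<le> K \<and>
    sqrt (msq (v1 t)) \<le> K \<and> sqrt (msq (v2 t)) \<le> K \<and> sqrt (msq (q t)) \<le> K \<and>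
    sqrt (msq (grad (v1 t))) \<le> K \<and> sqrt (msq (grad (v2 t))) \<le> K"
    by (rule uniform_bounds_on[OF T(1)]) blast
  \<comment> \<open>The difference of the right-hand sides is cut off like \<open>q\<close>, so that
    the integrated equation holds for every k; pairing with \<open>q\<close> does not see the
    cut.\<close>
  define r where "r \<tau> k = (if k = 0 \<or> sqrt (ksq k) \<le> N then 0 else R1 \<tau> k - R2 \<tau> k)" for \<tau> k
  have qr: "inner (q \<tau> k) (r \<tau> k) = inner (q \<tau> k) (R1 \<tau> k - R2 \<tau> k)" for \<tau> k
    by (simp add: q_def highP_def r_def)
  show ?thesis
  proof (rule energy_inequality[where r = r and R = "\<lambda>\<tau>. pairing_bound K (v1 \<tau>) + pairing_bound K (v2 \<tau>)" and T = T])
    show "set_integrable lborel {0..T} (\<lambda>\<tau>. r \<tau> k)" for k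
    proof (cases "k = 0 \<or> sqrt (ksq k) \<le> N")
      case True
      then show ?thesis by (simp add: r_def set_integrable_def)
    next
      case False
      then show ?thesis using T component_integral(1,3)[of T k] by (simp add: r_def)
    qed
    show "q \<tau> k = q 0 k + (LINT a:{0..\<tau>}|lborel. r a k)" if "\<tau> \<in> {0..T}" for k \<tau>
    proof (cases "k = 0 \<or> sqrt (ksq k) \<le> N")
      case True
      then show ?thesis by (simp add: r_def q_def highP_def set_lebesgue_integral_def)
    next
      case False
      have \<tau>0: "\<tau> \<ge> 0" using that by simp
      note c = component_integral[OF \<tau>0, of k]
      have "(LINT a:{0..\<tau>}|lborel. r a k) = (LINT a:{0..\<tau>}|lborel. R1 a k) - (LINT a:{0..\<tau>}|lborel. R2 a k)"
        using False c(1,3) by (simp add: r_def)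
      moreover have "q \<tau> k - q 0 k = (v1 \<tau> k - v1 0 k) - (v2 \<tau> k - v2 0 k)"
        using False by (simp add: q_def highP_def)
      moreover have "v1 \<tau> k - v1 0 k = (LINT a:{0..\<tau>}|lborel. R1 a k)"
        "v2 \<tau> k - v2 0 k = (LINT a:{0..\<tau>}|lborel. R2 a k)"
        using c(2,4) by (simp_all add: algebra_simps)
      ultimately have "q \<tau> k - q 0 k = (LINT a:{0..\<tau>}|lborel. r a k)" by simp
      then show ?thesis by (simp add: algebra_simps)
    qed
    show "l2 (q \<tau>)" if "\<tau> \<in> {0..T}" for \<tau>
      using inV_q[of \<tau>] that by (auto simp: inV_iff intro: inH_D)
    show "set_integrable lborel {0..T} (\<lambda>\<tau>. pairing_bound K (v1 \<tau>) + pairing_bound K (v2 \<tau>))"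
      by (intro set_integral_add(1) set_integrable_pairing_bound sol_cont T)
    show "continuous_on {s..t} ?f"
      by (intro continuous_intros continuous_on_M continuous_on_q s)
    show "AE \<tau> in lborel. \<tau> \<in> {0..T} \<longrightarrow>
      (\<lambda>k. \<bar>inner (q \<tau> k) (r \<tau> k)\<bar>) summable_on UNIV \<and>
      (\<Sum>\<^sub>\<infinity>k. \<bar>inner (q \<tau> k) (r \<tau> k)\<bar>) \<le> pairing_bound K (v1 \<tau>) + pairing_bound K (v2 \<tau>) \<and>
      (\<tau> \<in> {s..t} \<longrightarrow> 2 * (\<Sum>\<^sub>\<infinity>k. inner (q \<tau> k) (r \<tau> k)) \<le> ?f \<tau>)"
      using AE_inDA[OF T(1)]
    proof eventually_elim
      case (elim \<tau>)
      show ?case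
      proof
        assume \<tau>: "\<tau> \<in> {0..T}"
        then have \<tau>0: "\<tau> \<ge> 0" and DA: "inDA (v1 \<tau>)" "inDA (v2 \<tau>)" using elim by auto
        have V: "inV (v1 \<tau>)" "inV (v2 \<tau>)" and H: "inH (v1 \<tau>)" "inH (v2 \<tau>)" "inH (q \<tau>)"
          using inV_v[OF \<tau>0] inV_q[OF \<tau>0] by (auto simp: inV_iff)
        have nn: "\<nu> \<ge> 0" "mu1 \<ge> 0" using nu mu by auto
        note p1 = rhs_pairing[OF DA(1) V(1) H(2) inH_g(1)[OF \<tau>0] inH_D(4)[OF H(3)] inH_D(3)[OF H(3)] inH_D(1)[OF H(3)]
            nn mu(2) K0, of N]
        note p2 = rhs_pairing[OF DA(2) V(2) H(1) inH_g(2)[OF \<tau>0] inH_D(4)[OF H(3)] inH_D(3)[OF H(3)] inH_D(1)[OF H(3)]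
            nn mu(2) K0, of N]
        have s1: "(\<lambda>k. \<bar>inner (q \<tau> k) (R1 \<tau> k)\<bar>) summable_on UNIV" "(\<Sum>\<^sub>\<infinity>k. \<bar>inner (q \<tau> k) (R1 \<tau> k)\<bar>) \<le> pairing_bound K (v1 \<tau>)"
          and s2: "(\<lambda>k. \<bar>inner (q \<tau> k) (R2 \<tau> k)\<bar>) summable_on UNIV" "(\<Sum>\<^sub>\<infinity>k. \<bar>inner (q \<tau> k) (R2 \<tau> k)\<bar>) \<le> pairing_bound K (v2 \<tau>)"
          unfolding R1_def R2_def pairing_bound_def using K[OF \<tau>] by (intro p1 p2; simp)+
        have ss: "(\<lambda>k. \<bar>inner (q \<tau> k) (R1 \<tau> k)\<bar> + \<bar>inner (q \<tau> k) (R2 \<tau> k)\<bar>) summable_on UNIV"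
          by (intro summable_on_add s1 s2)
        have le: "\<bar>inner (q \<tau> k) (r \<tau> k)\<bar> \<le> \<bar>inner (q \<tau> k) (R1 \<tau> k)\<bar> + \<bar>inner (q \<tau> k) (R2 \<tau> k)\<bar>" for k
          unfolding qr inner_diff_right by (rule abs_triangle_ineq4)
        have a: "(\<lambda>k. \<bar>inner (q \<tau> k) (r \<tau> k)\<bar>) summable_on UNIV"
          by (rule summable_on_comparison_test[OF ss le]) auto
        have "(\<Sum>\<^sub>\<infinity>k. \<bar>inner (q \<tau> k) (r \<tau> k)\<bar>) \<le> (\<Sum>\<^sub>\<infinity>k. \<bar>inner (q \<tau> k) (R1 \<tau> k)\<bar> + \<bar>inner (q \<tau> k) (R2 \<tau> k)\<bar>)"
          by (intro infsum_mono a ss le)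
        also have "\<dots> \<le> pairing_bound K (v1 \<tau>) + pairing_bound K (v2 \<tau>)"
          using infsum_add[OF s1(1) s2(1)] s1(2) s2(2) by linarith
        finally have b: "(\<Sum>\<^sub>\<infinity>k. \<bar>inner (q \<tau> k) (r \<tau> k)\<bar>) \<le> pairing_bound K (v1 \<tau>) + pairing_bound K (v2 \<tau>)" .
        have a': "(\<lambda>k. inner (q \<tau> k) (R1 \<tau> k - R2 \<tau> k)) summable_on UNIV"
          unfolding qr[symmetric] by (rule abs_summable_summable) (use a in simp)
        \<comment> \<open>From |v1 - v2|^2 \<le> 2 (|v1|^2 + |v2|^2) and the uniform energy
          bound.\<close>
        have Y: "sqrt (msq (q \<tau>)) \<le> sqrt (2 * Emax)"
          using msq_q_le[OF \<tau>0] E_bounded[OF \<tau>0] by (intro real_sqrt_le_mono) linarith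
        have "2 * (\<Sum>\<^sub>\<infinity>k. inner (q \<tau> k) (r \<tau> k)) \<le> ?f \<tau>" if "\<tau> \<in> {s..t}"
        proof -
          have "\<tau> \<ge> s0" using that st by simp
          note e = \<epsilon>(1)[OF this] \<epsilon>(2)[OF this]
          show ?thesis unfolding qr
            using diff_rate[OF DA(1) V(1) DA(2) V(2) inH_g[OF \<tau>0] nu N CL e
                Y[unfolded q_def] a'[unfolded q_def R1_def R2_def]]
            unfolding M_def R1_def R2_def q_def .
        qed
        then show "(\<lambda>k. \<bar>inner (q \<tau> k) (r \<tau> k)\<bar>) summable_on UNIV \<and>
          (\<Sum>\<^sub>\<infinity>k. \<bar>inner (q \<tau> k) (r \<tau> k)\<bar>) \<le> pairing_bound K (v1 \<tau>) + pairing_bound K (v2 \<tau>) \<and>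
          (\<tau> \<in> {s..t} \<longrightarrow> 2 * (\<Sum>\<^sub>\<infinity>k. inner (q \<tau> k) (r \<tau> k)) \<le> ?f \<tau>)"
          using a b by blast
      qed
    qed
  qed (use s st T in auto)
qed

lemma q_tendsto_0:
  assumes large: "N \<ge> 4 * C_L * sqrt ((gfrak \<nu> g1)\<^sup>2 + (gfrak \<nu> g2)\<^sup>2)"
    and p: "((\<lambda>t. \<Sum>\<^sub>\<infinity>k. norm (projP N (\<lambda>k. v1 t k - v2 t k) k)) \<longlongrightarrow> 0) at_top"
    and g: "((\<lambda>t. sqrt (msq (\<lambda>k. g1 t k - g2 t k))) \<longlongrightarrow> 0) at_top"
  shows "((\<lambda>t. msq (q t)) \<longlongrightarrow> 0) at_top"
proof -
  \<comment> \<open>An artificial increase of the coefficient of \<open>M\<close>, which makes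
    \<kappa> positive even if the L4 constant contributes nothing. Its averaged effect \<eta> G /
    \<nu> is at most half of \<nu> N^2; the 1 in G + 1 avoids division by zero.\<close>
  define \<eta> where "\<eta> = \<nu>\<^sup>2 * N\<^sup>2 / (2 * (G + 1))"
  define \<kappa> where "\<kappa> = (2 * pi * max C_L 0)\<^sup>2 / \<nu> + \<eta>"
  define \<delta> where "\<delta> = \<nu> * N\<^sup>2 - \<kappa> * G / \<nu>"
  define Y where "Y = 2 * (2 + N) * sqrt (2 * Emax)"
  \<comment> \<open>Chosen so that \<theta> \<kappa> = Y: shifting the unknown by \<epsilon>
    \<theta> then produces the term \<epsilon> Y M. The price is the constant \<epsilon> \<theta>
    \<nu> N^2, collected in \<open>b\<close>.\<close>
  define \<theta> where "\<theta> = Y / \<kappa>"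
  \<comment> \<open>Deficit caused by the excess \<open>Emax\<close> in the integral bound for
    \<open>M\<close>; it is uniform in the time interval.\<close>
  define D where "D = \<kappa> * Emax / \<nu>"
  define b where "b = \<theta> * (\<nu> * N\<^sup>2) + Y"
  have G1: "G + 1 > 0" using G_nonneg by simp
  have \<eta>: "\<eta> > 0" unfolding \<eta>_def using nu N G1 by simp
  have \<kappa>: "\<kappa> > 0" unfolding \<kappa>_def using nu by (intro add_nonneg_pos \<eta>) simp
  have Emax0: "Emax \<ge> 0" unfolding Emax_def using E_nonneg G_nonneg nu by simp
  have Y0: "Y \<ge> 0" unfolding Y_def using N Emax0 by simp
  have \<theta>0: "\<theta> \<ge> 0" unfolding \<theta>_def using Y0 \<kappa> by simp
  have \<theta>\<kappa>: "\<theta> * \<kappa> = Y" unfolding \<theta>_def using \<kappa> by simp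
  have b0: "b \<ge> 0" unfolding b_def using \<theta>0 Y0 nu by simp
  \<comment> \<open>The factors of pi cancel between \<kappa> and \<open>G\<close>. The forces take
    at most \<nu> N^2 / 16 and \<eta> at most \<nu> N^2 / 2, which leaves at least 7/16 of \<nu>
    N^2.\<close>
  have \<delta>: "\<delta> > 0"
  proof -
    let ?g = "(gfrak \<nu> g1)\<^sup>2 + (gfrak \<nu> g2)\<^sup>2"
    have "4 * max C_L 0 * sqrt ?g \<le> N"
      using large N by (auto simp: max_def)
    then have "(4 * max C_L 0 * sqrt ?g)\<^sup>2 \<le> N\<^sup>2" by (intro power_mono) auto
    then have m: "16 * ((max C_L 0)\<^sup>2 * ?g) \<le> N\<^sup>2" by (simp add: power_mult_distrib)
    have "(2 * pi * max C_L 0)\<^sup>2 / \<nu> * G / \<nu> = \<nu> * ((max C_L 0)\<^sup>2 * ?g)"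
      unfolding G_def using nu by (simp add: power_mult_distrib power3_eq_cube field_simps)
    also have "\<dots> \<le> \<nu> * (N\<^sup>2 / 16)" using m nu by (intro mult_left_mono) auto
    finally have 1: "(2 * pi * max C_L 0)\<^sup>2 / \<nu> * G / \<nu> \<le> \<nu> * (N\<^sup>2 / 16)" .
    have "\<eta> * G / \<nu> = \<nu> * N\<^sup>2 / 2 * (G / (G + 1))"
      unfolding \<eta>_def using nu by (simp add: power2_eq_square)
    also have "\<dots> \<le> \<nu> * N\<^sup>2 / 2 * 1"
      using nu G_nonneg by (intro mult_left_mono) auto
    finally have 2: "\<eta> * G / \<nu> \<le> \<nu> * N\<^sup>2 / 2 * 1" .
    have "\<kappa> * G / \<nu> = (2 * pi * max C_L 0)\<^sup>2 / \<nu> * G / \<nu> + \<eta> * G / \<nu>"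
      by (simp only: \<kappa>_def add_divide_distrib distrib_right)
    with 1 2 have "\<kappa> * G / \<nu> \<le> \<nu> * N\<^sup>2 * (9 / 16)" by linarith
    moreover have "\<nu> * N\<^sup>2 > 0" using nu N by simp
    ultimately show ?thesis unfolding \<delta>_def by linarith
  qed
  have bound: "\<forall>\<^sub>F t in at_top. msq (q t) < \<gamma>" if \<gamma>: "\<gamma> > 0" for \<gamma>
  proof -
    \<comment> \<open>Once the initial contribution is below \<epsilon>, Gronwall gives \<epsilon>
      exp D (1 + b / \<delta>), which equals \<gamma> / 2.\<close>
    define \<epsilon> where "\<epsilon> = \<gamma> / (2 * (exp D * (1 + b / \<delta>)))"
    have pos: "exp D * (1 + b / \<delta>) > 0"
      using b0 \<delta> by (intro mult_pos_pos add_pos_nonneg) auto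
    have \<epsilon>0: "\<epsilon> > 0" unfolding \<epsilon>_def using \<gamma> pos by simp
    have "\<forall>\<^sub>F t in at_top. 0 \<le> t \<and> (\<Sum>\<^sub>\<infinity>k. norm (projP N (\<lambda>k. v1 t k - v2 t k) k)) < \<epsilon>
        \<and> sqrt (msq (\<lambda>k. g1 t k - g2 t k)) < \<epsilon>"
      by (intro eventually_conj eventually_ge_at_top order_tendstoD(2)[OF p \<epsilon>0] order_tendstoD(2)[OF g \<epsilon>0])
    then obtain s0 where s0: "\<And>t. t \<ge> s0 \<Longrightarrow> 0 \<le> t \<and> (\<Sum>\<^sub>\<infinity>k. norm (projP N (\<lambda>k. v1 t k - v2 t k) k)) < \<epsilon>
        \<and> sqrt (msq (\<lambda>k. g1 t k - g2 t k)) < \<epsilon>"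
      unfolding eventually_at_top_linorder by blast
    have s00: "s0 \<ge> 0" using s0[of s0] by simp
    text \<open>Adding the constant \<open>\<epsilon> * \<theta>\<close> absorbs the forcing term proportional to \<open>M\<close>,
      which is not bounded in time, into the linear term of the differential inequality.\<close>
    define z where "z t = msq (q t) + \<epsilon> * \<theta>" for t
    have zb: "z t \<le> exp D * (exp (- \<delta> * (t - s0)) * z s0 + (\<epsilon> * b) / \<delta>)" if t: "t \<ge> s0" for t
    proof (rule gronwall_decay[where a = "\<lambda>\<tau>. \<nu> * N\<^sup>2 - \<kappa> * M \<tau>"])
      show "continuous_on {s0..t} z"
        unfolding z_def by (intro continuous_intros continuous_on_q s00)
      show "continuous_on {s0..t} (\<lambda>\<tau>. \<nu> * N\<^sup>2 - \<kappa> * M \<tau>)"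
        by (intro continuous_intros continuous_on_M s00)
      show "0 \<le> \<epsilon> * b" using \<epsilon>0 b0 by simp
      show "0 \<le> z s0" unfolding z_def using \<epsilon>0 \<theta>0 by simp
      fix r assume r: "s0 \<le> r" "r \<le> t"
      have r0: "0 \<le> r" using r s00 by simp
      have "\<nu> * (\<kappa> * integral {r..t} M) = \<kappa> * (\<nu> * integral {r..t} M)" by (simp add: mult_ac)
      also have "\<dots> \<le> \<kappa> * (G * (t - r) + Emax)"
        using integral_M_le[OF r0 r(2)] \<kappa> by (intro mult_left_mono) auto
      finally have "\<kappa> * integral {r..t} M \<le> \<kappa> * (G * (t - r) + Emax) / \<nu>"
        using nu by (simp add: field_simps)
      moreover have "integral {r..t} (\<lambda>\<tau>. \<nu> * N\<^sup>2 - \<kappa> * M \<tau>) = \<nu> * N\<^sup>2 * (t - r) - \<kappa> * integral {r..t} M"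
        using r r0 by (subst Henstock_Kurzweil_Integration.integral_diff)
          (auto intro!: integrable_M integrable_on_mult_right simp: mult.commute)
      moreover have "\<delta> * (t - r) - D = \<nu> * N\<^sup>2 * (t - r) - \<kappa> * (G * (t - r) + Emax) / \<nu>"
        by (simp add: \<delta>_def D_def algebra_simps add_divide_distrib diff_divide_distrib)
      ultimately show "\<delta> * (t - r) - D \<le> integral {r..t} (\<lambda>\<tau>. \<nu> * N\<^sup>2 - \<kappa> * M \<tau>)" by linarith
    next
      fix r r' assume r: "s0 \<le> r" "r \<le> r'" "r' \<le> t"
      have r0: "0 \<le> r" using r s00 by simp
      have "z r' - z r = msq (q r') - msq (q r)" by (simp add: z_def)
      also have "\<dots> \<le> integral {r..r'} (\<lambda>\<tau>. - (\<nu> * N\<^sup>2 - (2 * pi * max C_L 0)\<^sup>2 / \<nu> * M \<tau>) * msq (q \<tau>)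
          + \<epsilon> * (2 * (2 + N) * sqrt (2 * Emax)) * (1 + M \<tau>))"
        using s0 by (intro q_increment[OF s00 r(1,2)]) (auto intro: less_imp_le)
      also have "\<dots> \<le> integral {r..r'} (\<lambda>\<tau>. \<epsilon> * b - (\<nu> * N\<^sup>2 - \<kappa> * M \<tau>) * z \<tau>)"
      proof (rule integral_le)
        show "(\<lambda>\<tau>. - (\<nu> * N\<^sup>2 - (2 * pi * max C_L 0)\<^sup>2 / \<nu> * M \<tau>) * msq (q \<tau>)
          + \<epsilon> * (2 * (2 + N) * sqrt (2 * Emax)) * (1 + M \<tau>)) integrable_on {r..r'}"
          by (intro integrable_continuous_real continuous_intros continuous_on_M continuous_on_q r0)
        show "(\<lambda>\<tau>. \<epsilon> * b - (\<nu> * N\<^sup>2 - \<kappa> * M \<tau>) * z \<tau>) integrable_on {r..r'}"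
          unfolding z_def
          by (intro integrable_continuous_real continuous_intros continuous_on_M continuous_on_q r0)
        fix \<tau>
        have "\<epsilon> * b - (\<nu> * N\<^sup>2 - \<kappa> * M \<tau>) * z \<tau>
          = - (\<nu> * N\<^sup>2 - \<kappa> * M \<tau>) * msq (q \<tau>) + \<epsilon> * Y + \<epsilon> * (\<theta> * \<kappa>) * M \<tau>"
          by (simp add: b_def z_def algebra_simps)
        also have "\<dots> = - (\<nu> * N\<^sup>2 - \<kappa> * M \<tau>) * msq (q \<tau>) + \<epsilon> * Y * (1 + M \<tau>)"
          unfolding \<theta>\<kappa> by (simp add: algebra_simps)
        also have "\<dots> = - (\<nu> * N\<^sup>2 - (2 * pi * max C_L 0)\<^sup>2 / \<nu> * M \<tau>) * msq (q \<tau>) + \<epsilon> * Y * (1 + M \<tau>)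
          + \<eta> * (M \<tau> * msq (q \<tau>))"
          unfolding \<kappa>_def by (simp add: algebra_simps)
        finally show "- (\<nu> * N\<^sup>2 - (2 * pi * max C_L 0)\<^sup>2 / \<nu> * M \<tau>) * msq (q \<tau>)
          + \<epsilon> * (2 * (2 + N) * sqrt (2 * Emax)) * (1 + M \<tau>) \<le> \<epsilon> * b - (\<nu> * N\<^sup>2 - \<kappa> * M \<tau>) * z \<tau>"
          using mult_nonneg_nonneg[OF less_imp_le[OF \<eta>] mult_nonneg_nonneg[OF M_nonneg[of \<tau>] msq_nonneg[of "q \<tau>"]]]
          unfolding Y_def by linarith
      qed
      finally show "z r' - z r \<le> integral {r..r'} (\<lambda>\<tau>. \<epsilon> * b - (\<nu> * N\<^sup>2 - \<kappa> * M \<tau>) * z \<tau>)" .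
    qed (use t \<delta> in auto)
    have "filterlim (\<lambda>t. - \<delta> * (- s0 + t)) at_bot at_top"
      using \<delta> by (intro filterlim_tendsto_neg_mult_at_bot[OF tendsto_const]
          filterlim_tendsto_add_at_top[OF tendsto_const] filterlim_ident) auto
    then have "filterlim (\<lambda>t. - \<delta> * (t - s0)) at_bot at_top" by (simp add: algebra_simps)
    then have "((\<lambda>t. exp (- \<delta> * (t - s0)) * z s0) \<longlongrightarrow> 0) at_top"
      by (intro tendsto_mult_left_zero filterlim_compose[OF exp_at_bot])
    from order_tendstoD(2)[OF this \<epsilon>0]
    have "\<forall>\<^sub>F t in at_top. exp (- \<delta> * (t - s0)) * z s0 < \<epsilon>" .
    then show ?thesis
      using eventually_ge_at_top[of s0]
    proof eventually_elim
      case (elim t)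
      have "msq (q t) \<le> z t" unfolding z_def using \<epsilon>0 \<theta>0 by simp
      also have "\<dots> \<le> exp D * (exp (- \<delta> * (t - s0)) * z s0 + (\<epsilon> * b) / \<delta>)" by (rule zb[OF elim(2)])
      also have "\<dots> \<le> exp D * (\<epsilon> + (\<epsilon> * b) / \<delta>)" using elim(1) by (intro mult_left_mono) auto
      also have "\<dots> = \<epsilon> * (exp D * (1 + b / \<delta>))" by (simp add: algebra_simps)
      also have "\<dots> = \<gamma> / 2"
      proof -
        have "\<gamma> / (2 * c) * c = \<gamma> / 2" if "c > 0" for c :: real using that by simp
        from this[OF pos] show ?thesis unfolding \<epsilon>_def .
      qed
      finally show ?case using \<gamma> by simp
    qed
  qed
  show ?thesis
  proof (rule order_tendstoI)
    show "\<forall>\<^sub>F t in at_top. a < msq (q t)" if "a < 0" for a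
      using less_le_trans[OF that msq_nonneg] by (intro always_eventually) blast
  qed (rule bound)
qed

end

section \<open>Recombination of low and high modes\<close>

theorem theorem3p16:
  fixes \<nu> mu1 mu2 N C_L :: real
    and g1 g2 v1 v2 :: "real \<Rightarrow> vfield"
  assumes "\<nu> > 0"
    and "mu1 \<ge> mu2" and "mu2 \<ge> 0" and "N > 0"
    and "\<forall>u. inV u \<longrightarrow> L4sq u \<le> C_L * normV u * normH u"
    and "Linf_H g1" and "Linf_H g2"
    and "nudging_solution \<nu> mu1 mu2 N g1 g2 v1 v2"
    and "N \<ge> 4 * C_L * sqrt ((gfrak \<nu> g1)\<^sup>2 + (gfrak \<nu> g2)\<^sup>2)"
    and "((\<lambda>t. normH (vdiff (projP N (v1 t)) (projP N (v2 t)))) \<longlongrightarrow> 0) at_top"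
    and "((\<lambda>t. normH (vdiff (g1 t) (g2 t))) \<longlongrightarrow> 0) at_top"
  shows "((\<lambda>t. normH (vdiff (v1 t) (v2 t))) \<longlongrightarrow> 0) at_top"
proof -
  interpret nudging_pair \<nu> mu1 mu2 N C_L g1 g2 v1 v2
    using assms by unfold_locales
  define w where "w t = (\<lambda>k. v1 t k - v2 t k)" for t
  have to_sqrt: "((\<lambda>t. sqrt (msq (u t))) \<longlongrightarrow> 0) at_top" if "((\<lambda>t. normH (u t)) \<longlongrightarrow> 0) at_top" for u
    using tendsto_mult_left[OF that, of "1 / (2 * pi)"] by (simp add: normH_eq)
  have pe: "vdiff (projP N (v1 t)) (projP N (v2 t)) = projP N (w t)" for t
    by (auto simp: vdiff_eq projP_eq w_def)
  have p: "((\<lambda>t. sqrt (msq (projP N (w t)))) \<longlongrightarrow> 0) at_top"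
    using to_sqrt[OF assms(10)] unfolding pe .
  have g: "((\<lambda>t. sqrt (msq (\<lambda>k. g1 t k - g2 t k))) \<longlongrightarrow> 0) at_top"
    using to_sqrt[OF assms(11)] unfolding vdiff_eq .
  have l2w: "l2 (w t)" if "t \<ge> 0" for t
    unfolding w_def by (intro l2_diff(1) l2_v that)
  \<comment> \<open>Only finitely many low modes exist, so L2 synchronization of P_N v1 and P_N v2
    makes the sum of moduli of their coefficient differences vanish.\<close>
  have p1: "((\<lambda>t. \<Sum>\<^sub>\<infinity>k. norm (projP N (w t) k)) \<longlongrightarrow> 0) at_top"
  proof (rule Lim_null_comparison)
    let ?c = "real (card {k. k \<noteq> 0 \<and> sqrt (ksq k) \<le> N})"
    show "((\<lambda>t. ?c * sqrt (msq (projP N (w t)))) \<longlongrightarrow> 0) at_top"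
      using tendsto_mult_left[OF p, of ?c] by simp
    show "\<forall>\<^sub>F t in at_top. norm (\<Sum>\<^sub>\<infinity>k. norm (projP N (w t) k)) \<le> ?c * sqrt (msq (projP N (w t)))"
      using eventually_ge_at_top[of 0]
    proof eventually_elim
      case (elim t)
      then show ?case using projP_l1(2)[OF l2w, of t N] by (simp add: infsum_nonneg)
    qed
  qed
  have q0: "((\<lambda>t. msq (q t)) \<longlongrightarrow> 0) at_top"
    by (rule q_tendsto_0[OF assms(9) p1[unfolded w_def] g])
  have "((\<lambda>t. 2 * (sqrt (msq (projP N (w t))))\<^sup>2 + 2 * msq (q t)) \<longlongrightarrow> 2 * 0\<^sup>2 + 2 * 0) at_top"
    by (intro tendsto_intros p q0)
  then have lim: "((\<lambda>t. 2 * msq (projP N (w t)) + 2 * msq (q t)) \<longlongrightarrow> 0) at_top" by simp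
  have "((\<lambda>t. msq (w t)) \<longlongrightarrow> 0) at_top"
  proof (rule Lim_null_comparison[OF _ lim])
    show "\<forall>\<^sub>F t in at_top. norm (msq (w t)) \<le> 2 * msq (projP N (w t)) + 2 * msq (q t)"
      using eventually_ge_at_top[of 0]
    proof eventually_elim
      case (elim t)
      have w0: "w t 0 = 0" using inV_v[OF elim] by (simp add: w_def inV_iff inH_D)
      have "l2 (projP N (w t))" by (rule msq_mono(1)[OF l2w[OF elim]]) (simp add: projP_eq)
      \<comment> \<open>The sum p + q is written as p - (-q) to apply the norm bound for
        differences.\<close>
      moreover have "l2 (\<lambda>k. - q t k)" "msq (\<lambda>k. - q t k) = msq (q t)"
        using inV_q[OF elim] by (auto simp: inV_iff l2_def msq_def dest: inH_D(4))
      moreover have "w t = (\<lambda>k. projP N (w t) k - - q t k)"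
        using projP_plus_highP[of "w t" N] w0 by (simp add: q_def w_def)
      ultimately show ?case using l2_diff(2)[of "projP N (w t)" "\<lambda>k. - q t k"] by simp
    qed
  qed
  then have "((\<lambda>t. 2 * pi * sqrt (msq (w t))) \<longlongrightarrow> 2 * pi * sqrt 0) at_top"
    by (intro tendsto_intros)
  then show ?thesis by (simp add: normH_eq vdiff_eq w_def)
qed

end
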